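(* Let $\mathcal V$ be an extensive, cartesian closed category with pullbacks, $\mathcal G$ a conservative family of objects in $\mathcal V$, $\mathcal C$ a $\mathcal V$-category, and $F\colon\mathcal C^{\mathrm{op}}\to\mathcal V$ a $\mathcal V$-functor. Given a pair $(C,x)$ of an object $C\in\mathcal C$ and an element $x\colon\ast\to FC$ in $\mathcal V$, the following are equivalent: (i) the $\mathcal V$-functor $F$ is $\mathcal V$-representable by $(C,x)$; (ii) for every object $X\in\mathcal G$, the pair $(C,x)$ is a $\mathcal V$-terminal object in the $\mathcal V$-category of generalized elements $\mathrm{Und}\llbracket\mathrm{cst}X,\int_{\mathcal C}F\rrbracket$.
   Context: Extensive: $\mathcal V$ has all small coproducts and for every set $I$ and family $\{X_i\}_{i\in I}$ the functor $\bigsqcup_{i\in I}\colon\prod_{i\in I}\mathcal V_{/X_i}\to\mathcal V_{/\bigsqcup_i X_i}$ is an equivalence. $\ast$ is the terminal object, $[X,Y]$ the internal hom of $\mathcal V$, $\iota$ denotes coproduct inclusions. A family $\mathcal G$ of objects is conservative if a map $f\colon Y\to Z$ in $\mathcal V$ is an isomorphism if and only if $f_*\colon\mathcal V(X,Y)\to\mathcal V(X,Z)$ is a bijection for every $X\in\mathcal G$. $\mathcal V$-categories are enriched over the cartesian structure, have a set of objects, composition $c_{A,B,C}\colon\mathcal C(A,B)\times\mathcal C(B,C)\to\mathcal C(A,C)$ and identities $i_A\colon\ast\to\mathcal C(A,A)$. For $F\colon\mathcal C^{\mathrm{op}}\to\mathcal V$, $\mathrm{ev}^F_{A,B}\colon\mathcal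 C(A,B)\times FB\to FA$ is the transpose of $\mathcal C(A,B)\to[FB,FA]$. $F$ is $\mathcal V$-representable by $(C,x)$ if the $\mathcal V$-natural transformation $\alpha_x\colon\mathcal C(-,C)\Rightarrow F$ corresponding to $x$ under the enriched Yoneda lemma is an isomorphism. An object $T$ of a $\mathcal V$-category $\mathcal D$ is $\mathcal V$-terminal if $\mathcal D(A,T)\to\ast$ is an isomorphism for every $A\in\mathcal D$. An internal category $\mathbb A$ to $\mathcal V$ consists of objects $\mathbb A_0,\mathbb A_1$ with maps $s,t\colon\mathbb A_1\to\mathbb A_0$, $i\colon\mathbb A_0\to\mathbb A_1$, $c\colon\mathbb A_1\times_{\mathbb A_0}\mathbb A_1\to\mathbb A_1$ satisfying the usual axioms; with internal functors these form $\mathrm{Cat}(\mathcal V)$, cartesian closed with internal hom $\llbracket-,-\rrbracket$. $\mathrm{cst}X$ is the internal category with $(\mathrm{cst}X)_0=(\mathrm{cst}X)_1=X$ and all structure maps identities; $\ast=\mathrm{cst}\ast$ is terminal; elements of $\mathbb A$ are internal functors $\ast\to\mathbb A$, i.e. maps $\ast\to\mathbb A_0$. The underlying $\mathcal V$-category $\mathrm{Und}\,\mathbb A$ has as objects the maps $A\colon\ast\to\mathbb A_0$ in $\mathcal V$, as hom-object $\mathrm{Und}\,\mathbb A(A,B)$ the pullback of $(s,t)\colon\mathbb A_1\to\mathbb A_0\times\mathbb A_0$ along $(A,B)\colon\ast\to\mathbb A_0\times\mathbb A_0$, and composition and identities induced from $\mathbb A$. $\int_{\mathcal C}F$ has $(\int_{\mathcal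 C}F)_0=\bigsqcup_{A}FA$, $(\int_{\mathcal C}F)_1=\bigsqcup_{A,B}\mathcal C(A,B)\times FB$; on the $(A,B)$ summand, $s$ is $\mathrm{ev}^F_{A,B}$ into $FA$ and $t$ is the projection onto $FB$; identity is induced by $i_A\times\mathrm{id}_{FA}$ and composition by $c_{A,B,C}\times\mathrm{id}_{FC}$. The pair $(C,x)$ is the element $\ast\xrightarrow{x}FC\xrightarrow{\iota_C}(\int_{\mathcal C}F)_0$, and is regarded as an object of $\mathrm{Und}\llbracket\mathrm{cst}X,\int_{\mathcal C}F\rrbracket$ by post-composing with $!^*\colon\int_{\mathcal C}F\to\llbracket\mathrm{cst}X,\int_{\mathcal C}F\rrbracket$ induced by $!\colon\mathrm{cst}X\to\ast$. *)

theory Defs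
  imports Main "HOL-Library.FuncSet"
begin

section \<open>Categories\<close>

record ('o, 'a) cat =
  Obj :: "'o set"
  Arr :: "'a set"
  Dom :: "'a \<Rightarrow> 'o"
  Cod :: "'a \<Rightarrow> 'o"
  Ident :: "'o \<Rightarrow> 'a"
  Comp :: "'a \<Rightarrow> 'a \<Rightarrow> 'a"  (infixr "\<cdot>\<index>" 55)

definition Hom :: "('o, 'a) cat \<Rightarrow> 'o \<Rightarrow> 'o \<Rightarrow> 'a set" where
  "Hom V X Y = {f \<in> Arr V. Dom V f = X \<and> Cod V f = Y}"

locale category =
  fixes V :: "('o, 'a) cat" (structure)
  assumes dom_in_Obj: "f \<in> Arr V \<Longrightarrow> Dom V f \<in> Obj V"
    and cod_in_Obj: "f \<in> Arr V \<Longrightarrow> Cod V f \<in> Obj V"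
    and ident_in_Hom: "X \<in> Obj V \<Longrightarrow> Ident V X \<in> Hom V X X"
    and comp_in_Hom: "f \<in> Hom V X Y \<Longrightarrow> g \<in> Hom V Y Z \<Longrightarrow> g \<cdot> f \<in> Hom V X Z"
    and comp_ident_left: "f \<in> Hom V X Y \<Longrightarrow> Ident V Y \<cdot> f = f"
    and comp_ident_right: "f \<in> Hom V X Y \<Longrightarrow> f \<cdot> Ident V X = f"
    and comp_assoc: "f \<in> Hom V W X \<Longrightarrow> g \<in> Hom V X Y \<Longrightarrow> h \<in> Hom V Y Z \<Longrightarrow>
      (h \<cdot> g) \<cdot> f = h \<cdot> (g \<cdot> f)"

definition is_iso :: "('o, 'a) cat \<Rightarrow> 'a \<Rightarrow> bool" where
  "is_iso V f \<longleftrightarrow> f \<in> Arr V \<and>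
    (\<exists>g \<in> Hom V (Cod V f) (Dom V f).
      g \<cdot>\<^bsub>V\<^esub> f = Ident V (Dom V f) \<and> f \<cdot>\<^bsub>V\<^esub> g = Ident V (Cod V f))"

definition conservative_family :: "('o, 'a) cat \<Rightarrow> 'o set \<Rightarrow> bool" where
  "conservative_family V G \<longleftrightarrow> G \<subseteq> Obj V \<and>
    (\<forall>Y Z f. f \<in> Hom V Y Z \<longrightarrow>
      (is_iso V f \<longleftrightarrow>
        (\<forall>X\<in>G. bij_betw (\<lambda>u. f \<cdot>\<^bsub>V\<^esub> u) (Hom V X Y) (Hom V X Z))))"


section \<open>Equivalences of categories\<close>

record ('o, 'a, 'p, 'b) ftor =
  FObj :: "'o \<Rightarrow> 'p"
  FArr :: "'a \<Rightarrow> 'b"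

definition is_functor ::
    "('o, 'a) cat \<Rightarrow> ('p, 'b) cat \<Rightarrow> ('o, 'a, 'p, 'b) ftor \<Rightarrow> bool" where
  "is_functor A B F \<longleftrightarrow>
    (\<forall>X\<in>Obj A. FObj F X \<in> Obj B) \<and>
    (\<forall>X Y f. f \<in> Hom A X Y \<longrightarrow> FArr F f \<in> Hom B (FObj F X) (FObj F Y)) \<and>
    (\<forall>X\<in>Obj A. FArr F (Ident A X) = Ident B (FObj F X)) \<and>
    (\<forall>X Y Z f g. f \<in> Hom A X Y \<longrightarrow> g \<in> Hom A Y Z \<longrightarrow>
      FArr F (g \<cdot>\<^bsub>A\<^esub> f) = FArr F g \<cdot>\<^bsub>B\<^esub> FArr F f)"

definition id_ftor :: "('o, 'a, 'o, 'a) ftor" where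
  "id_ftor = \<lparr>FObj = (\<lambda>X. X), FArr = (\<lambda>f. f)\<rparr>"

definition comp_ftor ::
    "('p, 'b, 'q, 'c) ftor \<Rightarrow> ('o, 'a, 'p, 'b) ftor \<Rightarrow> ('o, 'a, 'q, 'c) ftor" where
  "comp_ftor G F = \<lparr>FObj = FObj G \<circ> FObj F, FArr = FArr G \<circ> FArr F\<rparr>"

definition is_natural_iso ::
    "('o, 'a) cat \<Rightarrow> ('p, 'b) cat \<Rightarrow> ('o, 'a, 'p, 'b) ftor \<Rightarrow> ('o, 'a, 'p, 'b) ftor \<Rightarrow>
      ('o \<Rightarrow> 'b) \<Rightarrow> bool" where
  "is_natural_iso A B F G \<eta> \<longleftrightarrow>
    (\<forall>X\<in>Obj A. \<eta> X \<in> Hom B (FObj F X) (FObj G X) \<and> is_iso B (\<eta> X)) \<and>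
    (\<forall>X Y f. f \<in> Hom A X Y \<longrightarrow> \<eta> Y \<cdot>\<^bsub>B\<^esub> FArr F f = FArr G f \<cdot>\<^bsub>B\<^esub> \<eta> X)"

definition is_equivalence ::
    "('o, 'a) cat \<Rightarrow> ('p, 'b) cat \<Rightarrow> ('o, 'a, 'p, 'b) ftor \<Rightarrow> bool" where
  "is_equivalence A B F \<longleftrightarrow> is_functor A B F \<and>
    (\<exists>G. is_functor B A G \<and>
      (\<exists>\<eta>. is_natural_iso A A id_ftor (comp_ftor G F) \<eta>) \<and>
      (\<exists>\<epsilon>. is_natural_iso B B (comp_ftor F G) id_ftor \<epsilon>))"

text \<open>An arrow of the slice category is a triple \<open>(f, h, g)\<close> with \<open>g \<cdot> h = f\<close>, regarded
  as the arrow \<open>h\<close> from the object \<open>f\<close> to the object \<open>g\<close>.\<close>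

definition slice :: "('o, 'a) cat \<Rightarrow> 'o \<Rightarrow> ('a, 'a \<times> 'a \<times> 'a) cat" where
  "slice V X =
    \<lparr>Obj = {f \<in> Arr V. Cod V f = X},
     Arr = {(f, h, g). f \<in> Arr V \<and> Cod V f = X \<and> g \<in> Arr V \<and> Cod V g = X \<and>
              h \<in> Hom V (Dom V f) (Dom V g) \<and> g \<cdot>\<^bsub>V\<^esub> h = f},
     Dom = (\<lambda>(f, h, g). f),
     Cod = (\<lambda>(f, h, g). g),
     Ident = (\<lambda>f. (f, Ident V (Dom V f), f)),
     Comp = (\<lambda>(f', h', g') (f, h, g). (f, h' \<cdot>\<^bsub>V\<^esub> h, g'))\<rparr>"

definition product_cat ::
    "'i set \<Rightarrow> ('i \<Rightarrow> ('o, 'a) cat) \<Rightarrow> ('i \<Rightarrow> 'o, 'i \<Rightarrow> 'a) cat" where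
  "product_cat I K =
    \<lparr>Obj = (\<Pi>\<^sub>E i\<in>I. Obj (K i)),
     Arr = (\<Pi>\<^sub>E i\<in>I. Arr (K i)),
     Dom = (\<lambda>a. \<lambda>i\<in>I. Dom (K i) (a i)),
     Cod = (\<lambda>a. \<lambda>i\<in>I. Cod (K i) (a i)),
     Ident = (\<lambda>X. \<lambda>i\<in>I. Ident (K i) (X i)),
     Comp = (\<lambda>b a. \<lambda>i\<in>I. b i \<cdot>\<^bsub>K i\<^esub> a i)\<rparr>"


section \<open>Limits, exponentials and coproducts\<close>

text \<open>Each universal construction is a choice by \<open>SOME\<close> among all objects that have the
  universal property, and each induced arrow is given by \<open>THE\<close>; they are meaningful only
  where the object in question exists.\<close>

definition is_terminal :: "('o, 'a) cat \<Rightarrow> 'o \<Rightarrow> bool" where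
  "is_terminal V T \<longleftrightarrow> T \<in> Obj V \<and> (\<forall>X\<in>Obj V. \<exists>!f. f \<in> Hom V X T)"

definition terminal :: "('o, 'a) cat \<Rightarrow> 'o" where
  "terminal V = (SOME T. is_terminal V T)"

definition bang :: "('o, 'a) cat \<Rightarrow> 'o \<Rightarrow> 'a" where
  "bang V X = (THE f. f \<in> Hom V X (terminal V))"

definition is_product :: "('o, 'a) cat \<Rightarrow> 'o \<Rightarrow> 'o \<Rightarrow> 'o \<times> 'a \<times> 'a \<Rightarrow> bool" where
  "is_product V X Y = (\<lambda>(P, p, q). p \<in> Hom V P X \<and> q \<in> Hom V P Y \<and>
    (\<forall>Z f g. f \<in> Hom V Z X \<longrightarrow> g \<in> Hom V Z Y \<longrightarrow>
      (\<exists>!h. h \<in> Hom V Z P \<and> p \<cdot>\<^bsub>V\<^esub> h = f \<and> q \<cdot>\<^bsub>V\<^esub> h = g)))"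

definition product_cone :: "('o, 'a) cat \<Rightarrow> 'o \<Rightarrow> 'o \<Rightarrow> 'o \<times> 'a \<times> 'a" where
  "product_cone V X Y = (SOME c. is_product V X Y c)"

definition product :: "('o, 'a) cat \<Rightarrow> 'o \<Rightarrow> 'o \<Rightarrow> 'o" where
  "product V X Y = fst (product_cone V X Y)"

definition pr1 :: "('o, 'a) cat \<Rightarrow> 'o \<Rightarrow> 'o \<Rightarrow> 'a" where
  "pr1 V X Y = fst (snd (product_cone V X Y))"

definition pr2 :: "('o, 'a) cat \<Rightarrow> 'o \<Rightarrow> 'o \<Rightarrow> 'a" where
  "pr2 V X Y = snd (snd (product_cone V X Y))"

definition pairing :: "('o, 'a) cat \<Rightarrow> 'a \<Rightarrow> 'a \<Rightarrow> 'a" where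
  "pairing V f g = (THE h. h \<in> Hom V (Dom V f) (product V (Cod V f) (Cod V g)) \<and>
    pr1 V (Cod V f) (Cod V g) \<cdot>\<^bsub>V\<^esub> h = f \<and> pr2 V (Cod V f) (Cod V g) \<cdot>\<^bsub>V\<^esub> h = g)"

definition prod_map :: "('o, 'a) cat \<Rightarrow> 'a \<Rightarrow> 'a \<Rightarrow> 'a" where
  "prod_map V f g = pairing V (f \<cdot>\<^bsub>V\<^esub> pr1 V (Dom V f) (Dom V g))
                              (g \<cdot>\<^bsub>V\<^esub> pr2 V (Dom V f) (Dom V g))"

definition is_pullback :: "('o, 'a) cat \<Rightarrow> 'a \<Rightarrow> 'a \<Rightarrow> 'o \<times> 'a \<times> 'a \<Rightarrow> bool" where
  "is_pullback V f g = (\<lambda>(P, p, q).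
    p \<in> Hom V P (Dom V f) \<and> q \<in> Hom V P (Dom V g) \<and> f \<cdot>\<^bsub>V\<^esub> p = g \<cdot>\<^bsub>V\<^esub> q \<and>
    (\<forall>Z u v. u \<in> Hom V Z (Dom V f) \<longrightarrow> v \<in> Hom V Z (Dom V g) \<longrightarrow>
      f \<cdot>\<^bsub>V\<^esub> u = g \<cdot>\<^bsub>V\<^esub> v \<longrightarrow>
      (\<exists>!h. h \<in> Hom V Z P \<and> p \<cdot>\<^bsub>V\<^esub> h = u \<and> q \<cdot>\<^bsub>V\<^esub> h = v)))"

definition has_pullbacks :: "('o, 'a) cat \<Rightarrow> bool" where
  "has_pullbacks V \<longleftrightarrow>
    (\<forall>f\<in>Arr V. \<forall>g\<in>Arr V. Cod V f = Cod V g \<longrightarrow> (\<exists>c. is_pullback V f g c))"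

definition pullback_cone :: "('o, 'a) cat \<Rightarrow> 'a \<Rightarrow> 'a \<Rightarrow> 'o \<times> 'a \<times> 'a" where
  "pullback_cone V f g = (SOME c. is_pullback V f g c)"

definition pullback :: "('o, 'a) cat \<Rightarrow> 'a \<Rightarrow> 'a \<Rightarrow> 'o" where
  "pullback V f g = fst (pullback_cone V f g)"

definition pb1 :: "('o, 'a) cat \<Rightarrow> 'a \<Rightarrow> 'a \<Rightarrow> 'a" where
  "pb1 V f g = fst (snd (pullback_cone V f g))"

definition pb2 :: "('o, 'a) cat \<Rightarrow> 'a \<Rightarrow> 'a \<Rightarrow> 'a" where
  "pb2 V f g = snd (snd (pullback_cone V f g))"

definition pb_lift :: "('o, 'a) cat \<Rightarrow> 'a \<Rightarrow> 'a \<Rightarrow> 'a \<Rightarrow> 'a \<Rightarrow> 'a" where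
  "pb_lift V f g u v = (THE h. h \<in> Hom V (Dom V u) (pullback V f g) \<and>
    pb1 V f g \<cdot>\<^bsub>V\<^esub> h = u \<and> pb2 V f g \<cdot>\<^bsub>V\<^esub> h = v)"

definition is_exponential :: "('o, 'a) cat \<Rightarrow> 'o \<Rightarrow> 'o \<Rightarrow> 'o \<times> 'a \<Rightarrow> bool" where
  "is_exponential V X Y = (\<lambda>(E, e). E \<in> Obj V \<and> e \<in> Hom V (product V E X) Y \<and>
    (\<forall>Z\<in>Obj V. \<forall>f \<in> Hom V (product V Z X) Y.
      \<exists>!h. h \<in> Hom V Z E \<and> e \<cdot>\<^bsub>V\<^esub> prod_map V h (Ident V X) = f))"

definition cartesian_closed :: "('o, 'a) cat \<Rightarrow> bool" where
  "cartesian_closed V \<longleftrightarrow>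
    (\<exists>T. is_terminal V T) \<and>
    (\<forall>X\<in>Obj V. \<forall>Y\<in>Obj V. \<exists>c. is_product V X Y c) \<and>
    (\<forall>X\<in>Obj V. \<forall>Y\<in>Obj V. \<exists>c. is_exponential V X Y c)"

definition exponential :: "('o, 'a) cat \<Rightarrow> 'o \<Rightarrow> 'o \<Rightarrow> 'o \<times> 'a" where
  "exponential V X Y = (SOME c. is_exponential V X Y c)"

text \<open>\<open>exponent V X Y\<close> is the internal hom \<open>[X, Y]\<close>.\<close>

definition exponent :: "('o, 'a) cat \<Rightarrow> 'o \<Rightarrow> 'o \<Rightarrow> 'o" where
  "exponent V X Y = fst (exponential V X Y)"

definition evalmap :: "('o, 'a) cat \<Rightarrow> 'o \<Rightarrow> 'o \<Rightarrow> 'a" where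
  "evalmap V X Y = snd (exponential V X Y)"

text \<open>The transpose \<open>Z \<rightarrow> [X, Y]\<close> of an arrow \<open>f : Z \<times> X \<rightarrow> Y\<close>.\<close>

definition exp_transpose :: "('o, 'a) cat \<Rightarrow> 'o \<Rightarrow> 'o \<Rightarrow> 'a \<Rightarrow> 'a" where
  "exp_transpose V Z X f = (THE h. h \<in> Hom V Z (exponent V X (Cod V f)) \<and>
    evalmap V X (Cod V f) \<cdot>\<^bsub>V\<^esub> prod_map V h (Ident V X) = f)"

text \<open>The arrow \<open>f\<^sup>* : [Y, A] \<rightarrow> [X, A]\<close> induced by \<open>f : X \<rightarrow> Y\<close>.\<close>

definition exp_precomp :: "('o, 'a) cat \<Rightarrow> 'a \<Rightarrow> 'o \<Rightarrow> 'a" where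
  "exp_precomp V f A = exp_transpose V (exponent V (Cod V f) A) (Dom V f)
    (evalmap V (Cod V f) A \<cdot>\<^bsub>V\<^esub> prod_map V (Ident V (exponent V (Cod V f) A)) f)"

text \<open>The arrow \<open>A \<cong> [*, A] \<rightarrow> [X, A]\<close> induced by the unique arrow \<open>X \<rightarrow> *\<close>.\<close>

definition exp_const :: "('o, 'a) cat \<Rightarrow> 'o \<Rightarrow> 'o \<Rightarrow> 'a" where
  "exp_const V X A = exp_precomp V (bang V X) A
    \<cdot>\<^bsub>V\<^esub> exp_transpose V A (terminal V) (pr1 V A (terminal V))"

definition is_coproduct ::
    "('o, 'a) cat \<Rightarrow> 'i set \<Rightarrow> ('i \<Rightarrow> 'o) \<Rightarrow> 'o \<times> ('i \<Rightarrow> 'a) \<Rightarrow> bool" where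
  "is_coproduct V I X = (\<lambda>(S, \<iota>). S \<in> Obj V \<and> (\<forall>i\<in>I. \<iota> i \<in> Hom V (X i) S) \<and>
    (\<forall>Z\<in>Obj V. \<forall>f. (\<forall>i\<in>I. f i \<in> Hom V (X i) Z) \<longrightarrow>
      (\<exists>!h. h \<in> Hom V S Z \<and> (\<forall>i\<in>I. h \<cdot>\<^bsub>V\<^esub> \<iota> i = f i))))"

definition coproduct_cocone ::
    "('o, 'a) cat \<Rightarrow> 'i set \<Rightarrow> ('i \<Rightarrow> 'o) \<Rightarrow> 'o \<times> ('i \<Rightarrow> 'a)" where
  "coproduct_cocone V I X = (SOME c. is_coproduct V I X c)"

definition coproduct :: "('o, 'a) cat \<Rightarrow> 'i set \<Rightarrow> ('i \<Rightarrow> 'o) \<Rightarrow> 'o" where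
  "coproduct V I X = fst (coproduct_cocone V I X)"

definition incl :: "('o, 'a) cat \<Rightarrow> 'i set \<Rightarrow> ('i \<Rightarrow> 'o) \<Rightarrow> 'i \<Rightarrow> 'a" where
  "incl V I X = snd (coproduct_cocone V I X)"

definition copair ::
    "('o, 'a) cat \<Rightarrow> 'i set \<Rightarrow> ('i \<Rightarrow> 'o) \<Rightarrow> 'o \<Rightarrow> ('i \<Rightarrow> 'a) \<Rightarrow> 'a" where
  "copair V I X Z f = (THE h. h \<in> Hom V (coproduct V I X) Z \<and>
    (\<forall>i\<in>I. h \<cdot>\<^bsub>V\<^esub> incl V I X i = f i))"

definition coprod_map ::
    "('o, 'a) cat \<Rightarrow> 'i set \<Rightarrow> ('i \<Rightarrow> 'o) \<Rightarrow> ('i \<Rightarrow> 'o) \<Rightarrow> ('i \<Rightarrow> 'a) \<Rightarrow> 'a" where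
  "coprod_map V I X Y f =
    copair V I X (coproduct V I Y) (\<lambda>i. incl V I Y i \<cdot>\<^bsub>V\<^esub> f i)"

definition coprod_slice_ftor ::
    "('o, 'a) cat \<Rightarrow> 'i set \<Rightarrow> ('i \<Rightarrow> 'o) \<Rightarrow>
      ('i \<Rightarrow> 'a, 'i \<Rightarrow> 'a \<times> 'a \<times> 'a, 'a, 'a \<times> 'a \<times> 'a) ftor" where
  "coprod_slice_ftor V I X =
    (let over = (\<lambda>f. coprod_map V I (\<lambda>i. Dom V (f i)) X f) in
    \<lparr>FObj = over,
     FArr = (\<lambda>a. let f = (\<lambda>i. fst (a i)); h = (\<lambda>i. fst (snd (a i))); g = (\<lambda>i. snd (snd (a i)))
       in (over f, coprod_map V I (\<lambda>i. Dom V (f i)) (\<lambda>i. Dom V (g i)) h, over g))\<rparr>)"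

text \<open>The subsets of the type \<open>'i\<close> play the role of the small sets.\<close>

definition extensive :: "'i itself \<Rightarrow> ('o, 'a) cat \<Rightarrow> bool" where
  "extensive _ V \<longleftrightarrow>
    (\<forall>(I :: 'i set) X. (\<forall>i\<in>I. X i \<in> Obj V) \<longrightarrow> (\<exists>c. is_coproduct V I X c)) \<and>
    (\<forall>(I :: 'i set) X. (\<forall>i\<in>I. X i \<in> Obj V) \<longrightarrow>
      is_equivalence (product_cat I (\<lambda>i. slice V (X i))) (slice V (coproduct V I X))
        (coprod_slice_ftor V I X))"


section \<open>Enriched categories\<close>

text \<open>Composition is in diagrammatic order: \<open>VComp C A B D : C(A,B) \<times> C(B,D) \<rightarrow> C(A,D)\<close>.\<close>

record ('c, 'o, 'a) vcat =
  VObj :: "'c set"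
  VHom :: "'c \<Rightarrow> 'c \<Rightarrow> 'o"
  VComp :: "'c \<Rightarrow> 'c \<Rightarrow> 'c \<Rightarrow> 'a"
  VId :: "'c \<Rightarrow> 'a"

locale v_category =
  fixes V :: "('o, 'a) cat" (structure) and C :: "('c, 'o, 'a) vcat"
  assumes vhom_in_Obj: "A \<in> VObj C \<Longrightarrow> B \<in> VObj C \<Longrightarrow> VHom C A B \<in> Obj V"
    and vcomp_in_Hom: "A \<in> VObj C \<Longrightarrow> B \<in> VObj C \<Longrightarrow> D \<in> VObj C \<Longrightarrow>
      VComp C A B D \<in> Hom V (product V (VHom C A B) (VHom C B D)) (VHom C A D)"
    and vid_in_Hom: "A \<in> VObj C \<Longrightarrow> VId C A \<in> Hom V (terminal V) (VHom C A A)"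
    and vid_left: "A \<in> VObj C \<Longrightarrow> B \<in> VObj C \<Longrightarrow>
      VComp C A A B \<cdot> pairing V (VId C A \<cdot> bang V (VHom C A B)) (Ident V (VHom C A B))
        = Ident V (VHom C A B)"
    and vid_right: "A \<in> VObj C \<Longrightarrow> B \<in> VObj C \<Longrightarrow>
      VComp C A B B \<cdot> pairing V (Ident V (VHom C A B)) (VId C B \<cdot> bang V (VHom C A B))
        = Ident V (VHom C A B)"
    and vcomp_assoc: "A \<in> VObj C \<Longrightarrow> B \<in> VObj C \<Longrightarrow> D \<in> VObj C \<Longrightarrow> E \<in> VObj C \<Longrightarrow>
      (let H1 = VHom C A B; H2 = VHom C B D; H3 = VHom C D E; P = product V H1 H2 in
       VComp C A D E \<cdot> prod_map V (VComp C A B D) (Ident V H3)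
       = VComp C A B E \<cdot> pairing V (pr1 V H1 H2 \<cdot> pr1 V P H3)
           (VComp C B D E \<cdot> pairing V (pr2 V H1 H2 \<cdot> pr1 V P H3) (pr2 V P H3)))"

definition opposite :: "('o, 'a) cat \<Rightarrow> ('c, 'o, 'a) vcat \<Rightarrow> ('c, 'o, 'a) vcat" where
  "opposite V C =
    \<lparr>VObj = VObj C,
     VHom = (\<lambda>A B. VHom C B A),
     VComp = (\<lambda>A B D. VComp C D B A
       \<cdot>\<^bsub>V\<^esub> pairing V (pr2 V (VHom C B A) (VHom C D B)) (pr1 V (VHom C B A) (VHom C D B))),
     VId = VId C\<rparr>"

text \<open>The self-enrichment of \<open>V\<close> by its internal homs.\<close>

definition self_enriched :: "('o, 'a) cat \<Rightarrow> ('o, 'o, 'a) vcat" where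
  "self_enriched V =
    \<lparr>VObj = Obj V,
     VHom = exponent V,
     VComp = (\<lambda>X Y Z.
       let H = exponent V X Y; K = exponent V Y Z; P = product V H K in
       exp_transpose V P X
         (evalmap V Y Z \<cdot>\<^bsub>V\<^esub> pairing V (pr2 V H K \<cdot>\<^bsub>V\<^esub> pr1 V P X)
            (evalmap V X Y \<cdot>\<^bsub>V\<^esub> pairing V (pr1 V H K \<cdot>\<^bsub>V\<^esub> pr1 V P X) (pr2 V P X)))),
     VId = (\<lambda>X. exp_transpose V (terminal V) X (pr2 V (terminal V) X))\<rparr>"

record ('c, 'd, 'a) vfun =
  VFObj :: "'c \<Rightarrow> 'd"
  VFHom :: "'c \<Rightarrow> 'c \<Rightarrow> 'a"

locale v_functor =
  fixes V :: "('o, 'a) cat" (structure) and C :: "('c, 'o, 'a) vcat"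
    and D :: "('d, 'o, 'a) vcat" and F :: "('c, 'd, 'a) vfun"
  assumes vfobj_in_VObj: "A \<in> VObj C \<Longrightarrow> VFObj F A \<in> VObj D"
    and vfhom_in_Hom: "A \<in> VObj C \<Longrightarrow> B \<in> VObj C \<Longrightarrow>
      VFHom F A B \<in> Hom V (VHom C A B) (VHom D (VFObj F A) (VFObj F B))"
    and vfhom_vid: "A \<in> VObj C \<Longrightarrow> VFHom F A A \<cdot> VId C A = VId D (VFObj F A)"
    and vfhom_vcomp: "A \<in> VObj C \<Longrightarrow> B \<in> VObj C \<Longrightarrow> E \<in> VObj C \<Longrightarrow>
      VFHom F A E \<cdot> VComp C A B E
      = VComp D (VFObj F A) (VFObj F B) (VFObj F E) \<cdot> prod_map V (VFHom F A B) (VFHom F B E)"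

locale v_natural =
  fixes V :: "('o, 'a) cat" (structure) and C :: "('c, 'o, 'a) vcat"
    and D :: "('d, 'o, 'a) vcat" and F G :: "('c, 'd, 'a) vfun" and \<alpha> :: "'c \<Rightarrow> 'a"
  assumes vnat_extensional: "\<alpha> \<in> extensional (VObj C)"
    and vnat_in_Hom: "A \<in> VObj C \<Longrightarrow>
      \<alpha> A \<in> Hom V (terminal V) (VHom D (VFObj F A) (VFObj G A))"
    and vnat_naturality: "A \<in> VObj C \<Longrightarrow> B \<in> VObj C \<Longrightarrow>
      VComp D (VFObj F A) (VFObj F B) (VFObj G B)
        \<cdot> pairing V (VFHom F A B) (\<alpha> B \<cdot> bang V (VHom C A B))
      = VComp D (VFObj F A) (VFObj G A) (VFObj G B)
        \<cdot> pairing V (\<alpha> A \<cdot> bang V (VHom C A B)) (VFHom G A B)"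

definition v_natural_iso ::
    "('o, 'a) cat \<Rightarrow> ('c, 'o, 'a) vcat \<Rightarrow> ('d, 'o, 'a) vcat \<Rightarrow>
      ('c, 'd, 'a) vfun \<Rightarrow> ('c, 'd, 'a) vfun \<Rightarrow> ('c \<Rightarrow> 'a) \<Rightarrow> bool" where
  "v_natural_iso V C D F G \<alpha> \<longleftrightarrow> v_natural V C D F G \<alpha> \<and>
    (\<exists>\<beta>. v_natural V C D G F \<beta> \<and>
      (\<forall>A\<in>VObj C.
        VComp D (VFObj F A) (VFObj G A) (VFObj F A) \<cdot>\<^bsub>V\<^esub> pairing V (\<alpha> A) (\<beta> A)
          = VId D (VFObj F A) \<and>
        VComp D (VFObj G A) (VFObj F A) (VFObj G A) \<cdot>\<^bsub>V\<^esub> pairing V (\<beta> A) (\<alpha> A)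
          = VId D (VFObj G A)))"

definition v_terminal :: "('o, 'a) cat \<Rightarrow> ('c, 'o, 'a) vcat \<Rightarrow> 'c \<Rightarrow> bool" where
  "v_terminal V D T \<longleftrightarrow> T \<in> VObj D \<and> (\<forall>A\<in>VObj D. is_iso V (bang V (VHom D A T)))"


section \<open>Presheaves and representability\<close>

definition v_presheaf ::
    "('o, 'a) cat \<Rightarrow> ('c, 'o, 'a) vcat \<Rightarrow> ('c, 'o, 'a) vfun \<Rightarrow> bool" where
  "v_presheaf V C F \<longleftrightarrow> v_functor V (opposite V C) (self_enriched V) F"

text \<open>The arrow \<open>ev\<^sup>F : C(A,B) \<times> F B \<rightarrow> F A\<close>; note that \<open>C(A,B)\<close> is the hom-object from
  \<open>B\<close> to \<open>A\<close> in the opposite.\<close>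

definition presheaf_ev ::
    "('o, 'a) cat \<Rightarrow> ('c, 'o, 'a) vfun \<Rightarrow> 'c \<Rightarrow> 'c \<Rightarrow> 'a" where
  "presheaf_ev V F A B = evalmap V (VFObj F B) (VFObj F A)
    \<cdot>\<^bsub>V\<^esub> prod_map V (VFHom F B A) (Ident V (VFObj F B))"

text \<open>The presheaf \<open>C(-, c)\<close>.\<close>

definition hom_presheaf ::
    "('o, 'a) cat \<Rightarrow> ('c, 'o, 'a) vcat \<Rightarrow> 'c \<Rightarrow> ('c, 'o, 'a) vfun" where
  "hom_presheaf V C c =
    \<lparr>VFObj = (\<lambda>A. VHom C A c),
     VFHom = (\<lambda>B A. exp_transpose V (VHom C A B) (VHom C B c) (VComp C A B c))\<rparr>"

text \<open>The element of \<open>F c\<close> that the enriched Yoneda lemma assigns to a \<open>V\<close>-natural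
  transformation from \<open>C(-, c)\<close> to \<open>F\<close>: its component at \<open>c\<close>, evaluated at the identity.\<close>

definition yoneda_element ::
    "('o, 'a) cat \<Rightarrow> ('c, 'o, 'a) vcat \<Rightarrow> ('c, 'o, 'a) vfun \<Rightarrow> 'c \<Rightarrow> ('c \<Rightarrow> 'a) \<Rightarrow> 'a" where
  "yoneda_element V C F c \<alpha> =
    evalmap V (VHom C c c) (VFObj F c) \<cdot>\<^bsub>V\<^esub> pairing V (\<alpha> c) (VId C c)"

definition yoneda_transformation ::
    "('o, 'a) cat \<Rightarrow> ('c, 'o, 'a) vcat \<Rightarrow> ('c, 'o, 'a) vfun \<Rightarrow> 'c \<Rightarrow> 'a \<Rightarrow> ('c \<Rightarrow> 'a)" where
  "yoneda_transformation V C F c x =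
    (THE \<alpha>. v_natural V (opposite V C) (self_enriched V) (hom_presheaf V C c) F \<alpha> \<and>
      yoneda_element V C F c \<alpha> = x)"

definition v_representable_by ::
    "('o, 'a) cat \<Rightarrow> ('c, 'o, 'a) vcat \<Rightarrow> ('c, 'o, 'a) vfun \<Rightarrow> 'c \<Rightarrow> 'a \<Rightarrow> bool" where
  "v_representable_by V C F c x \<longleftrightarrow>
    v_natural_iso V (opposite V C) (self_enriched V) (hom_presheaf V C c) F
      (yoneda_transformation V C F c x)"


section \<open>Internal categories\<close>

record ('o, 'a) icat =
  Ob :: 'o
  Ar :: 'o
  Src :: 'a
  Tgt :: 'a
  Idn :: 'a
  Cmp :: 'a

text \<open>The domain of \<open>Cmp\<close> is the pullback of the target along the source, so that the first
  projection is the arrow applied first.\<close>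

locale internal_category =
  fixes V :: "('o, 'a) cat" (structure) and \<A> :: "('o, 'a) icat"
  assumes ob_in_Obj: "Ob \<A> \<in> Obj V"
    and ar_in_Obj: "Ar \<A> \<in> Obj V"
    and src_in_Hom: "Src \<A> \<in> Hom V (Ar \<A>) (Ob \<A>)"
    and tgt_in_Hom: "Tgt \<A> \<in> Hom V (Ar \<A>) (Ob \<A>)"
    and idn_in_Hom: "Idn \<A> \<in> Hom V (Ob \<A>) (Ar \<A>)"
    and cmp_in_Hom: "Cmp \<A> \<in> Hom V (pullback V (Tgt \<A>) (Src \<A>)) (Ar \<A>)"
    and src_idn: "Src \<A> \<cdot> Idn \<A> = Ident V (Ob \<A>)"
    and tgt_idn: "Tgt \<A> \<cdot> Idn \<A> = Ident V (Ob \<A>)"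
    and src_cmp: "Src \<A> \<cdot> Cmp \<A> = Src \<A> \<cdot> pb1 V (Tgt \<A>) (Src \<A>)"
    and tgt_cmp: "Tgt \<A> \<cdot> Cmp \<A> = Tgt \<A> \<cdot> pb2 V (Tgt \<A>) (Src \<A>)"
    and cmp_idn_left:
      "Cmp \<A> \<cdot> pb_lift V (Tgt \<A>) (Src \<A>) (Idn \<A> \<cdot> Src \<A>) (Ident V (Ar \<A>)) = Ident V (Ar \<A>)"
    and cmp_idn_right:
      "Cmp \<A> \<cdot> pb_lift V (Tgt \<A>) (Src \<A>) (Ident V (Ar \<A>)) (Idn \<A> \<cdot> Tgt \<A>) = Ident V (Ar \<A>)"
    and cmp_assoc:
      "(let p1 = pb1 V (Tgt \<A>) (Src \<A>); p2 = pb2 V (Tgt \<A>) (Src \<A>);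
            q1 = pb1 V (Tgt \<A> \<cdot> p2) (Src \<A>); q2 = pb2 V (Tgt \<A> \<cdot> p2) (Src \<A>);
            lift = pb_lift V (Tgt \<A>) (Src \<A>) in
        Cmp \<A> \<cdot> lift (Cmp \<A> \<cdot> q1) q2 = Cmp \<A> \<cdot> lift (p1 \<cdot> q1) (Cmp \<A> \<cdot> lift (p2 \<cdot> q1) q2))"

record ('o, 'a) ifun =
  IDom :: "('o, 'a) icat"
  ICod :: "('o, 'a) icat"
  IOb :: 'a
  IAr :: 'a

locale internal_functor =
  fixes V :: "('o, 'a) cat" (structure) and \<A> \<B> :: "('o, 'a) icat" and f g :: 'a
  assumes ob_map_in_Hom: "f \<in> Hom V (Ob \<A>) (Ob \<B>)"
    and ar_map_in_Hom: "g \<in> Hom V (Ar \<A>) (Ar \<B>)"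
    and map_src: "Src \<B> \<cdot> g = f \<cdot> Src \<A>"
    and map_tgt: "Tgt \<B> \<cdot> g = f \<cdot> Tgt \<A>"
    and map_idn: "g \<cdot> Idn \<A> = Idn \<B> \<cdot> f"
    and map_cmp: "g \<cdot> Cmp \<A> = Cmp \<B> \<cdot> pb_lift V (Tgt \<B>) (Src \<B>)
      (g \<cdot> pb1 V (Tgt \<A>) (Src \<A>)) (g \<cdot> pb2 V (Tgt \<A>) (Src \<A>))"

definition Cat :: "('o, 'a) cat \<Rightarrow> (('o, 'a) icat, ('o, 'a) ifun) cat" where
  "Cat V =
    \<lparr>Obj = {\<A>. internal_category V \<A>},
     Arr = {\<phi>. internal_category V (IDom \<phi>) \<and> internal_category V (ICod \<phi>) \<and>
              internal_functor V (IDom \<phi>) (ICod \<phi>) (IOb \<phi>) (IAr \<phi>)},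
     Dom = IDom,
     Cod = ICod,
     Ident = (\<lambda>\<A>. \<lparr>IDom = \<A>, ICod = \<A>, IOb = Ident V (Ob \<A>), IAr = Ident V (Ar \<A>)\<rparr>),
     Comp = (\<lambda>\<psi> \<phi>. \<lparr>IDom = IDom \<phi>, ICod = ICod \<psi>,
               IOb = IOb \<psi> \<cdot>\<^bsub>V\<^esub> IOb \<phi>, IAr = IAr \<psi> \<cdot>\<^bsub>V\<^esub> IAr \<phi>\<rparr>)\<rparr>"

text \<open>The composition of \<open>cst X\<close> is the canonical isomorphism from the pullback of the
  identity along itself to \<open>X\<close>.\<close>

definition cst :: "('o, 'a) cat \<Rightarrow> 'o \<Rightarrow> ('o, 'a) icat" where
  "cst V X = \<lparr>Ob = X, Ar = X, Src = Ident V X, Tgt = Ident V X, Idn = Ident V X,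
    Cmp = pb1 V (Ident V X) (Ident V X)\<rparr>"

text \<open>The underlying \<open>V\<close>-category; \<open>und_incl\<close> is the map from its hom-object to the object of
  arrows.\<close>

definition und_incl :: "('o, 'a) cat \<Rightarrow> ('o, 'a) icat \<Rightarrow> 'a \<Rightarrow> 'a \<Rightarrow> 'a" where
  "und_incl V \<A> A B = pb1 V (pairing V (Src \<A>) (Tgt \<A>)) (pairing V A B)"

definition Und :: "('o, 'a) cat \<Rightarrow> ('o, 'a) icat \<Rightarrow> ('a, 'o, 'a) vcat" where
  "Und V \<A> =
    (let st = pairing V (Src \<A>) (Tgt \<A>); hom = (\<lambda>A B. pullback V st (pairing V A B)) in
    \<lparr>VObj = Hom V (terminal V) (Ob \<A>),
     VHom = hom,
     VComp = (\<lambda>A B D. pb_lift V st (pairing V A D)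
       (Cmp \<A> \<cdot>\<^bsub>V\<^esub> pb_lift V (Tgt \<A>) (Src \<A>)
          (und_incl V \<A> A B \<cdot>\<^bsub>V\<^esub> pr1 V (hom A B) (hom B D))
          (und_incl V \<A> B D \<cdot>\<^bsub>V\<^esub> pr2 V (hom A B) (hom B D)))
       (bang V (product V (hom A B) (hom B D)))),
     VId = (\<lambda>A. pb_lift V st (pairing V A A) (Idn \<A> \<cdot>\<^bsub>V\<^esub> A) (Ident V (terminal V)))\<rparr>)"


section \<open>The category of elements\<close>

definition el_ob :: "('o, 'a) cat \<Rightarrow> ('c, 'o, 'a) vcat \<Rightarrow> ('c, 'o, 'a) vfun \<Rightarrow> 'o" where
  "el_ob V C F = coproduct V (VObj C) (VFObj F)"

definition el_incl :: "('o, 'a) cat \<Rightarrow> ('c, 'o, 'a) vcat \<Rightarrow> ('c, 'o, 'a) vfun \<Rightarrow> 'c \<Rightarrow> 'a" where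
  "el_incl V C F = incl V (VObj C) (VFObj F)"

definition el_summand ::
    "('o, 'a) cat \<Rightarrow> ('c, 'o, 'a) vcat \<Rightarrow> ('c, 'o, 'a) vfun \<Rightarrow> 'c \<times> 'c \<Rightarrow> 'o" where
  "el_summand V C F = (\<lambda>(A, B). product V (VHom C A B) (VFObj F B))"

definition el_ar :: "('o, 'a) cat \<Rightarrow> ('c, 'o, 'a) vcat \<Rightarrow> ('c, 'o, 'a) vfun \<Rightarrow> 'o" where
  "el_ar V C F = coproduct V (VObj C \<times> VObj C) (el_summand V C F)"

definition el_ar_incl ::
    "('o, 'a) cat \<Rightarrow> ('c, 'o, 'a) vcat \<Rightarrow> ('c, 'o, 'a) vfun \<Rightarrow> 'c \<Rightarrow> 'c \<Rightarrow> 'a" where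
  "el_ar_incl V C F A B = incl V (VObj C \<times> VObj C) (el_summand V C F) (A, B)"

definition el_src :: "('o, 'a) cat \<Rightarrow> ('c, 'o, 'a) vcat \<Rightarrow> ('c, 'o, 'a) vfun \<Rightarrow> 'a" where
  "el_src V C F = copair V (VObj C \<times> VObj C) (el_summand V C F) (el_ob V C F)
    (\<lambda>(A, B). el_incl V C F A \<cdot>\<^bsub>V\<^esub> presheaf_ev V F A B)"

definition el_tgt :: "('o, 'a) cat \<Rightarrow> ('c, 'o, 'a) vcat \<Rightarrow> ('c, 'o, 'a) vfun \<Rightarrow> 'a" where
  "el_tgt V C F = copair V (VObj C \<times> VObj C) (el_summand V C F) (el_ob V C F)
    (\<lambda>(A, B). el_incl V C F B \<cdot>\<^bsub>V\<^esub> pr2 V (VHom C A B) (VFObj F B))"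

definition el_idn :: "('o, 'a) cat \<Rightarrow> ('c, 'o, 'a) vcat \<Rightarrow> ('c, 'o, 'a) vfun \<Rightarrow> 'a" where
  "el_idn V C F = copair V (VObj C) (VFObj F) (el_ar V C F)
    (\<lambda>A. el_ar_incl V C F A A
      \<cdot>\<^bsub>V\<^esub> pairing V (VId C A \<cdot>\<^bsub>V\<^esub> bang V (VFObj F A)) (Ident V (VFObj F A)))"

text \<open>By extensivity the object of composable pairs is the coproduct of the objects
  \<open>(C(A,B) \<times> C(B,D)) \<times> F D\<close> over all \<open>A\<close>, \<open>B\<close>, \<open>D\<close>, where \<open>((a, b), y)\<close> stands for the pair
  of \<open>(a, b \<cdot> y)\<close> in the summand \<open>(A, B)\<close> and \<open>(b, y)\<close> in the summand \<open>(B, D)\<close>. So there is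
  exactly one arrow out of it that restricts to \<open>c \<times> id\<close> on each summand.\<close>

definition el_pair_incl ::
    "('o, 'a) cat \<Rightarrow> ('c, 'o, 'a) vcat \<Rightarrow> ('c, 'o, 'a) vfun \<Rightarrow> 'c \<Rightarrow> 'c \<Rightarrow> 'c \<Rightarrow> 'a" where
  "el_pair_incl V C F A B D =
    (let H = VHom C A B; K = VHom C B D; P = product V H K; Y = VFObj F D;
         a = pr1 V H K \<cdot>\<^bsub>V\<^esub> pr1 V P Y; b = pr2 V H K \<cdot>\<^bsub>V\<^esub> pr1 V P Y; y = pr2 V P Y in
     pb_lift V (el_tgt V C F) (el_src V C F)
       (el_ar_incl V C F A B \<cdot>\<^bsub>V\<^esub> pairing V a (presheaf_ev V F B D \<cdot>\<^bsub>V\<^esub> pairing V b y))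
       (el_ar_incl V C F B D \<cdot>\<^bsub>V\<^esub> pairing V b y))"

definition el_cmp :: "('o, 'a) cat \<Rightarrow> ('c, 'o, 'a) vcat \<Rightarrow> ('c, 'o, 'a) vfun \<Rightarrow> 'a" where
  "el_cmp V C F =
    (THE m. m \<in> Hom V (pullback V (el_tgt V C F) (el_src V C F)) (el_ar V C F) \<and>
      (\<forall>A\<in>VObj C. \<forall>B\<in>VObj C. \<forall>D\<in>VObj C.
        m \<cdot>\<^bsub>V\<^esub> el_pair_incl V C F A B D
        = el_ar_incl V C F A D \<cdot>\<^bsub>V\<^esub> prod_map V (VComp C A B D) (Ident V (VFObj F D))))"

definition elements ::
    "('o, 'a) cat \<Rightarrow> ('c, 'o, 'a) vcat \<Rightarrow> ('c, 'o, 'a) vfun \<Rightarrow> ('o, 'a) icat" where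
  "elements V C F = \<lparr>Ob = el_ob V C F, Ar = el_ar V C F, Src = el_src V C F, Tgt = el_tgt V C F,
    Idn = el_idn V C F, Cmp = el_cmp V C F\<rparr>"

definition generalized_elements ::
    "('o, 'a) cat \<Rightarrow> ('c, 'o, 'a) vcat \<Rightarrow> ('c, 'o, 'a) vfun \<Rightarrow> 'o \<Rightarrow> ('a, 'o, 'a) vcat" where
  "generalized_elements V C F X = Und V (exponent (Cat V) (cst V X) (elements V C F))"

definition constant_element ::
    "('o, 'a) cat \<Rightarrow> ('c, 'o, 'a) vcat \<Rightarrow> ('c, 'o, 'a) vfun \<Rightarrow> 'o \<Rightarrow> 'c \<Rightarrow> 'a \<Rightarrow> 'a" where
  "constant_element V C F X c x =
    IOb (exp_const (Cat V) (cst V X) (elements V C F)) \<cdot>\<^bsub>V\<^esub> (el_incl V C F c \<cdot>\<^bsub>V\<^esub> x)"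

end

theory Submission
  imports Defs
begin

text \<open>Everything is argued with generalized elements: an object is known through the arrows into it from
an arbitrary object \<open>Z\<close>, the stage. Write \<open>f \<cdot> y\<close> for the action of an element \<open>f\<close> of \<open>C(A, B)\<close> on an
element \<open>y\<close> of \<open>F B\<close>.

By the Yoneda lemma, \<open>F\<close> is represented by \<open>(c, x)\<close> exactly when each of the arrows
\<open>\<alpha> A : C(A, c) \<rightarrow> F A\<close>, \<open>f \<mapsto> f \<cdot> x\<close>, is an isomorphism (\<open>representable_iff\<close>).

On the other side, an arrow of the category of elements from \<open>(A, u)\<close> to \<open>(B, y)\<close>, at any stage, is an
element \<open>f\<close> of \<open>C(A, B)\<close> with \<open>f \<cdot> y = u\<close> (\<open>arrow_between\<close>). This is where extensivity enters: an arrow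
\<open>Z \<rightarrow> \<Squnion> C(A, B) \<times> F B\<close> cuts the stage \<open>Z\<close> into a coproduct of pieces, one over each summand, and the
pieces over the summands that do not fit the prescribed source and target are initial. Consequently,
if all \<open>\<alpha> A\<close> are isomorphisms, then at every stage there is exactly one arrow from any given object of
elements to the constant object \<open>(c, x)\<close> (\<open>unique_arrow_if_isos\<close>); and if this holds at the stage \<open>Z\<close>,
then every \<open>\<alpha> A\<close> is bijective on elements at the stage \<open>Z\<close> (\<open>action_bijective_if_unique_arrow\<close>).

Finally, the internal hom out of \<open>cst X\<close> is computed levelwise by \<open>[X, -]\<close> (\<open>power_is_exponential\<close>), so that
\<open>(c, x)\<close> is terminal among the generalized elements of shape \<open>X\<close> when, for all \<open>a : X \<rightarrow> \<Squnion> F A\<close> and all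
\<open>Z\<close>, there is exactly one arrow at the stage \<open>Z \<times> X\<close> from \<open>a\<close> to \<open>(c, x)\<close> (\<open>v_terminal_exponent_iff\<close>).
If all \<open>\<alpha> A\<close> are isomorphisms, this is an instance of the above. Conversely, the case where \<open>Z\<close> is the
terminal object yields bijectivity of \<open>\<alpha> A\<close> on elements at each stage \<open>X\<close> of the conservative family,
which is what it means for \<open>\<alpha> A\<close> to be invertible.

None of this has content before the category of elements is known to be an internal category, because the
internal hom is only defined for objects of \<open>Cat V\<close>. Its composition has to be glued from the
summands (\<open>ex_composition\<close>), and its axioms are checked on pieces of the stage.\<close>

section \<open>Finite limits and internal homs by generalized elements\<close>

context category
begin

text \<open>Typing is expressed by equations for domain and codomain, so that it can be established by rewriting,
together with the equations below. In the resulting normal form composites are nested to the right and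
composition is pushed into pairings.\<close>

lemma Hom_iff: "f \<in> Hom V X Y \<longleftrightarrow>
    f \<in> Arr V \<and> Dom V f = X \<and> Cod V f = Y \<and> X \<in> Obj V \<and> Y \<in> Obj V"
  using dom_in_Obj cod_in_Obj unfolding Hom_def by auto

lemma arr_Hom: "f \<in> Arr V \<Longrightarrow> f \<in> Hom V (Dom V f) (Cod V f)"
  by (simp add: Hom_def)

lemma dom_Obj [simp]: "f \<in> Arr V \<Longrightarrow> Dom V f \<in> Obj V"
  and cod_Obj [simp]: "f \<in> Arr V \<Longrightarrow> Cod V f \<in> Obj V"
  by (simp_all add: dom_in_Obj cod_in_Obj)

lemma ident_simps [simp]:
  assumes "X \<in> Obj V"
  shows "Ident V X \<in> Arr V" "Dom V (Ident V X) = X" "Cod V (Ident V X) = X"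
  using ident_in_Hom[OF assms] by (simp_all add: Hom_def)

lemma comp_simps [simp]:
  assumes "f \<in> Arr V" "g \<in> Arr V" "Cod V f = Dom V g"
  shows "g \<cdot> f \<in> Arr V" "Dom V (g \<cdot> f) = Dom V f" "Cod V (g \<cdot> f) = Cod V g"
  using comp_in_Hom[of f "Dom V f" "Cod V f" g "Cod V g"] assms by (simp_all add: Hom_def)

lemma comp_ident [simp]:
  assumes "f \<in> Arr V"
  shows "Cod V f = X \<Longrightarrow> Ident V X \<cdot> f = f" "Dom V f = X \<Longrightarrow> f \<cdot> Ident V X = f"
  using comp_ident_left comp_ident_right arr_Hom[OF assms] by blast+

lemma assoc [simp]:
  assumes "f \<in> Arr V" "g \<in> Arr V" "h \<in> Arr V" "Cod V f = Dom V g" "Cod V g = Dom V h"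
  shows "(h \<cdot> g) \<cdot> f = h \<cdot> (g \<cdot> f)"
  using comp_assoc[of f "Dom V f" "Dom V g" g "Cod V g" h "Cod V h"] assms
  by (simp add: Hom_def)

lemma comp_cong_right: "g \<cdot> f = k \<Longrightarrow> f \<in> Arr V \<Longrightarrow> g \<in> Arr V \<Longrightarrow> z \<in> Arr V \<Longrightarrow>
    Cod V z = Dom V f \<Longrightarrow> Cod V f = Dom V g \<Longrightarrow> g \<cdot> (f \<cdot> z) = k \<cdot> z"
  using assoc by metis

lemma is_isoI:
  assumes "f \<in> Hom V X Y" "g \<in> Hom V Y X" "g \<cdot> f = Ident V X" "f \<cdot> g = Ident V Y"
  shows "is_iso V f"
  using assms unfolding is_iso_def by (auto simp: Hom_def)

lemma is_isoE:
  assumes "is_iso V f" "f \<in> Hom V X Y"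
  obtains g where "g \<in> Hom V Y X" "g \<cdot> f = Ident V X" "f \<cdot> g = Ident V Y"
  using assms unfolding is_iso_def by (auto simp: Hom_def)

end

locale cartesian_category = category V for V :: "('o, 'a) cat" (structure) +
  assumes ex_terminal: "\<exists>T. is_terminal V T"
    and ex_product: "X \<in> Obj V \<Longrightarrow> Y \<in> Obj V \<Longrightarrow> \<exists>c. is_product V X Y c"
begin

lemma is_terminal_terminal: "is_terminal V (terminal V)"
  unfolding terminal_def using ex_terminal by (rule someI_ex)

lemma terminal_Obj [simp]: "terminal V \<in> Obj V"
  using is_terminal_terminal by (simp add: is_terminal_def)

lemma bang_in_Hom: "X \<in> Obj V \<Longrightarrow> bang V X \<in> Hom V X (terminal V)"
  unfolding bang_def by (rule theI') (use is_terminal_terminal in \<open>simp add: is_terminal_def\<close>)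

lemma bang_simps [simp]:
  "X \<in> Obj V \<Longrightarrow> bang V X \<in> Arr V"
  "X \<in> Obj V \<Longrightarrow> Dom V (bang V X) = X"
  "X \<in> Obj V \<Longrightarrow> Cod V (bang V X) = terminal V"
  using bang_in_Hom by (simp_all add: Hom_def)

lemma terminal_unique: "f \<in> Hom V X (terminal V) \<Longrightarrow> g \<in> Hom V X (terminal V) \<Longrightarrow> f = g"
  using is_terminal_terminal by (auto simp: is_terminal_def Hom_iff)

lemma bang_unique: "f \<in> Hom V X (terminal V) \<Longrightarrow> f = bang V X"
  by (rule terminal_unique) (auto simp: Hom_iff)

lemma bang_comp [simp]:
  "f \<in> Arr V \<Longrightarrow> Cod V f = X \<Longrightarrow> bang V X \<cdot> f = bang V (Dom V f)"
  by (rule bang_unique) (auto simp: Hom_iff)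

lemma bang_terminal [simp]: "bang V (terminal V) = Ident V (terminal V)"
  by (rule bang_unique[symmetric]) (simp add: Hom_iff)

lemma is_product_chosen:
  assumes "X \<in> Obj V" "Y \<in> Obj V"
  shows "is_product V X Y (product V X Y, pr1 V X Y, pr2 V X Y)"
  using someI_ex[OF ex_product[OF assms]]
  unfolding product_def pr1_def pr2_def product_cone_def by simp

lemma pr_simps [simp]:
  assumes "X \<in> Obj V" "Y \<in> Obj V"
  shows "product V X Y \<in> Obj V"
    "pr1 V X Y \<in> Arr V" "Dom V (pr1 V X Y) = product V X Y" "Cod V (pr1 V X Y) = X"
    "pr2 V X Y \<in> Arr V" "Dom V (pr2 V X Y) = product V X Y" "Cod V (pr2 V X Y) = Y"
  using is_product_chosen[OF assms] by (auto simp: is_product_def Hom_iff)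

lemma pairing_aux:
  assumes "f \<in> Hom V Z X" "g \<in> Hom V Z Y"
  shows "pairing V f g \<in> Hom V Z (product V X Y) \<and>
    pr1 V X Y \<cdot> pairing V f g = f \<and> pr2 V X Y \<cdot> pairing V f g = g"
proof -
  have XY: "X \<in> Obj V" "Y \<in> Obj V" and e: "Dom V f = Z" "Cod V f = X" "Cod V g = Y"
    using assms by (auto simp: Hom_iff)
  have "\<exists>!h. h \<in> Hom V Z (product V X Y) \<and> pr1 V X Y \<cdot> h = f \<and> pr2 V X Y \<cdot> h = g"
    using is_product_chosen[OF XY] assms unfolding is_product_def by auto
  from theI'[OF this] show ?thesis unfolding pairing_def e .
qed

lemma pairing_simps [simp]:
  assumes "f \<in> Arr V" "g \<in> Arr V" "Dom V f = Dom V g"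
  shows "pairing V f g \<in> Arr V" "Dom V (pairing V f g) = Dom V g"
    "Cod V (pairing V f g) = product V (Cod V f) (Cod V g)"
    "Cod V f = X \<Longrightarrow> Cod V g = Y \<Longrightarrow> pr1 V X Y \<cdot> pairing V f g = f"
    "Cod V f = X \<Longrightarrow> Cod V g = Y \<Longrightarrow> pr2 V X Y \<cdot> pairing V f g = g"
  using pairing_aux[of f "Dom V g" "Cod V f" g "Cod V g"] assms by (auto simp: Hom_iff)

lemma product_eqI:
  assumes "X \<in> Obj V" "Y \<in> Obj V" "h \<in> Hom V Z (product V X Y)" "k \<in> Hom V Z (product V X Y)"
    "pr1 V X Y \<cdot> h = pr1 V X Y \<cdot> k" "pr2 V X Y \<cdot> h = pr2 V X Y \<cdot> k"
  shows "h = k"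
proof -
  have m: "pr1 V X Y \<cdot> k \<in> Hom V Z X" "pr2 V X Y \<cdot> k \<in> Hom V Z Y"
    using assms by (auto simp: Hom_iff)
  have "\<exists>!m. m \<in> Hom V Z (product V X Y) \<and> pr1 V X Y \<cdot> m = pr1 V X Y \<cdot> k
      \<and> pr2 V X Y \<cdot> m = pr2 V X Y \<cdot> k"
    using is_product_chosen[OF assms(1,2)] m unfolding is_product_def prod.case by blast
  then show ?thesis using assms by metis
qed

lemma pairing_comp [simp]:
  assumes "f \<in> Arr V" "g \<in> Arr V" "Dom V f = Dom V g" "z \<in> Arr V" "Cod V z = Dom V g"
  shows "pairing V f g \<cdot> z = pairing V (f \<cdot> z) (g \<cdot> z)"
  by (rule product_eqI[of "Cod V f" "Cod V g" _ "Dom V z"])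
     (use assms in \<open>auto simp: Hom_iff assoc[symmetric] simp del: assoc\<close>)

lemma pairing_pr [simp]:
  assumes "X \<in> Obj V" "Y \<in> Obj V"
  shows "pairing V (pr1 V X Y) (pr2 V X Y) = Ident V (product V X Y)"
  by (rule product_eqI[of X Y _ "product V X Y"]) (use assms in \<open>auto simp: Hom_iff\<close>)

lemma pairing_pr_comp [simp]:
  assumes "X \<in> Obj V" "Y \<in> Obj V" "z \<in> Arr V" "Cod V z = product V X Y"
  shows "pairing V (pr1 V X Y \<cdot> z) (pr2 V X Y \<cdot> z) = z"
  by (rule product_eqI[of X Y _ "Dom V z"]) (use assms in \<open>auto simp: Hom_iff\<close>)

lemma pairing_inject:
  assumes "pairing V f g = pairing V f' g'"
    "f \<in> Hom V Z X" "g \<in> Hom V Z Y" "f' \<in> Hom V Z X" "g' \<in> Hom V Z Y"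
  shows "f = f'" "g = g'"
  using assms pairing_aux by metis+

lemma prod_map_eq [simp]:
  assumes "f \<in> Arr V" "g \<in> Arr V"
  shows "prod_map V f g = pairing V (f \<cdot> pr1 V (Dom V f) (Dom V g)) (g \<cdot> pr2 V (Dom V f) (Dom V g))"
  by (simp add: prod_map_def)

end

definition exponentiable :: "('o, 'a) cat \<Rightarrow> 'o \<Rightarrow> 'o \<Rightarrow> bool" where
  "exponentiable V X Y \<longleftrightarrow> X \<in> Obj V \<and> Y \<in> Obj V \<and> (\<exists>c. is_exponential V X Y c)"

context cartesian_category
begin

lemma exponentiable_Obj: "exponentiable V X Y \<Longrightarrow> X \<in> Obj V \<and> Y \<in> Obj V"
  by (simp add: exponentiable_def)

lemma is_exponential_chosen:
  assumes "exponentiable V X Y"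
  shows "is_exponential V X Y (exponent V X Y, evalmap V X Y)"
  using someI_ex[of "is_exponential V X Y"] assms
  unfolding exponentiable_def exponent_def evalmap_def exponential_def by simp

lemma eval_simps [simp]:
  assumes "exponentiable V X Y"
  shows "exponent V X Y \<in> Obj V" "evalmap V X Y \<in> Arr V"
    "Dom V (evalmap V X Y) = product V (exponent V X Y) X" "Cod V (evalmap V X Y) = Y"
  using is_exponential_chosen[OF assms] by (auto simp: is_exponential_def Hom_iff)

lemma exp_transpose_aux:
  assumes "exponentiable V X Y" "Z \<in> Obj V" "f \<in> Hom V (product V Z X) Y"
  shows "exp_transpose V Z X f \<in> Hom V Z (exponent V X Y) \<and>
    evalmap V X Y \<cdot> prod_map V (exp_transpose V Z X f) (Ident V X) = f"
proof -
  have "\<exists>!h. h \<in> Hom V Z (exponent V X Y) \<and> evalmap V X Y \<cdot> prod_map V h (Ident V X) = f"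
    using is_exponential_chosen[OF assms(1)] assms unfolding is_exponential_def by auto
  moreover have "Cod V f = Y" using assms by (simp add: Hom_iff)
  ultimately show ?thesis unfolding exp_transpose_def using theI' by simp
qed

lemma exp_transpose_simps [simp]:
  assumes "exponentiable V X (Cod V f)" "Z \<in> Obj V" "f \<in> Arr V" "Dom V f = product V Z X"
  shows "exp_transpose V Z X f \<in> Arr V" "Dom V (exp_transpose V Z X f) = Z"
    "Cod V (exp_transpose V Z X f) = exponent V X (Cod V f)"
  using exp_transpose_aux[OF assms(1,2), of f] assms
  by (auto simp: Hom_iff exponentiable_def)

lemma eval_exp_transpose_comp [simp]:
  assumes "exponentiable V X Y" "Z \<in> Obj V" "f \<in> Arr V" "Dom V f = product V Z X" "Cod V f = Y"
    "z \<in> Arr V" "Cod V z = Z" "u \<in> Arr V" "Cod V u = X" "Dom V z = Dom V u"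
  shows "evalmap V X Y \<cdot> pairing V (exp_transpose V Z X f \<cdot> z) u = f \<cdot> pairing V z u"
proof -
  have X: "X \<in> Obj V" using assms(1) by (simp add: exponentiable_def)
  have "evalmap V X Y \<cdot> prod_map V (exp_transpose V Z X f) (Ident V X) = f"
    using exp_transpose_aux[OF assms(1,2), of f] assms X by (auto simp: Hom_iff)
  then have "(evalmap V X Y \<cdot> prod_map V (exp_transpose V Z X f) (Ident V X)) \<cdot> pairing V z u
      = f \<cdot> pairing V z u" by simp
  then show ?thesis using assms X by auto
qed

lemma exponent_eqI:
  assumes "exponentiable V X Y" "h \<in> Hom V Z (exponent V X Y)" "k \<in> Hom V Z (exponent V X Y)"
    "evalmap V X Y \<cdot> pairing V (h \<cdot> pr1 V Z X) (pr2 V Z X)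
      = evalmap V X Y \<cdot> pairing V (k \<cdot> pr1 V Z X) (pr2 V Z X)"
  shows "h = k"
proof -
  have X: "X \<in> Obj V" "Z \<in> Obj V"
    using assms(1,2) by (simp_all add: exponentiable_def Hom_iff)
  have e: "prod_map V m (Ident V X) = pairing V (m \<cdot> pr1 V Z X) (pr2 V Z X)"
    if "m \<in> Hom V Z (exponent V X Y)" for m
    using that X by (auto simp: Hom_iff)
  let ?f = "evalmap V X Y \<cdot> pairing V (k \<cdot> pr1 V Z X) (pr2 V Z X)"
  have f: "?f \<in> Hom V (product V Z X) Y"
    using assms X by (auto simp: Hom_iff exponentiable_def)
  have "\<exists>!m. m \<in> Hom V Z (exponent V X Y) \<and> evalmap V X Y \<cdot> prod_map V m (Ident V X) = ?f"
    using is_exponential_chosen[OF assms(1)] f X(2)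
    unfolding is_exponential_def prod.case by blast
  then show ?thesis using assms e by metis
qed

text \<open>The two projections of \<open>Z \<times> X\<close> form a generic pair \<open>(z, u)\<close>, at which the last premise is the equation
that the universal property demands. Quantifying over all pairs hides these projections from the equations
between transposes that are checked below.\<close>

lemma exponent_ext:
  assumes "exponentiable V X Y" "h \<in> Hom V Z (exponent V X Y)" "k \<in> Hom V Z (exponent V X Y)"
    "\<And>W z u. z \<in> Hom V W Z \<Longrightarrow> u \<in> Hom V W X \<Longrightarrow>
      evalmap V X Y \<cdot> pairing V (h \<cdot> z) u = evalmap V X Y \<cdot> pairing V (k \<cdot> z) u"
  shows "h = k"
  using assms(1-3)
  by (rule exponent_eqI)
     (rule assms(4)[of _ "product V Z X"], use assms in \<open>auto simp: Hom_iff exponentiable_def\<close>)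

text \<open>The projection \<open>Y \<times> * \<rightarrow> Y\<close> is invertible and serves as evaluation. This case is required because the
arrow \<open>A \<rightarrow> [X, A]\<close> is defined through \<open>[*, A]\<close>.\<close>

lemma exponentiable_terminal [simp]:
  assumes "Y \<in> Obj V"
  shows "exponentiable V (terminal V) Y"
proof -
  let ?T = "terminal V"
  have "is_exponential V ?T Y (Y, pr1 V Y ?T)"
    unfolding is_exponential_def prod.case
  proof (intro conjI ballI)
    fix Z f assume Z: "Z \<in> Obj V" and f: "f \<in> Hom V (product V Z ?T) Y"
    have f': "f \<in> Arr V" "Dom V f = product V Z ?T" "Cod V f = Y"
      using f by (auto simp: Hom_iff)
    have p2: "pr2 V Z ?T = bang V (product V Z ?T)"
      by (rule bang_unique) (simp add: Hom_iff Z)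
    have iso: "pairing V (pr1 V Z ?T) (bang V (product V Z ?T)) = Ident V (product V Z ?T)"
      using pairing_pr[of Z ?T] Z p2 by simp
    show "\<exists>!h. h \<in> Hom V Z Y \<and> pr1 V Y ?T \<cdot> prod_map V h (Ident V ?T) = f"
    proof (rule ex1I[of _ "f \<cdot> pairing V (Ident V Z) (bang V Z)"])
      show "f \<cdot> pairing V (Ident V Z) (bang V Z) \<in> Hom V Z Y \<and>
        pr1 V Y ?T \<cdot> prod_map V (f \<cdot> pairing V (Ident V Z) (bang V Z)) (Ident V ?T) = f"
        using f' Z assms iso by (simp add: Hom_iff)
    next
      fix h assume "h \<in> Hom V Z Y \<and> pr1 V Y ?T \<cdot> prod_map V h (Ident V ?T) = f"
      then show "h = f \<cdot> pairing V (Ident V Z) (bang V Z)"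
        using Z assms by (auto simp: Hom_iff)
    qed
  qed (use assms in \<open>auto simp: Hom_iff\<close>)
  then show ?thesis using assms unfolding exponentiable_def by auto
qed

text \<open>The equation identifies the arrow \<open>A \<rightarrow> [X, A]\<close> as the inclusion of the constant functions.\<close>

lemma eval_exp_const:
  assumes "exponentiable V X A" "z \<in> Hom V Z A" "u \<in> Hom V Z X"
  shows "exp_const V X A \<in> Hom V A (exponent V X A)"
    "evalmap V X A \<cdot> pairing V (exp_const V X A \<cdot> z) u = z"
  using assms exponentiable_Obj[OF assms(1)] unfolding exp_const_def exp_precomp_def
  by (auto simp: Hom_iff)

end

context cartesian_category
begin

lemma pr_in_Hom:
  assumes "X \<in> Obj V" "Y \<in> Obj V"
  shows "pr1 V X Y \<in> Hom V (product V X Y) X" "pr2 V X Y \<in> Hom V (product V X Y) Y"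
  using assms by (simp_all add: Hom_iff)

text \<open>Chosen products are compared with concrete ones, here for later use in the category of internal
categories, where the concrete product is formed levelwise but the chosen one is arbitrary.\<close>

lemma compare_products:
  assumes "is_product V X Y (Q, q1, q2)"
  obtains u v where "u \<in> Hom V (product V X Y) Q" "v \<in> Hom V Q (product V X Y)"
    "v \<cdot> u = Ident V (product V X Y)"
    "q1 \<cdot> u = pr1 V X Y" "q2 \<cdot> u = pr2 V X Y"
    "pr1 V X Y \<cdot> v = q1" "pr2 V X Y \<cdot> v = q2"
proof -
  have q: "q1 \<in> Hom V Q X" "q2 \<in> Hom V Q Y" using assms by (auto simp: is_product_def)
  then have XY: "X \<in> Obj V" "Y \<in> Obj V" by (auto simp: Hom_iff)
  have p: "pr1 V X Y \<in> Hom V (product V X Y) X" "pr2 V X Y \<in> Hom V (product V X Y) Y"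
    using XY by (simp_all add: Hom_iff)
  obtain u where u: "u \<in> Hom V (product V X Y) Q" "q1 \<cdot> u = pr1 V X Y" "q2 \<cdot> u = pr2 V X Y"
    using assms p unfolding is_product_def prod.case by blast
  let ?v = "pairing V q1 q2"
  have v: "?v \<in> Hom V Q (product V X Y)" "pr1 V X Y \<cdot> ?v = q1" "pr2 V X Y \<cdot> ?v = q2"
    using pairing_aux[OF q] by blast+
  have "?v \<cdot> u = Ident V (product V X Y)"
    using u q XY by (simp add: Hom_iff)
  then show ?thesis using that u v by blast
qed

lemma exponential_unique:
  assumes "is_exponential V X Y (M, e)" "X \<in> Obj V" "Y \<in> Obj V"
  obtains w where "w \<in> Hom V (exponent V X Y) M" "is_iso V w"
    "e \<cdot> prod_map V w (Ident V X) = evalmap V X Y"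
proof -
  let ?E = "exponent V X Y"
  have ex: "exponentiable V X Y" using assms unfolding exponentiable_def by blast
  have M: "M \<in> Obj V" "e \<in> Hom V (product V M X) Y"
    and uM: "\<And>Z f. Z \<in> Obj V \<Longrightarrow> f \<in> Hom V (product V Z X) Y \<Longrightarrow>
      \<exists>!h. h \<in> Hom V Z M \<and> e \<cdot> prod_map V h (Ident V X) = f"
    using assms(1) unfolding is_exponential_def by auto
  have e [simp]: "e \<in> Arr V" "Dom V e = product V M X" "Cod V e = Y" using M by (simp_all add: Hom_iff)
  note [simp] = ex M(1) assms(2,3)
  have "evalmap V X Y \<in> Hom V (product V ?E X) Y" by (simp add: Hom_iff)
  from uM[OF _ this] obtain w where w: "w \<in> Hom V ?E M" "e \<cdot> prod_map V w (Ident V X) = evalmap V X Y"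
    by auto
  then have [simp]: "w \<in> Arr V" "Dom V w = ?E" "Cod V w = M" by (simp_all add: Hom_iff)
  let ?t = "exp_transpose V M X e"
  have t: "?t \<in> Hom V M ?E" "evalmap V X Y \<cdot> prod_map V ?t (Ident V X) = e"
    using exp_transpose_aux[OF ex M] by blast+
  have ew: "e \<cdot> pairing V (w \<cdot> z) u = evalmap V X Y \<cdot> pairing V z u"
    if "z \<in> Hom V Z ?E" "u \<in> Hom V Z X" for z u Z
  proof -
    have "(e \<cdot> prod_map V w (Ident V X)) \<cdot> pairing V z u = evalmap V X Y \<cdot> pairing V z u"
      using w(2) by simp
    then show ?thesis using that by (simp add: Hom_iff)
  qed
  have "?t \<cdot> w = Ident V ?E"
    by (rule exponent_ext[OF ex, of _ ?E])
       (use ew in \<open>auto simp: Hom_iff\<close>)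
  moreover have "w \<cdot> ?t = Ident V M"
  proof -
    have "e \<cdot> prod_map V (w \<cdot> ?t) (Ident V X) = e"
      using ew[of "?t \<cdot> pr1 V M X" "product V M X" "pr2 V M X"] t(2) by (simp add: Hom_iff)
    moreover have "w \<cdot> ?t \<in> Hom V M M" by (simp add: Hom_iff)
    moreover have "e \<cdot> prod_map V (Ident V M) (Ident V X) = e" "Ident V M \<in> Hom V M M"
      by (simp_all add: Hom_iff)
    ultimately show ?thesis using uM[OF M] by blast
  qed
  ultimately have "is_iso V w" using is_isoI[OF w(1) t(1)] by blast
  then show ?thesis using that w by blast
qed

end

locale ccc_with_pullbacks = cartesian_category V for V :: "('o, 'a) cat" (structure) +
  assumes ex_exponential: "X \<in> Obj V \<Longrightarrow> Y \<in> Obj V \<Longrightarrow> \<exists>c. is_exponential V X Y c"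
    and ex_pullback: "has_pullbacks V"
begin

lemma exponentiable_all [simp]: "X \<in> Obj V \<Longrightarrow> Y \<in> Obj V \<Longrightarrow> exponentiable V X Y"
  using ex_exponential by (simp add: exponentiable_def)

lemma is_pullback_chosen:
  assumes "f \<in> Arr V" "g \<in> Arr V" "Cod V f = Cod V g"
  shows "is_pullback V f g (pullback V f g, pb1 V f g, pb2 V f g)"
  using someI_ex[of "is_pullback V f g"] ex_pullback assms
  unfolding pullback_def pb1_def pb2_def pullback_cone_def has_pullbacks_def by simp

lemma pb_simps [simp]:
  assumes "f \<in> Arr V" "g \<in> Arr V" "Cod V f = Cod V g"
  shows "pullback V f g \<in> Obj V"
    "pb1 V f g \<in> Arr V" "Dom V (pb1 V f g) = pullback V f g" "Cod V (pb1 V f g) = Dom V f"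
    "pb2 V f g \<in> Arr V" "Dom V (pb2 V f g) = pullback V f g" "Cod V (pb2 V f g) = Dom V g"
  using is_pullback_chosen[OF assms] by (auto simp: is_pullback_def Hom_iff)

lemma pb_commutes:
  assumes "f \<in> Arr V" "g \<in> Arr V" "Cod V f = Cod V g"
  shows "f \<cdot> pb1 V f g = g \<cdot> pb2 V f g"
  using is_pullback_chosen[OF assms] by (auto simp: is_pullback_def)

lemma pb_lift_aux:
  assumes "f \<in> Arr V" "g \<in> Arr V" "Cod V f = Cod V g"
    "u \<in> Hom V Z (Dom V f)" "v \<in> Hom V Z (Dom V g)" "f \<cdot> u = g \<cdot> v"
  shows "pb_lift V f g u v \<in> Hom V Z (pullback V f g) \<and>
    pb1 V f g \<cdot> pb_lift V f g u v = u \<and> pb2 V f g \<cdot> pb_lift V f g u v = v"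
proof -
  have "\<exists>!h. h \<in> Hom V Z (pullback V f g) \<and> pb1 V f g \<cdot> h = u \<and> pb2 V f g \<cdot> h = v"
    using is_pullback_chosen[OF assms(1-3)] assms(4-) unfolding is_pullback_def by auto
  moreover have "Dom V u = Z" using assms by (simp add: Hom_iff)
  ultimately show ?thesis unfolding pb_lift_def using theI' by simp
qed

lemma pb_lift_simps [simp]:
  assumes "f \<in> Arr V" "g \<in> Arr V" "Cod V f = Cod V g"
    "u \<in> Arr V" "v \<in> Arr V" "Dom V u = Dom V v" "Cod V u = Dom V f" "Cod V v = Dom V g"
    "f \<cdot> u = g \<cdot> v"
  shows "pb_lift V f g u v \<in> Arr V" "Dom V (pb_lift V f g u v) = Dom V v"
    "Cod V (pb_lift V f g u v) = pullback V f g"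
    "pb1 V f g \<cdot> pb_lift V f g u v = u" "pb2 V f g \<cdot> pb_lift V f g u v = v"
  using pb_lift_aux[of f g u "Dom V v" v] assms by (auto simp: Hom_iff)

lemma pullback_eqI:
  assumes "f \<in> Arr V" "g \<in> Arr V" "Cod V f = Cod V g"
    "h \<in> Hom V Z (pullback V f g)" "k \<in> Hom V Z (pullback V f g)"
    "pb1 V f g \<cdot> h = pb1 V f g \<cdot> k" "pb2 V f g \<cdot> h = pb2 V f g \<cdot> k"
  shows "h = k"
proof -
  have eq: "f \<cdot> (pb1 V f g \<cdot> k) = g \<cdot> (pb2 V f g \<cdot> k)"
    using assms pb_commutes[OF assms(1-3)] assoc[symmetric] by (simp add: Hom_iff del: assoc)
  have m: "pb1 V f g \<cdot> k \<in> Hom V Z (Dom V f)" "pb2 V f g \<cdot> k \<in> Hom V Z (Dom V g)"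
    using assms(1-5) by (auto simp: Hom_iff)
  have "\<exists>!m. m \<in> Hom V Z (pullback V f g) \<and> pb1 V f g \<cdot> m = pb1 V f g \<cdot> k
      \<and> pb2 V f g \<cdot> m = pb2 V f g \<cdot> k"
    using is_pullback_chosen[OF assms(1-3)] eq m unfolding is_pullback_def prod.case by blast
  then show ?thesis using assms by metis
qed

lemma pb_lift_comp:
  assumes "f \<in> Arr V" "g \<in> Arr V" "Cod V f = Cod V g"
    "u \<in> Arr V" "v \<in> Arr V" "Dom V u = Dom V v" "Cod V u = Dom V f" "Cod V v = Dom V g"
    "f \<cdot> u = g \<cdot> v" "z \<in> Arr V" "Cod V z = Dom V v"
  shows "pb_lift V f g u v \<cdot> z = pb_lift V f g (u \<cdot> z) (v \<cdot> z)"
proof -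
  have e: "f \<cdot> (u \<cdot> z) = g \<cdot> (v \<cdot> z)"
    using assms assoc[symmetric] by (simp del: assoc)
  show ?thesis
    by (rule pullback_eqI[OF assms(1-3), of _ "Dom V z"])
       (use assms e in \<open>auto simp: Hom_iff assoc[symmetric] simp del: assoc\<close>)
qed

lemma pb_lift_pb [simp]:
  assumes "f \<in> Arr V" "g \<in> Arr V" "Cod V f = Cod V g"
  shows "pb_lift V f g (pb1 V f g) (pb2 V f g) = Ident V (pullback V f g)"
  by (rule pullback_eqI[OF assms, of _ "pullback V f g"])
     (use assms in \<open>auto simp: Hom_iff pb_commutes\<close>)

end

section \<open>Extensivity\<close>

context category
begin

lemma iso_cancel_right:
  assumes "is_iso V e" "e \<in> Hom V X Y" "f \<in> Hom V Y Z" "g \<in> Hom V Y Z" "f \<cdot> e = g \<cdot> e"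
  shows "f = g"
proof -
  obtain k where k: "k \<in> Hom V Y X" "e \<cdot> k = Ident V Y"
    using is_isoE[OF assms(1,2)] by metis
  have "(f \<cdot> e) \<cdot> k = (g \<cdot> e) \<cdot> k" using assms(5) by simp
  then show ?thesis using k assms(2-4) by (simp add: Hom_iff)
qed

lemma iso_cancel_left:
  assumes "is_iso V e" "e \<in> Hom V X Y" "f \<in> Hom V Z X" "g \<in> Hom V Z X" "e \<cdot> f = e \<cdot> g"
  shows "f = g"
proof -
  obtain k where k: "k \<in> Hom V Y X" "k \<cdot> e = Ident V X"
    using is_isoE[OF assms(1,2)] by metis
  have "f = (k \<cdot> e) \<cdot> f" using k assms(3) by (simp add: Hom_iff)
  also have "\<dots> = (k \<cdot> e) \<cdot> g" using k(1) assms(2-5) by (simp add: Hom_iff)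
  also have "\<dots> = g" using k assms(4) by (simp add: Hom_iff)
  finally show ?thesis .
qed

end

text \<open>The preimage of \<open>r\<close> is obtained by conjugating \<open>G r\<close> with the unit. That its image is \<open>r\<close> follows since
\<open>G\<close> is faithful, which in turn follows from naturality of the counit.\<close>

lemma equivalence_full:
  assumes "category A" "category B" "is_equivalence A B F" "X \<in> Obj A" "Y \<in> Obj A"
    "r \<in> Hom B (FObj F X) (FObj F Y)"
  shows "\<exists>a \<in> Hom A X Y. FArr F a = r"
proof -
  interpret A: category A by fact
  interpret B: category B by fact
  obtain G \<eta> \<epsilon> where F: "is_functor A B F" and G: "is_functor B A G"
    and \<eta>: "is_natural_iso A A id_ftor (comp_ftor G F) \<eta>"
    and \<epsilon>: "is_natural_iso B B (comp_ftor F G) id_ftor \<epsilon>"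
    using assms(3) unfolding is_equivalence_def by blast
  let ?FX = "FObj F X" and ?FY = "FObj F Y"
  have FO: "?FX \<in> Obj B" "?FY \<in> Obj B" using F assms unfolding is_functor_def by auto
  have \<eta>H: "\<eta> X \<in> Hom A X (FObj G ?FX)" "\<eta> Y \<in> Hom A Y (FObj G ?FY)"
      "is_iso A (\<eta> X)" "is_iso A (\<eta> Y)"
    using \<eta> assms(4,5) unfolding is_natural_iso_def id_ftor_def comp_ftor_def by auto
  have \<epsilon>H: "\<epsilon> ?FX \<in> Hom B (FObj F (FObj G ?FX)) ?FX" "is_iso B (\<epsilon> ?FX)"
    using \<epsilon> FO unfolding is_natural_iso_def id_ftor_def comp_ftor_def by auto
  obtain k where k: "k \<in> Hom A (FObj G ?FY) Y" "\<eta> Y \<cdot>\<^bsub>A\<^esub> k = Ident A (FObj G ?FY)"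
    using A.is_isoE[OF \<eta>H(4,2)] by metis
  have Gr: "FArr G r \<in> Hom A (FObj G ?FX) (FObj G ?FY)"
    using G assms(6) unfolding is_functor_def by auto
  define a where "a = k \<cdot>\<^bsub>A\<^esub> (FArr G r \<cdot>\<^bsub>A\<^esub> \<eta> X)"
  have a: "a \<in> Hom A X Y"
    unfolding a_def using k Gr \<eta>H by (auto simp: A.Hom_iff)
  have Fa: "FArr F a \<in> Hom B ?FX ?FY" using F a unfolding is_functor_def by auto
  have GFa: "FArr G (FArr F a) \<in> Hom A (FObj G ?FX) (FObj G ?FY)"
    using G Fa unfolding is_functor_def by auto
  have "\<eta> Y \<cdot>\<^bsub>A\<^esub> a = (\<eta> Y \<cdot>\<^bsub>A\<^esub> k) \<cdot>\<^bsub>A\<^esub> (FArr G r \<cdot>\<^bsub>A\<^esub> \<eta> X)"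
    unfolding a_def using k(1) Gr \<eta>H by (auto simp: A.Hom_iff)
  also have "\<dots> = FArr G r \<cdot>\<^bsub>A\<^esub> \<eta> X" using k Gr \<eta>H by (auto simp: A.Hom_iff)
  finally have "\<eta> Y \<cdot>\<^bsub>A\<^esub> a = FArr G r \<cdot>\<^bsub>A\<^esub> \<eta> X" .
  moreover have "\<eta> Y \<cdot>\<^bsub>A\<^esub> a = FArr G (FArr F a) \<cdot>\<^bsub>A\<^esub> \<eta> X"
    using \<eta> a unfolding is_natural_iso_def id_ftor_def comp_ftor_def by auto
  ultimately have GG: "FArr G (FArr F a) = FArr G r"
    using A.iso_cancel_right[OF \<eta>H(3,1) GFa Gr] by simp
  have nat: "\<epsilon> ?FY \<cdot>\<^bsub>B\<^esub> FArr F (FArr G q) = q \<cdot>\<^bsub>B\<^esub> \<epsilon> ?FX" if "q \<in> Hom B ?FX ?FY" for q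
    using \<epsilon> that unfolding is_natural_iso_def id_ftor_def comp_ftor_def by auto
  have "FArr F a = r"
    by (rule B.iso_cancel_right[OF \<epsilon>H(2,1) Fa assms(6)])
       (use nat[OF Fa] nat[OF assms(6)] GG in simp)
  then show ?thesis using a by blast
qed

lemma Hom_slice:
  "t \<in> Hom (slice V X) f g \<longleftrightarrow> (\<exists>h. t = (f, h, g) \<and> f \<in> Arr V \<and> Cod V f = X \<and> g \<in> Arr V
    \<and> Cod V g = X \<and> h \<in> Hom V (Dom V f) (Dom V g) \<and> g \<cdot>\<^bsub>V\<^esub> h = f)"
  by (auto simp: Hom_def slice_def)

lemma slice_sel [simp]:
  "Obj (slice V X) = {f \<in> Arr V. Cod V f = X}"
  "Dom (slice V X) (f, h, g) = f" "Cod (slice V X) (f, h, g) = g"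
  "Ident (slice V X) f = (f, Ident V (Dom V f), f)"
  "(f', h', g') \<cdot>\<^bsub>slice V X\<^esub> (f, h, g) = (f, h' \<cdot>\<^bsub>V\<^esub> h, g')"
  by (simp_all add: slice_def)

lemma category_slice:
  assumes "category V"
  shows "category (slice V X)"
proof -
  interpret category V by fact
  show ?thesis
  proof
    fix f g h x y z w
    show "f \<in> Arr (slice V X) \<Longrightarrow> Dom (slice V X) f \<in> Obj (slice V X)"
      and "f \<in> Arr (slice V X) \<Longrightarrow> Cod (slice V X) f \<in> Obj (slice V X)"
      by (auto simp: slice_def)
    show "f \<in> Hom (slice V X) x y \<Longrightarrow> g \<in> Hom (slice V X) y z \<Longrightarrow>
        g \<cdot>\<^bsub>slice V X\<^esub> f \<in> Hom (slice V X) x z"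
    proof -
      assume "f \<in> Hom (slice V X) x y" "g \<in> Hom (slice V X) y z"
      then obtain h k where f: "f = (x, h, y)" "x \<in> Arr V" "Cod V x = X"
          "h \<in> Hom V (Dom V x) (Dom V y)" "y \<cdot>\<^bsub>V\<^esub> h = x"
        and g: "g = (y, k, z)" "z \<in> Arr V" "Cod V z = X"
          "k \<in> Hom V (Dom V y) (Dom V z)" "z \<cdot>\<^bsub>V\<^esub> k = y"
        unfolding Hom_slice by blast
      have "z \<cdot>\<^bsub>V\<^esub> (k \<cdot>\<^bsub>V\<^esub> h) = x"
        using f(4,5) g(2-5) assoc[of h k z] by (simp add: Hom_iff)
      then show ?thesis unfolding Hom_slice using f g by (auto intro: comp_in_Hom)
    qed
    have D: "\<exists>h. t = (p, h, q) \<and> h \<in> Hom V (Dom V p) (Dom V q)"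
      if "t \<in> Hom (slice V X) p q" for t p q
      using that unfolding Hom_slice by blast
    show "x \<in> Obj (slice V X) \<Longrightarrow> Ident (slice V X) x \<in> Hom (slice V X) x x"
      unfolding Hom_slice by (simp add: Hom_iff)
    show "f \<in> Hom (slice V X) x y \<Longrightarrow> Ident (slice V X) y \<cdot>\<^bsub>slice V X\<^esub> f = f"
      using D[of f x y] comp_ident_left by auto
    show "f \<in> Hom (slice V X) x y \<Longrightarrow> f \<cdot>\<^bsub>slice V X\<^esub> Ident (slice V X) x = f"
      using D[of f x y] comp_ident_right by auto
    show "f \<in> Hom (slice V X) w x \<Longrightarrow> g \<in> Hom (slice V X) x y \<Longrightarrow> h \<in> Hom (slice V X) y z \<Longrightarrow>
        (h \<cdot>\<^bsub>slice V X\<^esub> g) \<cdot>\<^bsub>slice V X\<^esub> f = h \<cdot>\<^bsub>slice V X\<^esub> (g \<cdot>\<^bsub>slice V X\<^esub> f)"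
      using D[of f w x] D[of g x y] D[of h y z] comp_assoc by auto
  qed
qed

lemma Hom_product_cat:
  "a \<in> Hom (product_cat I K) x y \<longleftrightarrow> a \<in> extensional I \<and> x \<in> extensional I \<and> y \<in> extensional I
    \<and> (\<forall>i\<in>I. a i \<in> Hom (K i) (x i) (y i))"
  unfolding Hom_def product_cat_def
  by (auto simp: PiE_def Pi_def extensional_def restrict_def fun_eq_iff)

lemma category_product_cat:
  assumes "\<And>i. i \<in> I \<Longrightarrow> category (K i)"
  shows "category (product_cat I K)"
proof
  fix f g h x y z w
  let ?P = "product_cat I K"
  show "f \<in> Arr ?P \<Longrightarrow> Dom ?P f \<in> Obj ?P" "f \<in> Arr ?P \<Longrightarrow> Cod ?P f \<in> Obj ?P"
    using assms by (auto simp: product_cat_def intro!: category.dom_in_Obj category.cod_in_Obj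
        dest: PiE_mem)
  show "x \<in> Obj ?P \<Longrightarrow> Ident ?P x \<in> Hom ?P x x"
    using assms unfolding Hom_product_cat
    by (auto simp: product_cat_def PiE_def intro: category.ident_in_Hom)
  show "f \<in> Hom ?P x y \<Longrightarrow> g \<in> Hom ?P y z \<Longrightarrow> g \<cdot>\<^bsub>?P\<^esub> f \<in> Hom ?P x z"
    using assms unfolding Hom_product_cat
    by (auto simp: product_cat_def intro: category.comp_in_Hom)
  show "f \<in> Hom ?P x y \<Longrightarrow> Ident ?P y \<cdot>\<^bsub>?P\<^esub> f = f"
    using assms unfolding Hom_product_cat
    by (auto simp: product_cat_def fun_eq_iff restrict_def extensional_def
        intro: category.comp_ident_left)
  show "f \<in> Hom ?P x y \<Longrightarrow> f \<cdot>\<^bsub>?P\<^esub> Ident ?P x = f"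
    using assms unfolding Hom_product_cat
    by (auto simp: product_cat_def fun_eq_iff restrict_def extensional_def
        intro: category.comp_ident_right)
  show "f \<in> Hom ?P w x \<Longrightarrow> g \<in> Hom ?P x y \<Longrightarrow> h \<in> Hom ?P y z \<Longrightarrow>
      (h \<cdot>\<^bsub>?P\<^esub> g) \<cdot>\<^bsub>?P\<^esub> f = h \<cdot>\<^bsub>?P\<^esub> (g \<cdot>\<^bsub>?P\<^esub> f)"
    using assms unfolding Hom_product_cat
    by (auto simp: product_cat_def fun_eq_iff restrict_def intro: category.comp_assoc)
qed

definition is_initial :: "('o, 'a) cat \<Rightarrow> 'o \<Rightarrow> bool" where
  "is_initial V Z \<longleftrightarrow> Z \<in> Obj V \<and> (\<forall>T\<in>Obj V. \<exists>!f. f \<in> Hom V Z T)"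

context category
begin

lemma initial_eq: "is_initial V Z \<Longrightarrow> u \<in> Hom V Z T \<Longrightarrow> v \<in> Hom V Z T \<Longrightarrow> u = v"
  unfolding is_initial_def by (auto simp: Hom_iff)

lemma initial_ex: "is_initial V Z \<Longrightarrow> T \<in> Obj V \<Longrightarrow> \<exists>u. u \<in> Hom V Z T"
  unfolding is_initial_def by blast

lemma is_coproduct_incl:
  assumes "is_coproduct V I X (S, \<iota>)"
  shows "S \<in> Obj V" "i \<in> I \<Longrightarrow> \<iota> i \<in> Hom V (X i) S"
  using assms by (auto simp: is_coproduct_def)

lemma is_coproduct_ext:
  assumes "is_coproduct V I X (S, \<iota>)" "u \<in> Hom V S T" "v \<in> Hom V S T"
    "\<And>i. i \<in> I \<Longrightarrow> u \<cdot> \<iota> i = v \<cdot> \<iota> i"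
  shows "u = v"
proof -
  have T: "T \<in> Obj V" using assms by (simp add: Hom_iff)
  have v: "\<forall>i\<in>I. v \<cdot> \<iota> i \<in> Hom V (X i) T"
    using is_coproduct_incl[OF assms(1)] assms(3) by (auto intro: comp_in_Hom)
  have "\<forall>f. (\<forall>i\<in>I. f i \<in> Hom V (X i) T) \<longrightarrow> (\<exists>!h. h \<in> Hom V S T \<and> (\<forall>i\<in>I. h \<cdot> \<iota> i = f i))"
    using assms(1) T unfolding is_coproduct_def by simp
  from spec[OF this, of "\<lambda>i. v \<cdot> \<iota> i"] v
  have "\<exists>!h. h \<in> Hom V S T \<and> (\<forall>i\<in>I. h \<cdot> \<iota> i = v \<cdot> \<iota> i)" by blast
  then show ?thesis using assms by blast
qed

lemma is_coproduct_ex: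
  assumes "is_coproduct V I X (S, \<iota>)" "T \<in> Obj V" "\<And>i. i \<in> I \<Longrightarrow> f i \<in> Hom V (X i) T"
  obtains h where "h \<in> Hom V S T" "\<And>i. i \<in> I \<Longrightarrow> h \<cdot> \<iota> i = f i"
proof -
  have "\<exists>!h. h \<in> Hom V S T \<and> (\<forall>i\<in>I. h \<cdot> \<iota> i = f i)"
    using assms unfolding is_coproduct_def prod.case by (elim conjE) blast
  then show ?thesis using that by blast
qed

lemma is_coproductI:
  assumes "S \<in> Obj V" "\<And>i. i \<in> I \<Longrightarrow> \<iota> i \<in> Hom V (X i) S"
    "\<And>T f. T \<in> Obj V \<Longrightarrow> (\<And>i. i \<in> I \<Longrightarrow> f i \<in> Hom V (X i) T) \<Longrightarrow>
      \<exists>h. h \<in> Hom V S T \<and> (\<forall>i\<in>I. h \<cdot> \<iota> i = f i)"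
    "\<And>T u v. u \<in> Hom V S T \<Longrightarrow> v \<in> Hom V S T \<Longrightarrow> (\<And>i. i \<in> I \<Longrightarrow> u \<cdot> \<iota> i = v \<cdot> \<iota> i) \<Longrightarrow> u = v"
  shows "is_coproduct V I X (S, \<iota>)"
  unfolding is_coproduct_def prod.case
proof (intro conjI ballI allI impI)
  fix T f assume T: "T \<in> Obj V" and f: "\<forall>i\<in>I. f i \<in> Hom V (X i) T"
  obtain h where h: "h \<in> Hom V S T" "\<forall>i\<in>I. h \<cdot> \<iota> i = f i" using assms(3)[OF T] f by metis
  show "\<exists>!h. h \<in> Hom V S T \<and> (\<forall>i\<in>I. h \<cdot> \<iota> i = f i)"
    by (rule ex1I[of _ h]) (use h assms(4) in auto)
qed (use assms in auto)

lemma is_coproduct_iso: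
  assumes "is_coproduct V I X (S, \<iota>)" "is_iso V h" "h \<in> Hom V S S'"
  shows "is_coproduct V I X (S', \<lambda>i. h \<cdot> \<iota> i)"
proof (rule is_coproductI)
  obtain k where k: "k \<in> Hom V S' S" "k \<cdot> h = Ident V S" "h \<cdot> k = Ident V S'"
    using is_isoE[OF assms(2,3)] by metis
  show "S' \<in> Obj V" using assms by (simp add: Hom_iff)
  show "\<And>i. i \<in> I \<Longrightarrow> h \<cdot> \<iota> i \<in> Hom V (X i) S'"
    using is_coproduct_incl[OF assms(1)] assms by (auto intro: comp_in_Hom)
  fix T
  { fix f assume T: "T \<in> Obj V" and f: "\<And>i. i \<in> I \<Longrightarrow> f i \<in> Hom V (X i) T"
    obtain m where m: "m \<in> Hom V S T" "\<And>i. i \<in> I \<Longrightarrow> m \<cdot> \<iota> i = f i"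
      using is_coproduct_ex[OF assms(1) T] f by blast
    have "(m \<cdot> k) \<cdot> (h \<cdot> \<iota> i) = f i" if i: "i \<in> I" for i
    proof -
      have "(m \<cdot> k) \<cdot> (h \<cdot> \<iota> i) = m \<cdot> ((k \<cdot> h) \<cdot> \<iota> i)"
        using m k(1) is_coproduct_incl(2)[OF assms(1) i] assms(3) by (auto simp: Hom_iff)
      also have "\<dots> = f i"
        using m k(2) i is_coproduct_incl(2)[OF assms(1) i] assms(3) by (auto simp: Hom_iff)
      finally show ?thesis .
    qed
    then show "\<exists>n. n \<in> Hom V S' T \<and> (\<forall>i\<in>I. n \<cdot> (h \<cdot> \<iota> i) = f i)"
      using m k by (blast intro: comp_in_Hom) }
  fix u v assume u: "u \<in> Hom V S' T" and v: "v \<in> Hom V S' T"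
    and uv: "\<And>i. i \<in> I \<Longrightarrow> u \<cdot> (h \<cdot> \<iota> i) = v \<cdot> (h \<cdot> \<iota> i)"
  have "u \<cdot> h = v \<cdot> h"
  proof (rule is_coproduct_ext[OF assms(1)])
    fix i assume i: "i \<in> I"
    show "(u \<cdot> h) \<cdot> \<iota> i = (v \<cdot> h) \<cdot> \<iota> i"
      using uv[OF i] u v is_coproduct_incl(2)[OF assms(1) i] assms(3) by (auto simp: Hom_iff)
  qed (use u v assms(3) in \<open>auto intro: comp_in_Hom\<close>)
  then show "u = v" using iso_cancel_right[OF assms(2,3) u v] by simp
qed

lemma is_coproduct_unique:
  assumes "is_coproduct V I X (S, \<iota>)" "is_coproduct V I X (S', \<iota>')"
  obtains h where "h \<in> Hom V S S'" "is_iso V h" "\<And>i. i \<in> I \<Longrightarrow> h \<cdot> \<iota> i = \<iota>' i"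
proof -
  note i1 = is_coproduct_incl[OF assms(1)] and i2 = is_coproduct_incl[OF assms(2)]
  obtain h where h: "h \<in> Hom V S S'" "\<And>i. i \<in> I \<Longrightarrow> h \<cdot> \<iota> i = \<iota>' i"
    using is_coproduct_ex[OF assms(1) i2(1), of \<iota>'] i2(2) by blast
  obtain k where k: "k \<in> Hom V S' S" "\<And>i. i \<in> I \<Longrightarrow> k \<cdot> \<iota>' i = \<iota> i"
    using is_coproduct_ex[OF assms(2) i1(1), of \<iota>] i1(2) by blast
  have "k \<cdot> h = Ident V S"
  proof (rule is_coproduct_ext[OF assms(1)])
    fix i assume i: "i \<in> I"
    show "(k \<cdot> h) \<cdot> \<iota> i = Ident V S \<cdot> \<iota> i"
      using h(1) h(2)[OF i] k(1) k(2)[OF i] i1(2)[OF i] by (simp add: Hom_iff)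
  qed (use h k i1 in \<open>auto intro: comp_in_Hom ident_in_Hom\<close>)
  moreover have "h \<cdot> k = Ident V S'"
  proof (rule is_coproduct_ext[OF assms(2)])
    fix i assume i: "i \<in> I"
    show "(h \<cdot> k) \<cdot> \<iota>' i = Ident V S' \<cdot> \<iota>' i"
      using h(1) h(2)[OF i] k(1) k(2)[OF i] i2(2)[OF i] by (simp add: Hom_iff)
  qed (use h k i2 in \<open>auto intro: comp_in_Hom ident_in_Hom\<close>)
  ultimately have "is_iso V h" using is_isoI h k by blast
  then show ?thesis using that h by blast
qed

lemma is_coproduct_reindex:
  assumes "is_coproduct V (e ` K) X (S, \<iota>)" "inj_on e K"
  shows "is_coproduct V K (\<lambda>k. X (e k)) (S, \<lambda>k. \<iota> (e k))"
proof (rule is_coproductI)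
  note i = is_coproduct_incl[OF assms(1)]
  show "S \<in> Obj V" "\<And>k. k \<in> K \<Longrightarrow> \<iota> (e k) \<in> Hom V (X (e k)) S" using i by auto
  fix T
  { fix f assume T: "T \<in> Obj V" and f: "\<And>k. k \<in> K \<Longrightarrow> f k \<in> Hom V (X (e k)) T"
    have "f (inv_into K e j) \<in> Hom V (X j) T" if "j \<in> e ` K" for j
      using f[of "inv_into K e j"] that assms(2) by (auto simp: inv_into_f_f)
    from is_coproduct_ex[OF assms(1) T this]
    obtain h where "h \<in> Hom V S T" "\<And>j. j \<in> e ` K \<Longrightarrow> h \<cdot> \<iota> j = f (inv_into K e j)" by metis
    then show "\<exists>h. h \<in> Hom V S T \<and> (\<forall>k\<in>K. h \<cdot> \<iota> (e k) = f k)"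
      using assms(2) by (auto simp: inv_into_f_f) }
  show "\<And>u v. u \<in> Hom V S T \<Longrightarrow> v \<in> Hom V S T \<Longrightarrow>
      (\<And>k. k \<in> K \<Longrightarrow> u \<cdot> \<iota> (e k) = v \<cdot> \<iota> (e k)) \<Longrightarrow> u = v"
    using is_coproduct_ext[OF assms(1)] by blast
qed

lemma is_coproduct_reindex_inv:
  assumes "is_coproduct V K X (S, \<iota>)" "inj_on e K"
  shows "is_coproduct V (e ` K) (\<lambda>j. X (inv_into K e j)) (S, \<lambda>j. \<iota> (inv_into K e j))"
proof (rule is_coproduct_reindex)
  have "inv_into K e ` (e ` K) = K" using assms(2) by simp
  then show "is_coproduct V (inv_into K e ` (e ` K)) X (S, \<iota>)" using assms(1) by simp
  show "inj_on (inv_into K e) (e ` K)" by (simp add: inj_on_inv_into)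
qed

lemma is_coproduct_cong:
  assumes "is_coproduct V K X (S, \<iota>)" "\<And>k. k \<in> K \<Longrightarrow> X k = X' k" "\<And>k. k \<in> K \<Longrightarrow> \<iota> k = \<iota>' k"
  shows "is_coproduct V K X' (S, \<iota>')"
  using assms unfolding is_coproduct_def by simp

lemma is_coproduct_chosen:
  assumes "\<exists>c. is_coproduct V I X c"
  shows "is_coproduct V I X (coproduct V I X, incl V I X)"
  using someI_ex[OF assms] unfolding coproduct_def incl_def coproduct_cocone_def by simp

lemma copair:
  assumes "\<exists>c. is_coproduct V I X c" "T \<in> Obj V" "\<And>i. i \<in> I \<Longrightarrow> f i \<in> Hom V (X i) T"
  shows "copair V I X T f \<in> Hom V (coproduct V I X) T"
    "i \<in> I \<Longrightarrow> copair V I X T f \<cdot> incl V I X i = f i"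
proof -
  have "\<exists>!h. h \<in> Hom V (coproduct V I X) T \<and> (\<forall>i\<in>I. h \<cdot> incl V I X i = f i)"
    using is_coproduct_chosen[OF assms(1)] assms(2,3)
    unfolding is_coproduct_def prod.case by (elim conjE) blast
  from theI'[OF this] show "copair V I X T f \<in> Hom V (coproduct V I X) T"
    "i \<in> I \<Longrightarrow> copair V I X T f \<cdot> incl V I X i = f i"
    unfolding copair_def by auto
qed

end

definition small :: "'i itself \<Rightarrow> 'k set \<Rightarrow> bool" where
  "small _ K \<longleftrightarrow> (\<exists>e :: 'k \<Rightarrow> 'i. inj_on e K)"

lemma small_same [simp]: "small TYPE('i) (I :: 'i set)"
  unfolding small_def by (rule exI[of _ id]) simp

text \<open>The coproducts over pairs of objects that enter the category of elements are small because
  an infinite type is in bijection with its square.\<close>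

lemma small_pairs [simp]:
  assumes "infinite (UNIV :: 'i set)"
  shows "small TYPE('i) (K :: ('i \<times> 'i) set)"
proof -
  have "\<exists>e :: 'i \<times> 'i \<Rightarrow> 'i. inj_on e (UNIV \<times> UNIV) \<and> e ` (UNIV \<times> UNIV) \<subseteq> UNIV"
    unfolding card_of_ordLeq
    using assms by (intro ordIso_imp_ordLeq card_of_Times_same_infinite)
  then obtain e :: "'i \<times> 'i \<Rightarrow> 'i" where "inj_on e (UNIV \<times> UNIV)"
    by blast
  then show ?thesis unfolding small_def by (auto intro: inj_on_subset)
qed

locale extensive_category = ccc_with_pullbacks V
  for V :: "('o, 'a) cat" (structure) +
  fixes I_type :: "'i itself"
  assumes extensive: "extensive TYPE('i) V"
begin

lemma ex_coproduct_type:
  "\<forall>i\<in>I. Y i \<in> Obj V \<Longrightarrow> \<exists>c. is_coproduct V (I :: 'i set) Y c"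
  using extensive unfolding extensive_def by blast

lemma slice_equivalence:
  "\<forall>i\<in>I. Y i \<in> Obj V \<Longrightarrow>
    is_equivalence (product_cat I (\<lambda>i. slice V (Y i))) (slice V (coproduct V I Y))
      (coprod_slice_ftor V (I :: 'i set) Y)"
  using extensive unfolding extensive_def by blast

lemma FObj_coprod_slice:
  assumes "\<forall>i\<in>I. Y i \<in> Obj V" "\<forall>i\<in>(I :: 'i set). f i \<in> Hom V (X i) (Y i)"
  shows "FObj (coprod_slice_ftor V I Y) f
      \<in> Hom V (coproduct V I (\<lambda>i. Dom V (f i))) (coproduct V I Y)"
    "i \<in> I \<Longrightarrow> FObj (coprod_slice_ftor V I Y) f \<cdot> incl V I (\<lambda>i. Dom V (f i)) i = incl V I Y i \<cdot> f i"
proof -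
  have D: "\<forall>i\<in>I. Dom V (f i) \<in> Obj V" using assms(2) by (auto simp: Hom_iff)
  have H: "incl V I Y i \<cdot> f i \<in> Hom V (Dom V (f i)) (coproduct V I Y)" if "i \<in> I" for i
  proof (rule comp_in_Hom)
    show "f i \<in> Hom V (Dom V (f i)) (Y i)" using assms(2) that by (auto simp: Hom_iff)
  qed (use is_coproduct_incl[OF is_coproduct_chosen[OF ex_coproduct_type[OF assms(1)]]] that in auto)
  have S: "coproduct V I Y \<in> Obj V"
    using is_coproduct_incl(1)[OF is_coproduct_chosen[OF ex_coproduct_type[OF assms(1)]]] by blast
  note * = copair[OF ex_coproduct_type[OF D] S H]
  show "FObj (coprod_slice_ftor V I Y) f
      \<in> Hom V (coproduct V I (\<lambda>i. Dom V (f i))) (coproduct V I Y)"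
    using *(1) by (simp add: coprod_slice_ftor_def coprod_map_def Let_def)
  show "i \<in> I \<Longrightarrow> FObj (coprod_slice_ftor V I Y) f \<cdot> incl V I (\<lambda>i. Dom V (f i)) i
      = incl V I Y i \<cdot> f i"
    using *(2) by (simp add: coprod_slice_ftor_def coprod_map_def Let_def)
qed

text \<open>This is essential surjectivity of the coproduct functor on slices: \<open>f\<close> is isomorphic, as an object of the
slice, to a coproduct of arrows \<open>g i\<close> into the summands.\<close>

lemma decompose_chosen:
  assumes Y: "\<forall>i\<in>I. Y i \<in> Obj V" and f: "f \<in> Hom V Z (coproduct V (I :: 'i set) Y)"
  shows "\<exists>Z' \<kappa> g. is_coproduct V I Z' (Z, \<kappa>) \<and>
    (\<forall>i\<in>I. g i \<in> Hom V (Z' i) (Y i) \<and> f \<cdot> \<kappa> i = incl V I Y i \<cdot> g i)"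
proof -
  let ?A = "product_cat I (\<lambda>i. slice V (Y i))" and ?B = "slice V (coproduct V I Y)"
  let ?F = "coprod_slice_ftor V I Y"
  obtain G \<epsilon> where G: "is_functor ?B ?A G"
    and \<epsilon>: "is_natural_iso ?B ?B (comp_ftor ?F G) id_ftor \<epsilon>"
    using slice_equivalence[OF Y] unfolding is_equivalence_def by blast
  have fB: "f \<in> Obj ?B" using f by (simp add: Hom_iff)
  define g where "g = FObj G f"
  have "g \<in> Obj ?A" unfolding g_def using G fB unfolding is_functor_def by blast
  then have g: "\<forall>i\<in>I. g i \<in> Hom V (Dom V (g i)) (Y i)"
    using Y by (auto simp: product_cat_def PiE_def Pi_def Hom_iff)
  let ?D = "\<lambda>i. Dom V (g i)"
  note Fg = FObj_coprod_slice[OF Y g]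
  have "\<epsilon> f \<in> Hom ?B (FObj ?F g) f" and iso: "is_iso ?B (\<epsilon> f)"
    using \<epsilon> fB unfolding is_natural_iso_def comp_ftor_def id_ftor_def g_def by auto
  then obtain h where h: "\<epsilon> f = (FObj ?F g, h, f)" "h \<in> Hom V (coproduct V I ?D) Z"
      "f \<cdot> h = FObj ?F g"
    using Fg(1) f unfolding Hom_slice by (auto simp: Hom_iff)
  have "is_iso V h"
  proof -
    obtain k where k: "k \<in> Hom ?B f (FObj ?F g)"
        "k \<cdot>\<^bsub>?B\<^esub> \<epsilon> f = Ident ?B (FObj ?F g)" "\<epsilon> f \<cdot>\<^bsub>?B\<^esub> k = Ident ?B f"
      using iso unfolding is_iso_def h(1) slice_sel by blast
    then obtain k' where k': "k = (f, k', FObj ?F g)"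
        "k' \<in> Hom V (Dom V f) (Dom V (FObj ?F g))"
      unfolding Hom_slice by blast
    have "k' \<cdot> h = Ident V (Dom V (FObj ?F g))" "h \<cdot> k' = Ident V (Dom V f)"
      using k(2,3) unfolding h(1) k'(1) slice_sel by simp_all
    moreover have "Dom V (FObj ?F g) = coproduct V I ?D" "Dom V f = Z"
      using Fg(1) f by (auto simp: Hom_iff)
    ultimately have "k' \<in> Hom V Z (coproduct V I ?D)" "k' \<cdot> h = Ident V (coproduct V I ?D)"
        "h \<cdot> k' = Ident V Z"
      using k'(2) by simp_all
    then show ?thesis using is_isoI h(2) by blast
  qed
  moreover have D: "\<forall>i\<in>I. ?D i \<in> Obj V" using g by (auto simp: Hom_iff)
  note cop = is_coproduct_chosen[OF ex_coproduct_type[OF D]]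
  ultimately have "is_coproduct V I ?D (Z, \<lambda>i. h \<cdot> incl V I ?D i)"
    using is_coproduct_iso cop h(2) by blast
  moreover have "f \<cdot> (h \<cdot> incl V I ?D i) = incl V I Y i \<cdot> g i" if "i \<in> I" for i
    using Fg(2)[OF that] h is_coproduct_incl(2)[OF cop that] f assoc[of "incl V I ?D i" h f]
    by (auto simp: Hom_iff)
  ultimately show ?thesis using g by blast
qed

text \<open>The empty instance of the preceding lemma: an object over an empty coproduct is itself an empty coproduct.\<close>

lemma strict_initial:
  assumes "is_initial V Z" "f \<in> Hom V W Z"
  shows "is_initial V W"
proof -
  let ?O = "coproduct V ({} :: 'i set) (\<lambda>_. undefined)"
  have O: "?O \<in> Obj V"
    using is_coproduct_incl(1)[OF is_coproduct_chosen[OF ex_coproduct_type]] by simp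
  obtain g where "g \<in> Hom V Z ?O" using initial_ex[OF assms(1) O] by blast
  then have "g \<cdot> f \<in> Hom V W ?O" using assms(2) by (rule comp_in_Hom[rotated])
  from decompose_chosen[of "{}", OF _ this] obtain Z' \<kappa> where "is_coproduct V ({} :: 'i set) Z' (W, \<kappa>)"
    by blast
  then show ?thesis unfolding is_initial_def is_coproduct_def by simp
qed

lemma ex_initial: "\<exists>Z. is_initial V Z"
proof -
  have "is_coproduct V {} (\<lambda>_. undefined) (coproduct V ({} :: 'i set) (\<lambda>_. undefined),
      incl V ({} :: 'i set) (\<lambda>_. undefined))"
    by (rule is_coproduct_chosen[OF ex_coproduct_type]) simp
  then show ?thesis unfolding is_initial_def is_coproduct_def by auto
qed

text \<open>An arrow out of the coproduct is prescribed only on the summand \<open>i\<close>. Families of this kind reduce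
questions about a single summand to statements about coproducts of families.\<close>

lemma concentrated_coproduct:
  assumes "is_coproduct V I D (P, \<kappa>)" "i \<in> I" "\<And>k. k \<in> I \<Longrightarrow> k \<noteq> i \<Longrightarrow> is_initial V (D k)"
  obtains p where "p \<in> Hom V P (D i)" "p \<cdot> \<kappa> i = Ident V (D i)" "\<kappa> i \<cdot> p = Ident V P"
proof -
  note inc = is_coproduct_incl[OF assms(1)]
  have Di: "D i \<in> Obj V" using inc(2)[OF assms(2)] by (simp add: Hom_iff)
  define d where "d k = (if k = i then Ident V (D i) else SOME u. u \<in> Hom V (D k) (D i))" for k
  have d: "d k \<in> Hom V (D k) (D i)" if "k \<in> I" for k
    using someI_ex[OF initial_ex[OF assms(3)[OF that] Di]] Di unfolding d_def
    by (auto simp: Hom_iff)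
  obtain p where p: "p \<in> Hom V P (D i)" "\<And>k. k \<in> I \<Longrightarrow> p \<cdot> \<kappa> k = d k"
    using is_coproduct_ex[OF assms(1) Di d] by blast
  have pi: "p \<cdot> \<kappa> i = Ident V (D i)" using p(2)[OF assms(2)] by (simp add: d_def)
  have "\<kappa> i \<cdot> p = Ident V P"
  proof (rule is_coproduct_ext[OF assms(1)])
    fix k assume k: "k \<in> I"
    have l: "(\<kappa> i \<cdot> p) \<cdot> \<kappa> k \<in> Hom V (D k) P" "Ident V P \<cdot> \<kappa> k \<in> Hom V (D k) P"
      using inc p k assms(2) by (auto intro!: comp_in_Hom ident_in_Hom)
    show "(\<kappa> i \<cdot> p) \<cdot> \<kappa> k = Ident V P \<cdot> \<kappa> k"
    proof (cases "k = i")
      case True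
      then show ?thesis using inc(1) inc(2)[OF assms(2)] p(1) pi by (auto simp: Hom_iff)
    next
      case False
      then show ?thesis using initial_eq[OF assms(3)[OF k False]] l by blast
    qed
  qed (use inc p assms(2) in \<open>auto intro: comp_in_Hom ident_in_Hom\<close>)
  then show ?thesis using that p(1) pi by blast
qed

text \<open>Regard the common value of \<open>incl i \<cdot> u\<close> and \<open>incl j \<cdot> v\<close> as an object of the slice. It is the coproduct of the
family with \<open>u\<close> at \<open>i\<close>, and also of the family with \<open>v\<close> at \<open>j\<close>, with initial objects elsewhere. By fullness
the identity of \<open>Z\<close> comes from a morphism of families. If \<open>i\<close> and \<open>j\<close> differ, its component at \<open>i\<close> maps \<open>Z\<close>
to an initial object; otherwise this component is the identity, so that \<open>u = v\<close>.\<close>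

lemma incl_chosen_disjoint:
  assumes Y: "\<forall>k\<in>I. Y k \<in> Obj V" and i: "(i :: 'i) \<in> I" and j: "j \<in> I"
    and u: "u \<in> Hom V Z (Y i)" and v: "v \<in> Hom V Z (Y j)"
    and uv: "incl V I Y i \<cdot> u = incl V I Y j \<cdot> v"
  shows "(i = j \<and> u = v) \<or> (i \<noteq> j \<and> is_initial V Z)"
proof -
  obtain O' where O: "is_initial V O'" using ex_initial by blast
  define o' where "o' T = (SOME f. f \<in> Hom V O' T)" for T
  have o': "o' T \<in> Hom V O' T" if "T \<in> Obj V" for T
    unfolding o'_def using someI_ex[OF initial_ex[OF O that]] .
  \<comment> \<open>the family with \<open>m\<close> at the index \<open>l\<close> and an initial domain at every other index\<close>
  define single where "single l m = (\<lambda>k\<in>I. if k = l then m else o' (Y k))" for l :: 'i and m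
  have single_Hom: "\<forall>k\<in>I. single l m k \<in> Hom V (Dom V (single l m k)) (Y k)"
    if "l \<in> I" "m \<in> Hom V Z (Y l)" for l m
    using that o' Y by (auto simp: single_def Hom_iff)
  let ?P = "\<lambda>l m k. Dom V (single l m k)"
  let ?S = "coproduct V I Y" and ?F = "coprod_slice_ftor V I Y"
  note S = is_coproduct_incl[OF is_coproduct_chosen[OF ex_coproduct_type[OF Y]]]
  have P_same: "?P l m l = Z" if "l \<in> I" "m \<in> Hom V Z (Y l)" for l m
    using that by (simp add: single_def Hom_iff)
  have P_initial: "is_initial V (?P l m k)" if "k \<in> I" "k \<noteq> l" for l m k
    using that o'[OF bspec[OF Y that(1)]] O by (simp add: single_def Hom_iff)
  have cop: "is_coproduct V I (?P l m) (coproduct V I (?P l m), incl V I (?P l m))"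
    if "l \<in> I" "m \<in> Hom V Z (Y l)" for l m
    by (rule is_coproduct_chosen[OF ex_coproduct_type])
       (use single_Hom that in \<open>auto simp: Hom_iff\<close>)
  have proj: "\<exists>p. p \<in> Hom V (coproduct V I (?P l m)) Z \<and> p \<cdot> incl V I (?P l m) l = Ident V Z
      \<and> incl V I (?P l m) l \<cdot> p = Ident V (coproduct V I (?P l m))"
    if "l \<in> I" "m \<in> Hom V Z (Y l)" for l m
    using concentrated_coproduct[OF cop[OF that] that(1) P_initial] P_same[OF that] by metis
  obtain p where p: "p \<in> Hom V (coproduct V I (?P i u)) Z" "p \<cdot> incl V I (?P i u) i = Ident V Z"
      "incl V I (?P i u) i \<cdot> p = Ident V (coproduct V I (?P i u))"
    using proj[OF i u] by blast
  obtain q where q: "q \<in> Hom V (coproduct V I (?P j v)) Z" "q \<cdot> incl V I (?P j v) j = Ident V Z"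
      "incl V I (?P j v) j \<cdot> q = Ident V (coproduct V I (?P j v))"
    using proj[OF j v] by blast
  have iu: "incl V I (?P i u) i \<in> Hom V Z (coproduct V I (?P i u))"
    using is_coproduct_incl(2)[OF cop[OF i u] i] P_same[OF i u] by simp
  have jv: "incl V I (?P j v) j \<in> Hom V Z (coproduct V I (?P j v))"
    using is_coproduct_incl(2)[OF cop[OF j v] j] P_same[OF j v] by simp
  note Fu = FObj_coprod_slice[OF Y single_Hom[OF i u]]
  note Fv = FObj_coprod_slice[OF Y single_Hom[OF j v]]
  have u_i: "single i u i = u" and v_j: "single j v j = v" using i j by (simp_all add: single_def)
  have Fui: "FObj ?F (single i u) \<cdot> incl V I (?P i u) i = incl V I Y i \<cdot> u"
    using Fu(2)[OF i] i by (simp add: u_i)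
  have Fvj: "FObj ?F (single j v) \<cdot> incl V I (?P j v) j = incl V I Y j \<cdot> v"
    using Fv(2)[OF j] j by (simp add: v_j)
  \<comment> \<open>the identity of \<open>Z\<close>, transported to the two coproducts\<close>
  define r where "r = incl V I (?P j v) j \<cdot> p"
  have r: "r \<in> Hom V (coproduct V I (?P i u)) (coproduct V I (?P j v))"
    unfolding r_def using p(1) jv by (rule comp_in_Hom)
  have "FObj ?F (single j v) \<cdot> r = (FObj ?F (single j v) \<cdot> incl V I (?P j v) j) \<cdot> p"
    unfolding r_def using p(1) jv Fv(1) by (auto simp: Hom_iff)
  also have "\<dots> = (FObj ?F (single i u) \<cdot> incl V I (?P i u) i) \<cdot> p"
    using Fui Fvj uv by simp
  also have "\<dots> = FObj ?F (single i u)"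
    using p iu Fu(1) by (auto simp: Hom_iff)
  finally have "(FObj ?F (single i u), r, FObj ?F (single j v))
      \<in> Hom (slice V ?S) (FObj ?F (single i u)) (FObj ?F (single j v))"
    using r Fu(1) Fv(1) by (auto simp: Hom_slice Hom_iff)
  moreover have "single i u \<in> Obj (product_cat I (\<lambda>k. slice V (Y k)))"
      "single j v \<in> Obj (product_cat I (\<lambda>k. slice V (Y k)))"
    using single_Hom[OF i u] single_Hom[OF j v]
    by (auto simp: product_cat_def Hom_iff) (auto simp: single_def)
  ultimately obtain a where a: "a \<in> Hom (product_cat I (\<lambda>k. slice V (Y k))) (single i u) (single j v)"
      "FArr ?F a = (FObj ?F (single i u), r, FObj ?F (single j v))"
    using equivalence_full[OF category_product_cat[OF category_slice] category_slice
        slice_equivalence[OF Y]] category_axioms by blast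
  define b where "b k = fst (snd (a k))" for k
  have ak: "a k = (single i u k, b k, single j v k)" "b k \<in> Hom V (?P i u k) (?P j v k)"
      "single j v k \<cdot> b k = single i u k" if "k \<in> I" for k
    using a(1) that unfolding Hom_product_cat b_def Hom_slice by fastforce+
  show ?thesis
  proof (cases "i = j")
    case False
    have "is_initial V (?P i u i)"
      using strict_initial[OF P_initial ak(2)] i False by blast
    then show ?thesis using P_same[OF i u] False by simp
  next
    case True
    have bi: "b i \<in> Hom V Z Z" using ak(2)[OF i] P_same i j u v True by metis
    have vb: "v \<cdot> b i = u" using ak(3)[OF i] i True by (simp add: single_def)
    \<comment> \<open>The chosen coproduct depends only on the family restricted to \<open>I\<close>; outside of \<open>I\<close> the
      components of \<open>a\<close> are undefined and disagree with the given families.\<close>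
    have copair_cong: "copair V I X T f = copair V I X' T f'"
      if "coproduct V I X = coproduct V I X'" "incl V I X = incl V I X'" "\<And>k. k \<in> I \<Longrightarrow> f k = f' k"
      for X X' T f f' using that unfolding copair_def by simp
    have is_cop_cong: "is_coproduct V I X = is_coproduct V I X'"
      if "\<And>k. k \<in> I \<Longrightarrow> X k = X' k" for X X'
      using that unfolding is_coproduct_def by (auto simp: fun_eq_iff)
    have cop_cong: "coproduct V I X = coproduct V I X'" "incl V I X = incl V I X'"
      if "\<And>k. k \<in> I \<Longrightarrow> X k = X' k" for X X'
      using is_cop_cong[OF that] unfolding coproduct_def incl_def coproduct_cocone_def by simp_all
    have D1: "coproduct V I (\<lambda>k. Dom V (fst (a k))) = coproduct V I (?P i u)"
        "incl V I (\<lambda>k. Dom V (fst (a k))) = incl V I (?P i u)"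
      by (rule cop_cong, simp add: ak(1))+
    have D2: "coproduct V I (\<lambda>k. Dom V (snd (snd (a k)))) = coproduct V I (?P j v)"
        "incl V I (\<lambda>k. Dom V (snd (snd (a k)))) = incl V I (?P j v)"
      by (rule cop_cong, simp add: ak(1))+
    have "r = copair V I (\<lambda>k. Dom V (fst (a k))) (coproduct V I (\<lambda>k. Dom V (snd (snd (a k)))))
          (\<lambda>k. incl V I (\<lambda>k. Dom V (snd (snd (a k)))) k \<cdot> b k)"
      using a(2) by (simp add: coprod_slice_ftor_def coprod_map_def Let_def b_def)
    also have "\<dots> = copair V I (?P i u) (coproduct V I (?P j v)) (\<lambda>k. incl V I (?P j v) k \<cdot> b k)"
      unfolding D2 by (rule copair_cong) (simp_all add: D1)
    finally have rc: "r = copair V I (?P i u) (coproduct V I (?P j v))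
        (\<lambda>k. incl V I (?P j v) k \<cdot> b k)" .
    have "r \<cdot> incl V I (?P i u) i = incl V I (?P j v) i \<cdot> b i"
      unfolding rc
    proof (rule copair(2)[OF _ _ _ i])
      show "\<exists>c. is_coproduct V I (?P i u) c" using cop[OF i u] by blast
      show "coproduct V I (?P j v) \<in> Obj V" using is_coproduct_incl(1)[OF cop[OF j v]] .
    qed (use ak(2) is_coproduct_incl(2)[OF cop[OF j v]] in \<open>auto intro: comp_in_Hom\<close>)
    moreover have "r \<cdot> incl V I (?P i u) i = incl V I (?P j v) j"
      unfolding r_def using p jv iu by (auto simp: Hom_iff)
    ultimately have "q \<cdot> incl V I (?P j v) j = q \<cdot> (incl V I (?P j v) j \<cdot> b i)"
      using True by simp
    then have "Ident V Z = (q \<cdot> incl V I (?P j v) j) \<cdot> b i"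
      using q(2) comp_assoc[OF bi jv q(1)] by simp
    then have "b i = Ident V Z"
      using q(2) comp_ident_left[OF bi] by simp
    then show ?thesis using vb v True by (auto simp: Hom_iff)
  qed
qed

lemma ex_coproduct:
  assumes "small TYPE('i) K" "\<And>k. k \<in> K \<Longrightarrow> W k \<in> Obj V"
  shows "\<exists>c. is_coproduct V K W c"
proof -
  obtain e :: "_ \<Rightarrow> 'i" where e: "inj_on e K" using assms(1) unfolding small_def by blast
  have "\<exists>c. is_coproduct V (e ` K) (\<lambda>j. W (inv_into K e j)) c"
    by (rule ex_coproduct_type) (use assms(2) e in \<open>auto simp: inv_into_f_f\<close>)
  then obtain S \<iota> where "is_coproduct V (e ` K) (\<lambda>j. W (inv_into K e j)) (S, \<iota>)" by auto
  from is_coproduct_reindex[OF this e] have "is_coproduct V K W (S, \<lambda>k. \<iota> (e k))"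
    by (rule is_coproduct_cong) (use e in auto)
  then show ?thesis by blast
qed

text \<open>Any coproduct is compared with the chosen one over a subset of the index type, so both
  consequences of extensivity hold for every small coproduct cocone.\<close>

lemma compare_with_chosen:
  assumes "small TYPE('i) K" "is_coproduct V K W (S, \<iota>)"
  obtains e :: "'k \<Rightarrow> 'i" and Y h where "inj_on e K" "\<And>k. k \<in> K \<Longrightarrow> Y (e k) = W k"
    "\<forall>i\<in>e ` K. Y i \<in> Obj V"
    "h \<in> Hom V S (coproduct V (e ` K) Y)" "is_iso V h"
    "\<And>k. k \<in> K \<Longrightarrow> h \<cdot> \<iota> k = incl V (e ` K) Y (e k)"
proof -
  obtain e :: "_ \<Rightarrow> 'i" where e: "inj_on e K" using assms(1) unfolding small_def by blast
  let ?Y = "\<lambda>j. W (inv_into K e j)"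
  have Y: "\<forall>i\<in>e ` K. ?Y i \<in> Obj V"
    using is_coproduct_incl(2)[OF assms(2)] e by (auto simp: Hom_iff)
  note c = is_coproduct_chosen[OF ex_coproduct_type[OF Y]]
  obtain h where "h \<in> Hom V S (coproduct V (e ` K) ?Y)" "is_iso V h"
      "\<And>i. i \<in> e ` K \<Longrightarrow> h \<cdot> \<iota> (inv_into K e i) = incl V (e ` K) ?Y i"
    using is_coproduct_unique[OF is_coproduct_reindex_inv[OF assms(2) e] c] by metis
  then show ?thesis using that[of e ?Y h] e Y by force
qed

lemma decompose:
  assumes "small TYPE('i) K" "is_coproduct V K W (S, \<iota>)" "f \<in> Hom V Z S"
  obtains Z' \<kappa> g where "is_coproduct V K Z' (Z, \<kappa>)" "\<And>k. k \<in> K \<Longrightarrow> \<kappa> k \<in> Hom V (Z' k) Z"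
    "\<And>k. k \<in> K \<Longrightarrow> g k \<in> Hom V (Z' k) (W k)" "\<And>k. k \<in> K \<Longrightarrow> f \<cdot> \<kappa> k = \<iota> k \<cdot> g k"
proof -
  obtain e :: "_ \<Rightarrow> 'i" and Y h where e: "inj_on e K" "\<And>k. k \<in> K \<Longrightarrow> Y (e k) = W k"
    "\<forall>i\<in>e ` K. Y i \<in> Obj V"
    "h \<in> Hom V S (coproduct V (e ` K) Y)" "is_iso V h"
    "\<And>k. k \<in> K \<Longrightarrow> h \<cdot> \<iota> k = incl V (e ` K) Y (e k)"
    using compare_with_chosen[OF assms(1,2)] by metis
  have hf: "h \<cdot> f \<in> Hom V Z (coproduct V (e ` K) Y)" using assms(3) e(4) by (rule comp_in_Hom)
  obtain Z' \<kappa> g where z: "is_coproduct V (e ` K) Z' (Z, \<kappa>)"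
    and g: "\<And>i. i \<in> e ` K \<Longrightarrow> g i \<in> Hom V (Z' i) (Y i) \<and> (h \<cdot> f) \<cdot> \<kappa> i = incl V (e ` K) Y i \<cdot> g i"
    using decompose_chosen[OF e(3) hf] by blast
  note z' = is_coproduct_reindex[OF z e(1)]
  note inc = is_coproduct_incl[OF z']
  have gk: "g (e k) \<in> Hom V (Z' (e k)) (W k)" if "k \<in> K" for k using g[of "e k"] e(2) that by auto
  have "f \<cdot> \<kappa> (e k) = \<iota> k \<cdot> g (e k)" if k: "k \<in> K" for k
  proof (rule iso_cancel_left[OF e(5,4)])
    note ik = is_coproduct_incl(2)[OF assms(2) k]
    show "f \<cdot> \<kappa> (e k) \<in> Hom V (Z' (e k)) S" using inc(2)[OF k] assms(3) by (rule comp_in_Hom)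
    show "\<iota> k \<cdot> g (e k) \<in> Hom V (Z' (e k)) S" using gk[OF k] ik by (rule comp_in_Hom)
    have "h \<cdot> (f \<cdot> \<kappa> (e k)) = (h \<cdot> f) \<cdot> \<kappa> (e k)"
      using inc(2)[OF k] assms(3) e(4) by (auto simp: Hom_iff)
    also have "\<dots> = (h \<cdot> \<iota> k) \<cdot> g (e k)" using g[of "e k"] e(6) k by simp
    also have "\<dots> = h \<cdot> (\<iota> k \<cdot> g (e k))" using gk[OF k] ik e(4) by (auto simp: Hom_iff)
    finally show "h \<cdot> (f \<cdot> \<kappa> (e k)) = h \<cdot> (\<iota> k \<cdot> g (e k))" .
  qed
  then show ?thesis using that[OF z' inc(2), of "\<lambda>k. g (e k)"] gk by blast
qed

lemma disjoint:
  assumes "small TYPE('i) K" "is_coproduct V K W (S, \<iota>)" "i \<in> K" "j \<in> K"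
    "u \<in> Hom V Z (W i)" "v \<in> Hom V Z (W j)" "\<iota> i \<cdot> u = \<iota> j \<cdot> v"
  shows "(i = j \<and> u = v) \<or> (i \<noteq> j \<and> is_initial V Z)"
proof -
  obtain e :: "_ \<Rightarrow> 'i" and Y h where e: "inj_on e K" "\<And>k. k \<in> K \<Longrightarrow> Y (e k) = W k"
    "\<forall>i\<in>e ` K. Y i \<in> Obj V"
    "h \<in> Hom V S (coproduct V (e ` K) Y)"
    "\<And>k. k \<in> K \<Longrightarrow> h \<cdot> \<iota> k = incl V (e ` K) Y (e k)"
    using compare_with_chosen[OF assms(1,2)] by metis
  have "h \<cdot> (\<iota> i \<cdot> u) = h \<cdot> (\<iota> j \<cdot> v)" using assms(7) by simp
  then have "incl V (e ` K) Y (e i) \<cdot> u = incl V (e ` K) Y (e j) \<cdot> v"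
    using e(5)[symmetric] e(4) assms(3-6) is_coproduct_incl(2)[OF assms(2,3)]
      is_coproduct_incl(2)[OF assms(2,4)] by (auto simp: Hom_iff)
  from incl_chosen_disjoint[OF e(3) _ _ _ _ this, of Z] show ?thesis
    using assms(3-6) e(1,2) by (auto simp: inj_on_eq_iff)
qed

lemma incl_mono:
  assumes "small TYPE('i) K" "is_coproduct V K W (S, \<iota>)" "i \<in> K"
    "u \<in> Hom V Z (W i)" "v \<in> Hom V Z (W i)" "\<iota> i \<cdot> u = \<iota> i \<cdot> v"
  shows "u = v"
  using disjoint[OF assms(1,2,3,3-)] by blast

text \<open>The pieces of \<open>Z\<close> in the decomposition along \<open>f\<close> are jointly epic and are among the generalized elements
quantified over. So equations between arrows out of \<open>Z\<close> may be checked locally, where \<open>f\<close> lies in a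
single summand.\<close>

lemma local_eq:
  assumes "small TYPE('i) K" "is_coproduct V K W (S, \<iota>)" "f \<in> Hom V Z S"
    "u \<in> Hom V Z T" "v \<in> Hom V Z T"
    "\<And>k Z' z g. k \<in> K \<Longrightarrow> z \<in> Hom V Z' Z \<Longrightarrow> g \<in> Hom V Z' (W k) \<Longrightarrow> f \<cdot> z = \<iota> k \<cdot> g \<Longrightarrow> u \<cdot> z = v \<cdot> z"
  shows "u = v"
proof -
  obtain Z' \<kappa> g where "is_coproduct V K Z' (Z, \<kappa>)" "\<And>k. k \<in> K \<Longrightarrow> \<kappa> k \<in> Hom V (Z' k) Z"
    "\<And>k. k \<in> K \<Longrightarrow> g k \<in> Hom V (Z' k) (W k)" "\<And>k. k \<in> K \<Longrightarrow> f \<cdot> \<kappa> k = \<iota> k \<cdot> g k"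
    using decompose[OF assms(1-3)] by blast
  then show ?thesis using assms by (blast intro: is_coproduct_ext)
qed

end

section \<open>Internal categories by generalized elements\<close>

text \<open>The composite of two generalized arrows at the same stage, the first one applied first.\<close>

definition icomp :: "('o, 'a) cat \<Rightarrow> ('o, 'a) icat \<Rightarrow> 'a \<Rightarrow> 'a \<Rightarrow> 'a" where
  "icomp V \<A> p q = Cmp \<A> \<cdot>\<^bsub>V\<^esub> pb_lift V (Tgt \<A>) (Src \<A>) p q"

locale elementwise_internal_category =
  ccc_with_pullbacks V + internal_category V \<A>
  for V :: "('o, 'a) cat" (structure) and \<A> :: "('o, 'a) icat"
begin

lemma icat_simps [simp]:
  "Ob \<A> \<in> Obj V" "Ar \<A> \<in> Obj V"
  "Src \<A> \<in> Arr V" "Dom V (Src \<A>) = Ar \<A>" "Cod V (Src \<A>) = Ob \<A>"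
  "Tgt \<A> \<in> Arr V" "Dom V (Tgt \<A>) = Ar \<A>" "Cod V (Tgt \<A>) = Ob \<A>"
  "Idn \<A> \<in> Arr V" "Dom V (Idn \<A>) = Ob \<A>" "Cod V (Idn \<A>) = Ar \<A>"
  "Cmp \<A> \<in> Arr V" "Dom V (Cmp \<A>) = pullback V (Tgt \<A>) (Src \<A>)" "Cod V (Cmp \<A>) = Ar \<A>"
  using ob_in_Obj ar_in_Obj src_in_Hom tgt_in_Hom idn_in_Hom cmp_in_Hom by (auto simp: Hom_iff)

lemma src_idn_comp [simp]: "z \<in> Arr V \<Longrightarrow> Cod V z = Ob \<A> \<Longrightarrow> Src \<A> \<cdot> (Idn \<A> \<cdot> z) = z"
  and tgt_idn_comp [simp]: "z \<in> Arr V \<Longrightarrow> Cod V z = Ob \<A> \<Longrightarrow> Tgt \<A> \<cdot> (Idn \<A> \<cdot> z) = z"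
  using comp_cong_right[OF src_idn] comp_cong_right[OF tgt_idn] by simp_all

lemma icomp_simps [simp]:
  assumes "p \<in> Arr V" "q \<in> Arr V" "Dom V p = Dom V q" "Cod V p = Ar \<A>" "Cod V q = Ar \<A>"
    "Tgt \<A> \<cdot> p = Src \<A> \<cdot> q"
  shows "icomp V \<A> p q \<in> Arr V" "Dom V (icomp V \<A> p q) = Dom V q"
    "Cod V (icomp V \<A> p q) = Ar \<A>"
    "Src \<A> \<cdot> icomp V \<A> p q = Src \<A> \<cdot> p" "Tgt \<A> \<cdot> icomp V \<A> p q = Tgt \<A> \<cdot> q"
proof -
  let ?l = "pb_lift V (Tgt \<A>) (Src \<A>) p q"
  have l: "?l \<in> Arr V" "Dom V ?l = Dom V q" "Cod V ?l = pullback V (Tgt \<A>) (Src \<A>)"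
    "pb1 V (Tgt \<A>) (Src \<A>) \<cdot> ?l = p" "pb2 V (Tgt \<A>) (Src \<A>) \<cdot> ?l = q"
    using assms by simp_all
  then show "icomp V \<A> p q \<in> Arr V" "Dom V (icomp V \<A> p q) = Dom V q"
    "Cod V (icomp V \<A> p q) = Ar \<A>" by (simp_all add: icomp_def)
  show "Src \<A> \<cdot> icomp V \<A> p q = Src \<A> \<cdot> p"
    using comp_cong_right[OF src_cmp, of ?l] l by (simp add: icomp_def)
  show "Tgt \<A> \<cdot> icomp V \<A> p q = Tgt \<A> \<cdot> q"
    using comp_cong_right[OF tgt_cmp, of ?l] l by (simp add: icomp_def)
qed

lemma icomp_comp:
  assumes "p \<in> Arr V" "q \<in> Arr V" "Dom V p = Dom V q" "Cod V p = Ar \<A>" "Cod V q = Ar \<A>"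
    "Tgt \<A> \<cdot> p = Src \<A> \<cdot> q" "z \<in> Arr V" "Cod V z = Dom V q"
  shows "icomp V \<A> p q \<cdot> z = icomp V \<A> (p \<cdot> z) (q \<cdot> z)"
  using assms by (simp add: icomp_def pb_lift_comp)

lemma Tgt_Src_comp:
  assumes "Tgt \<A> \<cdot> p = Src \<A> \<cdot> q" "p \<in> Arr V" "q \<in> Arr V" "Dom V p = Dom V q"
    "Cod V p = Ar \<A>" "Cod V q = Ar \<A>" "z \<in> Arr V" "Cod V z = Dom V q"
  shows "Tgt \<A> \<cdot> (p \<cdot> z) = Src \<A> \<cdot> (q \<cdot> z)"
  using assms comp_cong_right[OF assms(1), of z] by simp

lemma icomp_idn:
  assumes "p \<in> Arr V" "Cod V p = Ar \<A>"
  shows "icomp V \<A> (Idn \<A> \<cdot> (Src \<A> \<cdot> p)) p = p" "icomp V \<A> p (Idn \<A> \<cdot> (Tgt \<A> \<cdot> p)) = p"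
proof -
  have "icomp V \<A> (Idn \<A> \<cdot> Src \<A>) (Ident V (Ar \<A>)) \<cdot> p = p"
    using cmp_idn_left assms by (simp add: icomp_def)
  then show "icomp V \<A> (Idn \<A> \<cdot> (Src \<A> \<cdot> p)) p = p"
    using assms by (simp add: icomp_comp)
  have "icomp V \<A> (Ident V (Ar \<A>)) (Idn \<A> \<cdot> Tgt \<A>) \<cdot> p = p"
    using cmp_idn_right assms by (simp add: icomp_def)
  then show "icomp V \<A> p (Idn \<A> \<cdot> (Tgt \<A> \<cdot> p)) = p"
    using assms by (simp add: icomp_comp)
qed

lemma icomp_assoc:
  assumes "p \<in> Hom V Z (Ar \<A>)" "q \<in> Hom V Z (Ar \<A>)" "r \<in> Hom V Z (Ar \<A>)"
    "Tgt \<A> \<cdot> p = Src \<A> \<cdot> q" "Tgt \<A> \<cdot> q = Src \<A> \<cdot> r"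
  shows "icomp V \<A> (icomp V \<A> p q) r = icomp V \<A> p (icomp V \<A> q r)"
proof -
  let ?t = "Tgt \<A>" and ?s = "Src \<A>"
  let ?p1 = "pb1 V ?t ?s" and ?p2 = "pb2 V ?t ?s"
  let ?q1 = "pb1 V (?t \<cdot> ?p2) ?s" and ?q2 = "pb2 V (?t \<cdot> ?p2) ?s"
  have pqr: "p \<in> Arr V" "q \<in> Arr V" "r \<in> Arr V" "Dom V p = Z" "Dom V q = Z" "Dom V r = Z"
    "Cod V p = Ar \<A>" "Cod V q = Ar \<A>" "Cod V r = Ar \<A>"
    using assms(1-3) by (simp_all add: Hom_iff)
  let ?l = "pb_lift V ?t ?s p q"
  let ?m = "pb_lift V (?t \<cdot> ?p2) ?s ?l r"
  have l: "?l \<in> Arr V" "Dom V ?l = Z" "Cod V ?l = pullback V ?t ?s" "?p1 \<cdot> ?l = p" "?p2 \<cdot> ?l = q"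
    using pqr assms(4) by simp_all
  have m: "?m \<in> Arr V" "Dom V ?m = Z" "Cod V ?m = pullback V (?t \<cdot> ?p2) ?s" "?q1 \<cdot> ?m = ?l" "?q2 \<cdot> ?m = r"
    using pqr l assms(5) by simp_all
  have e1: "?t \<cdot> (?p1 \<cdot> ?q1) = ?s \<cdot> (?p2 \<cdot> ?q1)"
    using comp_cong_right[OF pb_commutes[of ?t ?s], of ?q1] by simp
  have e2: "?t \<cdot> (?p2 \<cdot> ?q1) = ?s \<cdot> ?q2"
    using pb_commutes[of "?t \<cdot> ?p2" ?s] by simp
  have q1: "pb_lift V ?t ?s (?p1 \<cdot> ?q1) (?p2 \<cdot> ?q1) = ?q1"
    using pb_lift_comp[of ?t ?s ?p1 ?p2 ?q1] pb_commutes[of ?t ?s] by simp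
  have A: "icomp V \<A> (icomp V \<A> (?p1 \<cdot> ?q1) (?p2 \<cdot> ?q1)) ?q2
      = icomp V \<A> (?p1 \<cdot> ?q1) (icomp V \<A> (?p2 \<cdot> ?q1) ?q2)"
    using cmp_assoc unfolding Let_def icomp_def q1 .
  have t1: "Tgt \<A> \<cdot> icomp V \<A> (?p1 \<cdot> ?q1) (?p2 \<cdot> ?q1) = Src \<A> \<cdot> ?q2"
    using e1 e2 by simp
  have t2: "Tgt \<A> \<cdot> (?p1 \<cdot> ?q1) = Src \<A> \<cdot> icomp V \<A> (?p2 \<cdot> ?q1) ?q2"
    using e1 e2 by simp
  have "icomp V \<A> (icomp V \<A> p q) r
      = icomp V \<A> (icomp V \<A> (?p1 \<cdot> ?q1) (?p2 \<cdot> ?q1)) ?q2 \<cdot> ?m"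
    using e1 e2 m l t1 by (simp add: icomp_comp)
  also have "\<dots> = icomp V \<A> p (icomp V \<A> q r)"
    unfolding A using e1 e2 m l t2 by (simp add: icomp_comp)
  finally show ?thesis .
qed

end

context ccc_with_pullbacks
begin

text \<open>By the Yoneda lemma the axioms of an internal category, which equate composites of structure maps on
iterated pullbacks, amount to the axioms of an ordinary category at every stage. The converse
direction instantiates the stagewise axioms at the generic composable pairs and triples.\<close>

lemma internal_category_elementwiseI:
  assumes obj: "Ob \<A> \<in> Obj V" "Ar \<A> \<in> Obj V"
    and hom: "Src \<A> \<in> Hom V (Ar \<A>) (Ob \<A>)" "Tgt \<A> \<in> Hom V (Ar \<A>) (Ob \<A>)"
      "Idn \<A> \<in> Hom V (Ob \<A>) (Ar \<A>)" "Cmp \<A> \<in> Hom V (pullback V (Tgt \<A>) (Src \<A>)) (Ar \<A>)"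
    and idn: "Src \<A> \<cdot> Idn \<A> = Ident V (Ob \<A>)" "Tgt \<A> \<cdot> Idn \<A> = Ident V (Ob \<A>)"
    and st: "\<And>Z p q. p \<in> Hom V Z (Ar \<A>) \<Longrightarrow> q \<in> Hom V Z (Ar \<A>) \<Longrightarrow> Tgt \<A> \<cdot> p = Src \<A> \<cdot> q \<Longrightarrow>
        Src \<A> \<cdot> icomp V \<A> p q = Src \<A> \<cdot> p \<and> Tgt \<A> \<cdot> icomp V \<A> p q = Tgt \<A> \<cdot> q"
    and unit: "\<And>Z p. p \<in> Hom V Z (Ar \<A>) \<Longrightarrow>
        icomp V \<A> (Idn \<A> \<cdot> (Src \<A> \<cdot> p)) p = p \<and> icomp V \<A> p (Idn \<A> \<cdot> (Tgt \<A> \<cdot> p)) = p"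
    and ass: "\<And>Z p q r. p \<in> Hom V Z (Ar \<A>) \<Longrightarrow> q \<in> Hom V Z (Ar \<A>) \<Longrightarrow> r \<in> Hom V Z (Ar \<A>) \<Longrightarrow>
        Tgt \<A> \<cdot> p = Src \<A> \<cdot> q \<Longrightarrow> Tgt \<A> \<cdot> q = Src \<A> \<cdot> r \<Longrightarrow>
        icomp V \<A> (icomp V \<A> p q) r = icomp V \<A> p (icomp V \<A> q r)"
  shows "internal_category V \<A>"
proof
  let ?t = "Tgt \<A>" and ?s = "Src \<A>"
  let ?p1 = "pb1 V ?t ?s" and ?p2 = "pb2 V ?t ?s"
  let ?q1 = "pb1 V (?t \<cdot> ?p2) ?s" and ?q2 = "pb2 V (?t \<cdot> ?p2) ?s"
  have ts [simp]: "?t \<in> Arr V" "?s \<in> Arr V" "Dom V ?t = Ar \<A>" "Dom V ?s = Ar \<A>"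
    "Cod V ?t = Ob \<A>" "Cod V ?s = Ob \<A>" using hom by (simp_all add: Hom_iff)
  have comm: "?t \<cdot> ?p1 = ?s \<cdot> ?p2" by (rule pb_commutes) simp_all
  have c: "icomp V \<A> ?p1 ?p2 = Cmp \<A>"
    using hom(4) by (simp add: icomp_def Hom_iff)
  have p: "?p1 \<in> Hom V (pullback V ?t ?s) (Ar \<A>)" "?p2 \<in> Hom V (pullback V ?t ?s) (Ar \<A>)"
    using obj by (simp_all add: Hom_iff)
  show "Src \<A> \<cdot> Cmp \<A> = Src \<A> \<cdot> ?p1" "Tgt \<A> \<cdot> Cmp \<A> = Tgt \<A> \<cdot> ?p2"
    using st[OF p comm] c by simp_all
  have I: "Ident V (Ar \<A>) \<in> Hom V (Ar \<A>) (Ar \<A>)" using obj by (rule_tac ident_in_Hom)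
  show "Cmp \<A> \<cdot> pb_lift V ?t ?s (Idn \<A> \<cdot> ?s) (Ident V (Ar \<A>)) = Ident V (Ar \<A>)"
    "Cmp \<A> \<cdot> pb_lift V ?t ?s (Ident V (Ar \<A>)) (Idn \<A> \<cdot> ?t) = Ident V (Ar \<A>)"
    using unit[OF I] by (simp_all add: icomp_def)
  have e1: "?t \<cdot> (?p1 \<cdot> ?q1) = ?s \<cdot> (?p2 \<cdot> ?q1)"
    using comp_cong_right[OF comm, of ?q1] by simp
  have e2: "?t \<cdot> (?p2 \<cdot> ?q1) = ?s \<cdot> ?q2"
    using pb_commutes[of "?t \<cdot> ?p2" ?s] by simp
  have q1: "pb_lift V ?t ?s (?p1 \<cdot> ?q1) (?p2 \<cdot> ?q1) = ?q1"
    using pb_lift_comp[of ?t ?s ?p1 ?p2 ?q1] comm by simp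
  have q: "?p1 \<cdot> ?q1 \<in> Hom V (pullback V (?t \<cdot> ?p2) ?s) (Ar \<A>)"
    "?p2 \<cdot> ?q1 \<in> Hom V (pullback V (?t \<cdot> ?p2) ?s) (Ar \<A>)"
    "?q2 \<in> Hom V (pullback V (?t \<cdot> ?p2) ?s) (Ar \<A>)"
    using obj by (simp_all add: Hom_iff)
  show "let p1 = ?p1; p2 = ?p2; q1 = pb1 V (?t \<cdot> p2) ?s; q2 = pb2 V (?t \<cdot> p2) ?s;
      lift = pb_lift V ?t ?s in
      Cmp \<A> \<cdot> lift (Cmp \<A> \<cdot> q1) q2 = Cmp \<A> \<cdot> lift (p1 \<cdot> q1) (Cmp \<A> \<cdot> lift (p2 \<cdot> q1) q2)"
    using ass[OF q e1 e2] unfolding Let_def icomp_def q1 .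
qed (use assms in auto)

lemma internal_functor_elementwiseI:
  assumes "internal_category V \<A>" "internal_category V \<B>"
    and hom: "f \<in> Hom V (Ob \<A>) (Ob \<B>)" "g \<in> Hom V (Ar \<A>) (Ar \<B>)"
    and st: "Src \<B> \<cdot> g = f \<cdot> Src \<A>" "Tgt \<B> \<cdot> g = f \<cdot> Tgt \<A>"
    and idn: "g \<cdot> Idn \<A> = Idn \<B> \<cdot> f"
    and cmp: "\<And>Z p q. p \<in> Hom V Z (Ar \<A>) \<Longrightarrow> q \<in> Hom V Z (Ar \<A>) \<Longrightarrow> Tgt \<A> \<cdot> p = Src \<A> \<cdot> q \<Longrightarrow>
      g \<cdot> icomp V \<A> p q = icomp V \<B> (g \<cdot> p) (g \<cdot> q)"
  shows "internal_functor V \<A> \<B> f g"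
proof
  interpret A: elementwise_internal_category V \<A>
    using assms(1) ccc_with_pullbacks_axioms elementwise_internal_category_def by blast
  let ?p1 = "pb1 V (Tgt \<A>) (Src \<A>)" and ?p2 = "pb2 V (Tgt \<A>) (Src \<A>)"
  have "g \<cdot> icomp V \<A> ?p1 ?p2 = icomp V \<B> (g \<cdot> ?p1) (g \<cdot> ?p2)"
    by (rule cmp[of _ "pullback V (Tgt \<A>) (Src \<A>)"]) (simp_all add: Hom_iff pb_commutes)
  then show "g \<cdot> Cmp \<A> = Cmp \<B> \<cdot> pb_lift V (Tgt \<B>) (Src \<B>) (g \<cdot> ?p1) (g \<cdot> ?p2)"
    by (simp add: icomp_def)
qed (use assms in auto)

lemma internal_functor_icomp:
  assumes "internal_category V \<A>" "internal_category V \<B>" "internal_functor V \<A> \<B> f g"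
    "p \<in> Hom V Z (Ar \<A>)" "q \<in> Hom V Z (Ar \<A>)" "Tgt \<A> \<cdot> p = Src \<A> \<cdot> q"
  shows "g \<cdot> icomp V \<A> p q = icomp V \<B> (g \<cdot> p) (g \<cdot> q)"
proof -
  interpret A: elementwise_internal_category V \<A>
    using assms(1) ccc_with_pullbacks_axioms elementwise_internal_category_def by blast
  interpret B: elementwise_internal_category V \<B>
    using assms(2) ccc_with_pullbacks_axioms elementwise_internal_category_def by blast
  interpret internal_functor V \<A> \<B> f g by fact
  have fg [simp]: "f \<in> Arr V" "Dom V f = Ob \<A>" "Cod V f = Ob \<B>"
    "g \<in> Arr V" "Dom V g = Ar \<A>" "Cod V g = Ar \<B>"
    using ob_map_in_Hom ar_map_in_Hom by (simp_all add: Hom_iff)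
  let ?p1 = "pb1 V (Tgt \<A>) (Src \<A>)" and ?p2 = "pb2 V (Tgt \<A>) (Src \<A>)"
  let ?l = "pb_lift V (Tgt \<A>) (Src \<A>) p q"
  have l: "?l \<in> Arr V" "Dom V ?l = Z" "Cod V ?l = pullback V (Tgt \<A>) (Src \<A>)"
    "?p1 \<cdot> ?l = p" "?p2 \<cdot> ?l = q"
    using assms(4-6) by (simp_all add: Hom_iff)
  have "Tgt \<B> \<cdot> (g \<cdot> ?p1) = f \<cdot> (Tgt \<A> \<cdot> ?p1)" using comp_cong_right[OF map_tgt, of ?p1] by simp
  also have "\<dots> = f \<cdot> (Src \<A> \<cdot> ?p2)" by (simp add: pb_commutes)
  also have "\<dots> = Src \<B> \<cdot> (g \<cdot> ?p2)" using comp_cong_right[OF map_src, of ?p2] by simp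
  finally have e: "Tgt \<B> \<cdot> (g \<cdot> ?p1) = Src \<B> \<cdot> (g \<cdot> ?p2)" .
  have "g \<cdot> Cmp \<A> = icomp V \<B> (g \<cdot> ?p1) (g \<cdot> ?p2)" using map_cmp by (simp add: icomp_def)
  then have "(g \<cdot> Cmp \<A>) \<cdot> ?l = icomp V \<B> (g \<cdot> ?p1) (g \<cdot> ?p2) \<cdot> ?l" by simp
  then show ?thesis using l e by (simp add: B.icomp_comp) (simp add: icomp_def)
qed

lemma elementwise [intro]: "internal_category V \<A> \<Longrightarrow> elementwise_internal_category V \<A>"
  using ccc_with_pullbacks_axioms elementwise_internal_category_def by blast

lemma Hom_Cat:
  "\<phi> \<in> Hom (Cat V) \<A> \<B> \<longleftrightarrow> IDom \<phi> = \<A> \<and> ICod \<phi> = \<B> \<and> internal_category V \<A> \<and>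
    internal_category V \<B> \<and> internal_functor V \<A> \<B> (IOb \<phi>) (IAr \<phi>)"
  by (auto simp: Hom_def Cat_def)

lemma Cat_sel [simp]:
  "Obj (Cat V) = {\<A>. internal_category V \<A>}" "Dom (Cat V) = IDom" "Cod (Cat V) = ICod"
  "IOb (\<psi> \<cdot>\<^bsub>Cat V\<^esub> \<phi>) = IOb \<psi> \<cdot> IOb \<phi>" "IAr (\<psi> \<cdot>\<^bsub>Cat V\<^esub> \<phi>) = IAr \<psi> \<cdot> IAr \<phi>"
  "IDom (\<psi> \<cdot>\<^bsub>Cat V\<^esub> \<phi>) = IDom \<phi>" "ICod (\<psi> \<cdot>\<^bsub>Cat V\<^esub> \<phi>) = ICod \<psi>"
  "IOb (Ident (Cat V) \<A>) = Ident V (Ob \<A>)" "IAr (Ident (Cat V) \<A>) = Ident V (Ar \<A>)"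
  "IDom (Ident (Cat V) \<A>) = \<A>" "ICod (Ident (Cat V) \<A>) = \<A>"
  by (simp_all add: Cat_def)

lemma ifun_eqI:
  "\<phi> \<in> Hom (Cat V) \<A> \<B> \<Longrightarrow> \<psi> \<in> Hom (Cat V) \<A> \<B> \<Longrightarrow> IOb \<phi> = IOb \<psi> \<Longrightarrow> IAr \<phi> = IAr \<psi> \<Longrightarrow> \<phi> = \<psi>"
  by (simp add: Hom_Cat)

lemma Hom_CatD:
  assumes "\<phi> \<in> Hom (Cat V) \<A> \<B>"
  shows "IOb \<phi> \<in> Arr V" "Dom V (IOb \<phi>) = Ob \<A>" "Cod V (IOb \<phi>) = Ob \<B>"
    "IAr \<phi> \<in> Arr V" "Dom V (IAr \<phi>) = Ar \<A>" "Cod V (IAr \<phi>) = Ar \<B>"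
    "Src \<B> \<cdot> IAr \<phi> = IOb \<phi> \<cdot> Src \<A>" "Tgt \<B> \<cdot> IAr \<phi> = IOb \<phi> \<cdot> Tgt \<A>"
    "IAr \<phi> \<cdot> Idn \<A> = Idn \<B> \<cdot> IOb \<phi>"
  using assms unfolding Hom_Cat internal_functor_def by (auto simp: Hom_iff)

lemma Hom_CatD_comp:
  assumes "\<phi> \<in> Hom (Cat V) \<A> \<B>" "z \<in> Arr V"
  shows "Cod V z = Ar \<A> \<Longrightarrow> Src \<B> \<cdot> (IAr \<phi> \<cdot> z) = IOb \<phi> \<cdot> (Src \<A> \<cdot> z)"
    "Cod V z = Ar \<A> \<Longrightarrow> Tgt \<B> \<cdot> (IAr \<phi> \<cdot> z) = IOb \<phi> \<cdot> (Tgt \<A> \<cdot> z)"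
    "Cod V z = Ob \<A> \<Longrightarrow> IAr \<phi> \<cdot> (Idn \<A> \<cdot> z) = Idn \<B> \<cdot> (IOb \<phi> \<cdot> z)"
proof -
  interpret A: elementwise_internal_category V \<A> using assms by (auto simp: Hom_Cat)
  interpret B: elementwise_internal_category V \<B> using assms by (auto simp: Hom_Cat)
  note [simp] = Hom_CatD(1-6)[OF assms(1)] and e = Hom_CatD(7-9)[OF assms(1)]
  show "Cod V z = Ar \<A> \<Longrightarrow> Src \<B> \<cdot> (IAr \<phi> \<cdot> z) = IOb \<phi> \<cdot> (Src \<A> \<cdot> z)"
    "Cod V z = Ar \<A> \<Longrightarrow> Tgt \<B> \<cdot> (IAr \<phi> \<cdot> z) = IOb \<phi> \<cdot> (Tgt \<A> \<cdot> z)"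
    "Cod V z = Ob \<A> \<Longrightarrow> IAr \<phi> \<cdot> (Idn \<A> \<cdot> z) = Idn \<B> \<cdot> (IOb \<phi> \<cdot> z)"
    using comp_cong_right[OF e(1), of z] comp_cong_right[OF e(2), of z]
      comp_cong_right[OF e(3), of z] assms(2) by simp_all
qed

lemma Hom_Cat_icomp:
  assumes "\<phi> \<in> Hom (Cat V) \<A> \<B>" "p \<in> Hom V Z (Ar \<A>)" "q \<in> Hom V Z (Ar \<A>)"
    "Tgt \<A> \<cdot> p = Src \<A> \<cdot> q"
  shows "IAr \<phi> \<cdot> icomp V \<A> p q = icomp V \<B> (IAr \<phi> \<cdot> p) (IAr \<phi> \<cdot> q)"
  using assms internal_functor_icomp unfolding Hom_Cat by blast

lemma Hom_CatI:
  assumes "internal_category V \<A>" "internal_category V \<B>"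
    and "f \<in> Hom V (Ob \<A>) (Ob \<B>)" "g \<in> Hom V (Ar \<A>) (Ar \<B>)"
    and "Src \<B> \<cdot> g = f \<cdot> Src \<A>" "Tgt \<B> \<cdot> g = f \<cdot> Tgt \<A>" "g \<cdot> Idn \<A> = Idn \<B> \<cdot> f"
    and "\<And>Z p q. p \<in> Hom V Z (Ar \<A>) \<Longrightarrow> q \<in> Hom V Z (Ar \<A>) \<Longrightarrow> Tgt \<A> \<cdot> p = Src \<A> \<cdot> q \<Longrightarrow>
      g \<cdot> icomp V \<A> p q = icomp V \<B> (g \<cdot> p) (g \<cdot> q)"
  shows "\<lparr>IDom = \<A>, ICod = \<B>, IOb = f, IAr = g\<rparr> \<in> Hom (Cat V) \<A> \<B>"
  unfolding Hom_Cat using internal_functor_elementwiseI[OF assms] assms(1,2) by simp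

lemma category_Cat: "category (Cat V)"
proof
  fix f g h :: "('o, 'a) ifun" and \<X> \<Y> \<Z> \<W> :: "('o, 'a) icat"
  show "f \<in> Arr (Cat V) \<Longrightarrow> Dom (Cat V) f \<in> Obj (Cat V)"
    and "f \<in> Arr (Cat V) \<Longrightarrow> Cod (Cat V) f \<in> Obj (Cat V)"
    by (auto simp: Cat_def)
  show idn: "Ident (Cat V) \<X> \<in> Hom (Cat V) \<X> \<X>" if "\<X> \<in> Obj (Cat V)"
  proof -
    interpret A: elementwise_internal_category V \<X> using that by auto
    have e: "Ident (Cat V) \<X>
        = \<lparr>IDom = \<X>, ICod = \<X>, IOb = Ident V (Ob \<X>), IAr = Ident V (Ar \<X>)\<rparr>"
      by (simp add: Cat_def)
    show ?thesis unfolding e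
      by (rule Hom_CatI) (use that in \<open>auto simp: Hom_iff\<close>)
  qed
  show "g \<cdot>\<^bsub>Cat V\<^esub> f \<in> Hom (Cat V) \<X> \<Z>" if f: "f \<in> Hom (Cat V) \<X> \<Y>" and g: "g \<in> Hom (Cat V) \<Y> \<Z>"
  proof -
    interpret A: elementwise_internal_category V \<X> using f by (auto simp: Hom_Cat)
    interpret B: elementwise_internal_category V \<Y> using f by (auto simp: Hom_Cat)
    interpret D: elementwise_internal_category V \<Z> using g by (auto simp: Hom_Cat)
    note [simp] = Hom_CatD(1-6)[OF f] Hom_CatD(1-6)[OF g] Hom_CatD(7-9)[OF f]
      Hom_CatD_comp[OF f] Hom_CatD_comp[OF g]
    have e: "g \<cdot>\<^bsub>Cat V\<^esub> f
        = \<lparr>IDom = \<X>, ICod = \<Z>, IOb = IOb g \<cdot> IOb f, IAr = IAr g \<cdot> IAr f\<rparr>"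
      using f g by (simp add: Cat_def Hom_def)
    show ?thesis unfolding e
    proof (rule Hom_CatI)
      fix Z p q assume pq: "p \<in> Hom V Z (Ar \<X>)" "q \<in> Hom V Z (Ar \<X>)" "Tgt \<X> \<cdot> p = Src \<X> \<cdot> q"
      have "IAr g \<cdot> (IAr f \<cdot> icomp V \<X> p q) = icomp V \<Z> (IAr g \<cdot> (IAr f \<cdot> p)) (IAr g \<cdot> (IAr f \<cdot> q))"
        unfolding Hom_Cat_icomp[OF f pq]
        by (rule Hom_Cat_icomp[OF g, of _ Z]) (use pq in \<open>auto simp: Hom_iff\<close>)
      then show "(IAr g \<cdot> IAr f) \<cdot> icomp V \<X> p q
          = icomp V \<Z> ((IAr g \<cdot> IAr f) \<cdot> p) ((IAr g \<cdot> IAr f) \<cdot> q)"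
        using pq by (simp add: Hom_iff)
    qed (use f g in \<open>auto simp: Hom_Cat Hom_iff\<close>)
  qed
  show "Ident (Cat V) \<Y> \<cdot>\<^bsub>Cat V\<^esub> f = f" if f: "f \<in> Hom (Cat V) \<X> \<Y>"
    using f by (simp add: Cat_def Hom_def Hom_CatD[OF f])
  show "f \<cdot>\<^bsub>Cat V\<^esub> Ident (Cat V) \<X> = f" if f: "f \<in> Hom (Cat V) \<X> \<Y>"
    using f by (simp add: Cat_def Hom_def Hom_CatD[OF f])
  show "(h \<cdot>\<^bsub>Cat V\<^esub> g) \<cdot>\<^bsub>Cat V\<^esub> f = h \<cdot>\<^bsub>Cat V\<^esub> (g \<cdot>\<^bsub>Cat V\<^esub> f)"
    if "f \<in> Hom (Cat V) \<W> \<X>" "g \<in> Hom (Cat V) \<X> \<Y>" "h \<in> Hom (Cat V) \<Y> \<Z>"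
    using that by (simp add: Cat_def Hom_CatD[OF that(1)] Hom_CatD[OF that(2)] Hom_CatD[OF that(3)])
qed

lemma internal_category_cst:
  assumes X: "X \<in> Obj V"
  shows "internal_category V (cst V X)"
    "p \<in> Hom V Z X \<Longrightarrow> icomp V (cst V X) p p = p"
proof -
  show c: "icomp V (cst V X) p p = p" if "p \<in> Hom V Z X" for p Z
    using that X by (simp add: icomp_def cst_def Hom_iff)
  have eq: "q = p" if "Tgt (cst V X) \<cdot> p = Src (cst V X) \<cdot> q" "p \<in> Hom V Z X" "q \<in> Hom V Z X" for p q Z
    using that by (simp add: cst_def Hom_iff)
  have cst [simp]: "Ob (cst V X) = X" "Ar (cst V X) = X" "Src (cst V X) = Ident V X"
    "Tgt (cst V X) = Ident V X" "Idn (cst V X) = Ident V X"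
    by (simp_all add: cst_def)
  show "internal_category V (cst V X)"
  proof (rule internal_category_elementwiseI)
    show "Cmp (cst V X) \<in> Hom V (pullback V (Tgt (cst V X)) (Src (cst V X))) (Ar (cst V X))"
      using X by (simp add: cst_def Hom_iff)
  qed (use X eq c in \<open>auto simp: Hom_iff dest!: eq\<close>)
qed

end

text \<open>The levelwise product. A composable pair in it consists of composable pairs in the two factors, whose
composites are paired.\<close>

definition prod_icat :: "('o, 'a) cat \<Rightarrow> ('o, 'a) icat \<Rightarrow> ('o, 'a) icat \<Rightarrow> ('o, 'a) icat" where
  "prod_icat V \<A> \<B> =
    (let s = prod_map V (Src \<A>) (Src \<B>); t = prod_map V (Tgt \<A>) (Tgt \<B>);
         l = pr1 V (Ar \<A>) (Ar \<B>); r = pr2 V (Ar \<A>) (Ar \<B>) in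
     \<lparr>Ob = product V (Ob \<A>) (Ob \<B>), Ar = product V (Ar \<A>) (Ar \<B>), Src = s, Tgt = t,
      Idn = prod_map V (Idn \<A>) (Idn \<B>),
      Cmp = pairing V (icomp V \<A> (l \<cdot>\<^bsub>V\<^esub> pb1 V t s) (l \<cdot>\<^bsub>V\<^esub> pb2 V t s))
                      (icomp V \<B> (r \<cdot>\<^bsub>V\<^esub> pb1 V t s) (r \<cdot>\<^bsub>V\<^esub> pb2 V t s))\<rparr>)"


locale two_internal_categories =
  A: elementwise_internal_category V \<A> + B: elementwise_internal_category V \<B>
  for V :: "('o, 'a) cat" (structure) and \<A> \<B> :: "('o, 'a) icat"
begin

abbreviation "\<P> \<equiv> prod_icat V \<A> \<B>"

lemma prod_icat_sel [simp]:
  "Ob \<P> = product V (Ob \<A>) (Ob \<B>)" "Ar \<P> = product V (Ar \<A>) (Ar \<B>)"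
  "Src \<P> = pairing V (Src \<A> \<cdot> pr1 V (Ar \<A>) (Ar \<B>)) (Src \<B> \<cdot> pr2 V (Ar \<A>) (Ar \<B>))"
  "Tgt \<P> = pairing V (Tgt \<A> \<cdot> pr1 V (Ar \<A>) (Ar \<B>)) (Tgt \<B> \<cdot> pr2 V (Ar \<A>) (Ar \<B>))"
  "Idn \<P> = pairing V (Idn \<A> \<cdot> pr1 V (Ob \<A>) (Ob \<B>)) (Idn \<B> \<cdot> pr2 V (Ob \<A>) (Ob \<B>))"
  by (simp_all add: prod_icat_def Let_def)

lemma composable_prod:
  assumes "p \<in> Hom V Z (product V (Ar \<A>) (Ar \<B>))" "q \<in> Hom V Z (product V (Ar \<A>) (Ar \<B>))"
    "Tgt \<P> \<cdot> p = Src \<P> \<cdot> q"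
  shows "Tgt \<A> \<cdot> (pr1 V (Ar \<A>) (Ar \<B>) \<cdot> p) = Src \<A> \<cdot> (pr1 V (Ar \<A>) (Ar \<B>) \<cdot> q)"
    "Tgt \<B> \<cdot> (pr2 V (Ar \<A>) (Ar \<B>) \<cdot> p) = Src \<B> \<cdot> (pr2 V (Ar \<A>) (Ar \<B>) \<cdot> q)"
proof -
  let ?l = "pr1 V (Ar \<A>) (Ar \<B>)" and ?r = "pr2 V (Ar \<A>) (Ar \<B>)"
  have e: "pairing V (Tgt \<A> \<cdot> (?l \<cdot> p)) (Tgt \<B> \<cdot> (?r \<cdot> p))
      = pairing V (Src \<A> \<cdot> (?l \<cdot> q)) (Src \<B> \<cdot> (?r \<cdot> q))"
    using assms by (simp add: A.Hom_iff)
  show "Tgt \<A> \<cdot> (?l \<cdot> p) = Src \<A> \<cdot> (?l \<cdot> q)" "Tgt \<B> \<cdot> (?r \<cdot> p) = Src \<B> \<cdot> (?r \<cdot> q)"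
    by (rule A.pairing_inject[OF e, of Z "Ob \<A>" "Ob \<B>"];
        use assms(1,2) in \<open>simp add: A.Hom_iff\<close>)+
qed

lemma Cmp_prod:
  "Cmp \<P> \<in> Hom V (pullback V (Tgt \<P>) (Src \<P>)) (product V (Ar \<A>) (Ar \<B>))"
  and icomp_prod:
  "p \<in> Hom V Z (product V (Ar \<A>) (Ar \<B>)) \<Longrightarrow> q \<in> Hom V Z (product V (Ar \<A>) (Ar \<B>)) \<Longrightarrow>
    Tgt \<P> \<cdot> p = Src \<P> \<cdot> q \<Longrightarrow> icomp V \<P> p q =
      pairing V (icomp V \<A> (pr1 V (Ar \<A>) (Ar \<B>) \<cdot> p) (pr1 V (Ar \<A>) (Ar \<B>) \<cdot> q))
                (icomp V \<B> (pr2 V (Ar \<A>) (Ar \<B>) \<cdot> p) (pr2 V (Ar \<A>) (Ar \<B>) \<cdot> q))"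
proof -
  let ?l = "pr1 V (Ar \<A>) (Ar \<B>)" and ?r = "pr2 V (Ar \<A>) (Ar \<B>)"
  let ?t = "Tgt \<P>" and ?s = "Src \<P>"
  let ?p1 = "pb1 V ?t ?s" and ?p2 = "pb2 V ?t ?s"
  have cmp: "Cmp \<P> = pairing V (icomp V \<A> (?l \<cdot> ?p1) (?l \<cdot> ?p2)) (icomp V \<B> (?r \<cdot> ?p1) (?r \<cdot> ?p2))"
    by (simp add: prod_icat_def Let_def)
  have ts [simp]: "?t \<in> Arr V" "?s \<in> Arr V" "Dom V ?t = product V (Ar \<A>) (Ar \<B>)"
    "Dom V ?s = product V (Ar \<A>) (Ar \<B>)"
    "Cod V ?t = product V (Ob \<A>) (Ob \<B>)" "Cod V ?s = product V (Ob \<A>) (Ob \<B>)"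
    by simp_all
  have c: "Tgt \<A> \<cdot> (?l \<cdot> ?p1) = Src \<A> \<cdot> (?l \<cdot> ?p2)" "Tgt \<B> \<cdot> (?r \<cdot> ?p1) = Src \<B> \<cdot> (?r \<cdot> ?p2)"
    by (rule composable_prod[of _ "pullback V ?t ?s"];
        simp add: A.Hom_iff A.pb_commutes del: prod_icat_sel)+
  show "Cmp \<P> \<in> Hom V (pullback V ?t ?s) (product V (Ar \<A>) (Ar \<B>))"
    unfolding cmp using c by (simp add: A.Hom_iff del: prod_icat_sel)
  assume pq: "p \<in> Hom V Z (product V (Ar \<A>) (Ar \<B>))" "q \<in> Hom V Z (product V (Ar \<A>) (Ar \<B>))"
    "?t \<cdot> p = ?s \<cdot> q"
  let ?L = "pb_lift V ?t ?s p q"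
  have L: "?L \<in> Arr V" "Dom V ?L = Z" "Cod V ?L = pullback V ?t ?s" "?p1 \<cdot> ?L = p" "?p2 \<cdot> ?L = q"
    using pq by (simp_all add: A.Hom_iff del: prod_icat_sel)
  show "icomp V \<P> p q = pairing V (icomp V \<A> (?l \<cdot> p) (?l \<cdot> q)) (icomp V \<B> (?r \<cdot> p) (?r \<cdot> q))"
    unfolding icomp_def[of V \<P>] cmp
    using c L by (simp add: A.icomp_comp B.icomp_comp del: prod_icat_sel)
qed

lemma internal_category_prod: "internal_category V \<P>"
proof (rule A.internal_category_elementwiseI)
  let ?l = "pr1 V (Ar \<A>) (Ar \<B>)" and ?r = "pr2 V (Ar \<A>) (Ar \<B>)"
  fix Z p q assume pq: "p \<in> Hom V Z (Ar \<P>)" "q \<in> Hom V Z (Ar \<P>)" "Tgt \<P> \<cdot> p = Src \<P> \<cdot> q"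
  note pq' = pq(1,2)[unfolded prod_icat_sel]
  note c = composable_prod[OF pq' pq(3)]
  show "Src \<P> \<cdot> icomp V \<P> p q = Src \<P> \<cdot> p \<and> Tgt \<P> \<cdot> icomp V \<P> p q = Tgt \<P> \<cdot> q"
    unfolding icomp_prod[OF pq' pq(3)] using c pq' by (simp add: A.Hom_iff)
  fix r assume r: "r \<in> Hom V Z (Ar \<P>)" "Tgt \<P> \<cdot> q = Src \<P> \<cdot> r"
  note r' = r(1)[unfolded prod_icat_sel]
  note d = composable_prod[OF pq'(2) r' r(2)]
  note i = icomp_prod[OF pq' pq(3)] icomp_prod[OF pq'(2) r' r(2)]
  have "icomp V \<P> (icomp V \<P> p q) r
      = pairing V (icomp V \<A> (icomp V \<A> (?l \<cdot> p) (?l \<cdot> q)) (?l \<cdot> r))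
                  (icomp V \<B> (icomp V \<B> (?r \<cdot> p) (?r \<cdot> q)) (?r \<cdot> r))"
    unfolding i by (subst icomp_prod[of _ Z]) (use c d pq' r' in \<open>simp_all add: A.Hom_iff\<close>)
  also have "\<dots> = pairing V (icomp V \<A> (?l \<cdot> p) (icomp V \<A> (?l \<cdot> q) (?l \<cdot> r)))
                  (icomp V \<B> (?r \<cdot> p) (icomp V \<B> (?r \<cdot> q) (?r \<cdot> r)))"
    using A.icomp_assoc[of "?l \<cdot> p" Z "?l \<cdot> q" "?l \<cdot> r"] B.icomp_assoc[of "?r \<cdot> p" Z "?r \<cdot> q" "?r \<cdot> r"]
      c d pq' r' by (simp add: A.Hom_iff)
  also have "\<dots> = icomp V \<P> p (icomp V \<P> q r)"
    unfolding i by (subst icomp_prod[of _ Z]) (use c d pq' r' in \<open>simp_all add: A.Hom_iff\<close>)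
  finally show "icomp V \<P> (icomp V \<P> p q) r = icomp V \<P> p (icomp V \<P> q r)" .
next
  fix Z p assume p: "p \<in> Hom V Z (Ar \<P>)"
  have "icomp V \<P> (Idn \<P> \<cdot> (Src \<P> \<cdot> p)) p = p"
    by (subst icomp_prod[of _ Z]) (use p in \<open>simp_all add: A.Hom_iff A.icomp_idn B.icomp_idn\<close>)
  moreover have "icomp V \<P> p (Idn \<P> \<cdot> (Tgt \<P> \<cdot> p)) = p"
    by (subst icomp_prod[of _ Z]) (use p in \<open>simp_all add: A.Hom_iff A.icomp_idn B.icomp_idn\<close>)
  ultimately show "icomp V \<P> (Idn \<P> \<cdot> (Src \<P> \<cdot> p)) p = p \<and> icomp V \<P> p (Idn \<P> \<cdot> (Tgt \<P> \<cdot> p)) = p" ..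
qed (use Cmp_prod in \<open>simp_all add: A.Hom_iff A.src_idn A.tgt_idn B.src_idn B.tgt_idn\<close>)

end

context two_internal_categories
begin

definition proj1 :: "('o, 'a) ifun" where
  "proj1 = \<lparr>IDom = \<P>, ICod = \<A>, IOb = pr1 V (Ob \<A>) (Ob \<B>), IAr = pr1 V (Ar \<A>) (Ar \<B>)\<rparr>"

definition proj2 :: "('o, 'a) ifun" where
  "proj2 = \<lparr>IDom = \<P>, ICod = \<B>, IOb = pr2 V (Ob \<A>) (Ob \<B>), IAr = pr2 V (Ar \<A>) (Ar \<B>)\<rparr>"

lemma internal_categories: "internal_category V \<A>" "internal_category V \<B>"
  by (rule A.internal_category_axioms, rule B.internal_category_axioms)

lemma proj_in_Hom: "proj1 \<in> Hom (Cat V) \<P> \<A>" "proj2 \<in> Hom (Cat V) \<P> \<B>"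
proof -
  have c: "pr1 V (Ar \<A>) (Ar \<B>) \<cdot> icomp V \<P> p q
        = icomp V \<A> (pr1 V (Ar \<A>) (Ar \<B>) \<cdot> p) (pr1 V (Ar \<A>) (Ar \<B>) \<cdot> q) \<and>
      pr2 V (Ar \<A>) (Ar \<B>) \<cdot> icomp V \<P> p q
        = icomp V \<B> (pr2 V (Ar \<A>) (Ar \<B>) \<cdot> p) (pr2 V (Ar \<A>) (Ar \<B>) \<cdot> q)"
    if "p \<in> Hom V Z (Ar \<P>)" "q \<in> Hom V Z (Ar \<P>)" "Tgt \<P> \<cdot> p = Src \<P> \<cdot> q" for Z p q
  proof -
    note pq = that(1,2)[unfolded prod_icat_sel]
    show ?thesis
      unfolding icomp_prod[OF pq that(3)]
      using composable_prod[OF pq that(3)] pq by (simp add: A.Hom_iff)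
  qed
  show "proj1 \<in> Hom (Cat V) \<P> \<A>"
    unfolding proj1_def
    by (rule A.Hom_CatI[OF internal_category_prod internal_categories(1)])
       (use c in blast | simp add: A.Hom_iff)+
  show "proj2 \<in> Hom (Cat V) \<P> \<B>"
    unfolding proj2_def
    by (rule A.Hom_CatI[OF internal_category_prod internal_categories(2)])
       (use c in blast | simp add: A.Hom_iff)+
qed

lemma is_product_prod_icat: "is_product (Cat V) \<A> \<B> (\<P>, proj1, proj2)"
  unfolding is_product_def prod.case
proof (intro conjI allI impI)
  fix \<Z> f g assume f: "f \<in> Hom (Cat V) \<Z> \<A>" and g: "g \<in> Hom (Cat V) \<Z> \<B>"
  have Z: "internal_category V \<Z>" using f by (simp add: A.Hom_Cat)
  interpret Z: elementwise_internal_category V \<Z> using Z by (rule A.elementwise)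
  note [simp] = A.Hom_CatD[OF f] A.Hom_CatD[OF g] A.Hom_CatD_comp[OF f] A.Hom_CatD_comp[OF g]
  let ?h = "\<lparr>IDom = \<Z>, ICod = \<P>, IOb = pairing V (IOb f) (IOb g), IAr = pairing V (IAr f) (IAr g)\<rparr>"
  have h: "?h \<in> Hom (Cat V) \<Z> \<P>"
  proof (rule A.Hom_CatI[OF Z internal_category_prod])
    fix Z p q
    assume pq: "p \<in> Hom V Z (Ar \<Z>)" "q \<in> Hom V Z (Ar \<Z>)" "Tgt \<Z> \<cdot> p = Src \<Z> \<cdot> q"
    show "pairing V (IAr f) (IAr g) \<cdot> icomp V \<Z> p q
        = icomp V \<P> (pairing V (IAr f) (IAr g) \<cdot> p) (pairing V (IAr f) (IAr g) \<cdot> q)"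
      by (subst icomp_prod[of _ Z])
         (use pq A.Hom_Cat_icomp[OF f pq] A.Hom_Cat_icomp[OF g pq] in \<open>simp_all add: A.Hom_iff\<close>)
  qed (simp_all add: A.Hom_iff)
  have D: "IDom f = \<Z>" "IDom g = \<Z>" "ICod f = \<A>" "ICod g = \<B>"
    using f g by (auto simp: A.Hom_Cat)
  show "\<exists>!h. h \<in> Hom (Cat V) \<Z> \<P> \<and> proj1 \<cdot>\<^bsub>Cat V\<^esub> h = f \<and> proj2 \<cdot>\<^bsub>Cat V\<^esub> h = g"
  proof (rule ex1I[of _ ?h])
    show "?h \<in> Hom (Cat V) \<Z> \<P> \<and> proj1 \<cdot>\<^bsub>Cat V\<^esub> ?h = f \<and> proj2 \<cdot>\<^bsub>Cat V\<^esub> ?h = g"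
      using h D by (auto simp: proj1_def proj2_def Cat_def)
    fix k assume k: "k \<in> Hom (Cat V) \<Z> \<P> \<and> proj1 \<cdot>\<^bsub>Cat V\<^esub> k = f \<and> proj2 \<cdot>\<^bsub>Cat V\<^esub> k = g"
    then have k': "k \<in> Hom (Cat V) \<Z> \<P>" by blast
    note kD = A.Hom_CatD(1-6)[OF k', unfolded prod_icat_sel]
    have fg: "f = proj1 \<cdot>\<^bsub>Cat V\<^esub> k" "g = proj2 \<cdot>\<^bsub>Cat V\<^esub> k" using k by simp_all
    have e: "IOb f = pr1 V (Ob \<A>) (Ob \<B>) \<cdot> IOb k" "IAr f = pr1 V (Ar \<A>) (Ar \<B>) \<cdot> IAr k"
      "IOb g = pr2 V (Ob \<A>) (Ob \<B>) \<cdot> IOb k" "IAr g = pr2 V (Ar \<A>) (Ar \<B>) \<cdot> IAr k"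
      unfolding fg by (simp_all add: proj1_def proj2_def)
    show "k = ?h"
      by (rule A.ifun_eqI[OF k' h]) (simp_all only: e kD ifun.select_convs A.pairing_pr_comp
        A.icat_simps B.icat_simps)
  qed
qed (rule proj_in_Hom)+

end

context ccc_with_pullbacks
begin

lemma two_internal [intro]:
  "internal_category V \<A> \<Longrightarrow> internal_category V \<B> \<Longrightarrow> two_internal_categories V \<A> \<B>"
  unfolding two_internal_categories_def by blast

lemma is_terminal_cst: "is_terminal (Cat V) (cst V (terminal V))"
  unfolding is_terminal_def
proof (intro conjI ballI)
  let ?T = "cst V (terminal V)"
  show T: "?T \<in> Obj (Cat V)" by (simp add: internal_category_cst)
  have cst: "Ob ?T = terminal V" "Ar ?T = terminal V" by (simp_all add: cst_def)
  fix \<A> assume A: "\<A> \<in> Obj (Cat V)"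
  interpret A: elementwise_internal_category V \<A> using A by auto
  interpret T: elementwise_internal_category V ?T using T by auto
  let ?f = "\<lparr>IDom = \<A>, ICod = ?T, IOb = bang V (Ob \<A>), IAr = bang V (Ar \<A>)\<rparr>"
  have f: "?f \<in> Hom (Cat V) \<A> ?T"
  proof (rule Hom_CatI)
    fix Z p q assume pq: "p \<in> Hom V Z (Ar \<A>)" "q \<in> Hom V Z (Ar \<A>)" "Tgt \<A> \<cdot> p = Src \<A> \<cdot> q"
    have "icomp V ?T (bang V Z) (bang V Z) = bang V Z"
      using internal_category_cst(2)[OF terminal_Obj, of "bang V Z" Z] pq(1)
      by (simp add: Hom_iff)
    then show "bang V (Ar \<A>) \<cdot> icomp V \<A> p q = icomp V ?T (bang V (Ar \<A>) \<cdot> p) (bang V (Ar \<A>) \<cdot> q)"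
      using pq by (simp add: Hom_iff)
  qed (use A T in \<open>simp_all add: Hom_iff cst_def\<close>)
  show "\<exists>!f. f \<in> Hom (Cat V) \<A> ?T"
  proof (rule ex1I[of _ ?f])
    show "?f \<in> Hom (Cat V) \<A> ?T" by (rule f)
    fix g assume g: "g \<in> Hom (Cat V) \<A> ?T"
    show "g = ?f"
      by (rule ifun_eqI[OF g f]; rule terminal_unique)
         (use Hom_CatD(1-6)[OF g] cst in \<open>auto simp: Hom_iff\<close>)
  qed
qed

lemma cartesian_category_Cat: "cartesian_category (Cat V)"
proof -
  interpret C: category "Cat V" by (rule category_Cat)
  show ?thesis
  proof
    show "\<exists>T. is_terminal (Cat V) T" using is_terminal_cst by blast
    fix \<A> \<B> assume "\<A> \<in> Obj (Cat V)" "\<B> \<in> Obj (Cat V)"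
    then interpret two_internal_categories V \<A> \<B> by auto
    show "\<exists>c. is_product (Cat V) \<A> \<B> c" using is_product_prod_icat by blast
  qed
qed

end

section \<open>Powers of internal categories\<close>

text \<open>Because \<open>[X, -]\<close> preserves pullbacks, it acts levelwise on internal categories, and the result is the
internal hom from the discrete internal category on \<open>X\<close>. The composition is the transpose of
composing in \<open>\<A>\<close> the values of the two members of a composable pair at an element of \<open>X\<close>.\<close>

definition power_icat :: "('o, 'a) cat \<Rightarrow> 'o \<Rightarrow> ('o, 'a) icat \<Rightarrow> ('o, 'a) icat" where
  "power_icat V X \<A> =
    (let E0 = exponent V X (Ob \<A>); E1 = exponent V X (Ar \<A>);
         ev0 = evalmap V X (Ob \<A>); ev1 = evalmap V X (Ar \<A>);
         s = exp_transpose V E1 X (Src \<A> \<cdot>\<^bsub>V\<^esub> ev1); t = exp_transpose V E1 X (Tgt \<A> \<cdot>\<^bsub>V\<^esub> ev1);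
         P = pullback V t s in
     \<lparr>Ob = E0, Ar = E1, Src = s, Tgt = t, Idn = exp_transpose V E0 X (Idn \<A> \<cdot>\<^bsub>V\<^esub> ev0),
      Cmp = exp_transpose V P X
        (icomp V \<A> (ev1 \<cdot>\<^bsub>V\<^esub> pairing V (pb1 V t s \<cdot>\<^bsub>V\<^esub> pr1 V P X) (pr2 V P X))
                    (ev1 \<cdot>\<^bsub>V\<^esub> pairing V (pb2 V t s \<cdot>\<^bsub>V\<^esub> pr1 V P X) (pr2 V P X)))\<rparr>)"

locale internal_category_power = elementwise_internal_category V \<A>
  for V :: "('o, 'a) cat" (structure) and \<A> :: "('o, 'a) icat" +
  fixes X :: 'o
  assumes X_Obj [simp]: "X \<in> Obj V"
begin

abbreviation "\<M> \<equiv> power_icat V X \<A>"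
abbreviation "ev0 \<equiv> evalmap V X (Ob \<A>)"
abbreviation "ev1 \<equiv> evalmap V X (Ar \<A>)"

lemma power_typing [simp]:
  "Ob \<M> = exponent V X (Ob \<A>)" "Ar \<M> = exponent V X (Ar \<A>)"
  "Src \<M> \<in> Arr V" "Dom V (Src \<M>) = exponent V X (Ar \<A>)" "Cod V (Src \<M>) = exponent V X (Ob \<A>)"
  "Tgt \<M> \<in> Arr V" "Dom V (Tgt \<M>) = exponent V X (Ar \<A>)" "Cod V (Tgt \<M>) = exponent V X (Ob \<A>)"
  "Idn \<M> \<in> Arr V" "Dom V (Idn \<M>) = exponent V X (Ob \<A>)" "Cod V (Idn \<M>) = exponent V X (Ar \<A>)"
  by (simp_all add: power_icat_def Let_def)

lemma power_eval [simp]: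
  assumes "u \<in> Arr V" "Cod V u = X" "p \<in> Arr V" "Dom V p = Dom V u"
  shows "Cod V p = exponent V X (Ar \<A>) \<Longrightarrow> ev0 \<cdot> pairing V (Src \<M> \<cdot> p) u = Src \<A> \<cdot> (ev1 \<cdot> pairing V p u)"
    "Cod V p = exponent V X (Ar \<A>) \<Longrightarrow> ev0 \<cdot> pairing V (Tgt \<M> \<cdot> p) u = Tgt \<A> \<cdot> (ev1 \<cdot> pairing V p u)"
    "Cod V p = exponent V X (Ob \<A>) \<Longrightarrow> ev1 \<cdot> pairing V (Idn \<M> \<cdot> p) u = Idn \<A> \<cdot> (ev0 \<cdot> pairing V p u)"
  using assms by (simp_all add: power_icat_def Let_def)

lemma composable_eval:
  assumes "p \<in> Hom V Z (exponent V X (Ar \<A>))" "q \<in> Hom V Z (exponent V X (Ar \<A>))"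
    "Tgt \<M> \<cdot> p = Src \<M> \<cdot> q" "z \<in> Hom V W Z" "u \<in> Hom V W X"
  shows "Tgt \<A> \<cdot> (ev1 \<cdot> pairing V (p \<cdot> z) u) = Src \<A> \<cdot> (ev1 \<cdot> pairing V (q \<cdot> z) u)"
proof -
  have "Tgt \<M> \<cdot> (p \<cdot> z) = Src \<M> \<cdot> (q \<cdot> z)"
    using comp_cong_right[OF assms(3), of z] assms by (simp add: Hom_iff)
  then have "ev0 \<cdot> pairing V (Tgt \<M> \<cdot> (p \<cdot> z)) u = ev0 \<cdot> pairing V (Src \<M> \<cdot> (q \<cdot> z)) u" by simp
  then show ?thesis using assms by (simp add: Hom_iff)
qed

lemma Cmp_power:
  "Cmp \<M> \<in> Hom V (pullback V (Tgt \<M>) (Src \<M>)) (exponent V X (Ar \<A>))"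
  and eval_icomp_power:
  "p \<in> Hom V Z (exponent V X (Ar \<A>)) \<Longrightarrow> q \<in> Hom V Z (exponent V X (Ar \<A>)) \<Longrightarrow>
    Tgt \<M> \<cdot> p = Src \<M> \<cdot> q \<Longrightarrow> z \<in> Hom V W Z \<Longrightarrow> u \<in> Hom V W X \<Longrightarrow>
    ev1 \<cdot> pairing V (icomp V \<M> p q \<cdot> z) u
      = icomp V \<A> (ev1 \<cdot> pairing V (p \<cdot> z) u) (ev1 \<cdot> pairing V (q \<cdot> z) u)"
proof -
  let ?t = "Tgt \<M>" and ?s = "Src \<M>"
  let ?P = "pullback V ?t ?s"
  let ?a = "ev1 \<cdot> pairing V (pb1 V ?t ?s \<cdot> pr1 V ?P X) (pr2 V ?P X)"
  let ?b = "ev1 \<cdot> pairing V (pb2 V ?t ?s \<cdot> pr1 V ?P X) (pr2 V ?P X)"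
  have cmp: "Cmp \<M> = exp_transpose V ?P X (icomp V \<A> ?a ?b)"
    by (simp add: power_icat_def Let_def)
  have c: "Tgt \<A> \<cdot> ?a = Src \<A> \<cdot> ?b"
    by (rule composable_eval[of _ ?P _ _ "product V ?P X"]) (simp_all add: Hom_iff pb_commutes)
  show "Cmp \<M> \<in> Hom V ?P (exponent V X (Ar \<A>))"
    unfolding cmp using c by (simp add: Hom_iff)
  assume h: "p \<in> Hom V Z (exponent V X (Ar \<A>))" "q \<in> Hom V Z (exponent V X (Ar \<A>))"
    "?t \<cdot> p = ?s \<cdot> q" "z \<in> Hom V W Z" "u \<in> Hom V W X"
  let ?L = "pb_lift V ?t ?s p q"
  have L: "?L \<in> Arr V" "Dom V ?L = Z" "Cod V ?L = ?P" "pb1 V ?t ?s \<cdot> ?L = p" "pb2 V ?t ?s \<cdot> ?L = q"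
    using h by (simp_all add: Hom_iff)
  have L': "pb1 V ?t ?s \<cdot> (?L \<cdot> z) = p \<cdot> z" "pb2 V ?t ?s \<cdot> (?L \<cdot> z) = q \<cdot> z"
    using comp_cong_right[OF L(4), of z] comp_cong_right[OF L(5), of z] L h by (simp_all add: Hom_iff)
  show "ev1 \<cdot> pairing V (icomp V \<M> p q \<cdot> z) u
      = icomp V \<A> (ev1 \<cdot> pairing V (p \<cdot> z) u) (ev1 \<cdot> pairing V (q \<cdot> z) u)"
    unfolding icomp_def[of V \<M>] cmp using c L(1-3) L' h
    by (simp add: Hom_iff icomp_comp)
qed

lemma icomp_power_Hom:
  assumes "p \<in> Hom V Z (exponent V X (Ar \<A>))" "q \<in> Hom V Z (exponent V X (Ar \<A>))"
    "Tgt \<M> \<cdot> p = Src \<M> \<cdot> q"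
  shows "icomp V \<M> p q \<in> Hom V Z (exponent V X (Ar \<A>))"
  using assms Cmp_power by (simp add: icomp_def Hom_iff)

lemma internal_category_power: "internal_category V \<M>"
proof (rule internal_category_elementwiseI; (unfold power_typing)?)
  have ex: "exponentiable V X (Ob \<A>)" "exponentiable V X (Ar \<A>)" by simp_all
  fix Z p q assume pq: "p \<in> Hom V Z (exponent V X (Ar \<A>))" "q \<in> Hom V Z (exponent V X (Ar \<A>))"
    "Tgt \<M> \<cdot> p = Src \<M> \<cdot> q"
  note i = icomp_power_Hom[OF pq] and ei = eval_icomp_power[OF pq] and c = composable_eval[OF pq]
  show st: "Src \<M> \<cdot> icomp V \<M> p q = Src \<M> \<cdot> p \<and> Tgt \<M> \<cdot> icomp V \<M> p q = Tgt \<M> \<cdot> q"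
  proof (intro conjI; rule exponent_ext[OF ex(1), of _ Z])
    fix W z u assume z: "z \<in> Hom V W Z" "u \<in> Hom V W X"
    show "ev0 \<cdot> pairing V ((Src \<M> \<cdot> icomp V \<M> p q) \<cdot> z) u = ev0 \<cdot> pairing V ((Src \<M> \<cdot> p) \<cdot> z) u"
      "ev0 \<cdot> pairing V ((Tgt \<M> \<cdot> icomp V \<M> p q) \<cdot> z) u = ev0 \<cdot> pairing V ((Tgt \<M> \<cdot> q) \<cdot> z) u"
      using pq(1,2) z i ei[OF z] c[OF z] by (simp_all add: Hom_iff)
  qed (use pq i in \<open>simp_all add: Hom_iff\<close>)
  fix r assume r: "r \<in> Hom V Z (exponent V X (Ar \<A>))" "Tgt \<M> \<cdot> q = Src \<M> \<cdot> r"
  note j = icomp_power_Hom[OF pq(2) r] and ej = eval_icomp_power[OF pq(2) r]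
    and d = composable_eval[OF pq(2) r]
  have sj: "Src \<M> \<cdot> icomp V \<M> q r = Src \<M> \<cdot> q"
  proof (rule exponent_ext[OF ex(1), of _ Z])
    fix W z u assume z: "z \<in> Hom V W Z" "u \<in> Hom V W X"
    show "ev0 \<cdot> pairing V ((Src \<M> \<cdot> icomp V \<M> q r) \<cdot> z) u = ev0 \<cdot> pairing V ((Src \<M> \<cdot> q) \<cdot> z) u"
      using pq(2) r(1) z j ej[OF z] d[OF z] by (simp_all add: Hom_iff)
  qed (use pq j in \<open>simp_all add: Hom_iff\<close>)
  have t1: "Tgt \<M> \<cdot> icomp V \<M> p q = Src \<M> \<cdot> r" using st r(2) by simp
  have t2: "Tgt \<M> \<cdot> p = Src \<M> \<cdot> icomp V \<M> q r" using sj pq(3) by simp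
  show "icomp V \<M> (icomp V \<M> p q) r = icomp V \<M> p (icomp V \<M> q r)"
  proof (rule exponent_ext[OF ex(2) icomp_power_Hom[OF i r(1) t1] icomp_power_Hom[OF pq(1) j t2]])
    fix W z u assume z: "z \<in> Hom V W Z" "u \<in> Hom V W X"
    show "ev1 \<cdot> pairing V (icomp V \<M> (icomp V \<M> p q) r \<cdot> z) u
        = ev1 \<cdot> pairing V (icomp V \<M> p (icomp V \<M> q r) \<cdot> z) u"
      unfolding eval_icomp_power[OF i r(1) t1 z] eval_icomp_power[OF pq(1) j t2 z] ei[OF z] ej[OF z]
      by (rule icomp_assoc[of _ W]) (use pq r z c[OF z] d[OF z] in \<open>simp_all add: Hom_iff\<close>)
  qed
next
  have ex: "exponentiable V X (Ob \<A>)" "exponentiable V X (Ar \<A>)" by simp_all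
  { fix Z p assume p: "p \<in> Hom V Z (exponent V X (Ob \<A>))"
    have "Src \<M> \<cdot> (Idn \<M> \<cdot> p) = p" "Tgt \<M> \<cdot> (Idn \<M> \<cdot> p) = p"
      by (rule exponent_ext[OF ex(1), of _ Z]; use p in \<open>simp add: Hom_iff\<close>)+ }
  note si = this
  show "Src \<M> \<cdot> Idn \<M> = Ident V (exponent V X (Ob \<A>))" "Tgt \<M> \<cdot> Idn \<M> = Ident V (exponent V X (Ob \<A>))"
    using si[of "Ident V (exponent V X (Ob \<A>))" "exponent V X (Ob \<A>)"] by (simp_all add: Hom_iff)
  fix Z p assume p: "p \<in> Hom V Z (exponent V X (Ar \<A>))"
  have h: "Idn \<M> \<cdot> (Src \<M> \<cdot> p) \<in> Hom V Z (exponent V X (Ar \<A>))"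
    "Idn \<M> \<cdot> (Tgt \<M> \<cdot> p) \<in> Hom V Z (exponent V X (Ar \<A>))"
    using p by (simp_all add: Hom_iff)
  have st: "Tgt \<M> \<cdot> (Idn \<M> \<cdot> (Src \<M> \<cdot> p)) = Src \<M> \<cdot> p" "Tgt \<M> \<cdot> p = Src \<M> \<cdot> (Idn \<M> \<cdot> (Tgt \<M> \<cdot> p))"
    using si[of "Src \<M> \<cdot> p" Z] si[of "Tgt \<M> \<cdot> p" Z] p by (simp_all add: Hom_iff)
  show "icomp V \<M> (Idn \<M> \<cdot> (Src \<M> \<cdot> p)) p = p \<and> icomp V \<M> p (Idn \<M> \<cdot> (Tgt \<M> \<cdot> p)) = p"
  proof (intro conjI; rule exponent_ext[OF ex(2), of _ Z])
    fix W z u assume z: "z \<in> Hom V W Z" "u \<in> Hom V W X"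
    show "ev1 \<cdot> pairing V (icomp V \<M> (Idn \<M> \<cdot> (Src \<M> \<cdot> p)) p \<cdot> z) u = ev1 \<cdot> pairing V (p \<cdot> z) u"
      unfolding eval_icomp_power[OF h(1) p st(1) z] using p z by (simp add: Hom_iff icomp_idn)
    show "ev1 \<cdot> pairing V (icomp V \<M> p (Idn \<M> \<cdot> (Tgt \<M> \<cdot> p)) \<cdot> z) u = ev1 \<cdot> pairing V (p \<cdot> z) u"
      unfolding eval_icomp_power[OF p h(2) st(2) z] using p z by (simp add: Hom_iff icomp_idn)
  qed (use p h st icomp_power_Hom in \<open>auto simp: Hom_iff\<close>)
qed (use Cmp_power in \<open>simp_all add: Hom_iff\<close>)

sublocale P: two_internal_categories V \<M> "cst V X"
  using two_internal internal_category_power internal_category_cst X_Obj by blast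

lemma cst_sel [simp]:
  "Ob (cst V X) = X" "Ar (cst V X) = X" "Src (cst V X) = Ident V X"
  "Tgt (cst V X) = Ident V X" "Idn (cst V X) = Ident V X"
  by (simp_all add: cst_def)

lemma icomp_cst: "p \<in> Hom V Z X \<Longrightarrow> icomp V (cst V X) p p = p"
  by (rule internal_category_cst(2)[OF X_Obj])

definition eval_functor :: "('o, 'a) ifun" where
  "eval_functor = \<lparr>IDom = P.\<P>, ICod = \<A>, IOb = ev0, IAr = ev1\<rparr>"

lemma eval_functor_in_Hom: "eval_functor \<in> Hom (Cat V) P.\<P> \<A>"
  unfolding eval_functor_def
proof (rule Hom_CatI)
  let ?l = "pr1 V (exponent V X (Ar \<A>)) X" and ?r = "pr2 V (exponent V X (Ar \<A>)) X"
  fix Z p q assume pq: "p \<in> Hom V Z (Ar P.\<P>)" "q \<in> Hom V Z (Ar P.\<P>)" "Tgt P.\<P> \<cdot> p = Src P.\<P> \<cdot> q"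
  note pq' = pq(1,2)[unfolded P.prod_icat_sel]
  note c = P.composable_prod[OF pq' pq(3), unfolded power_typing cst_sel]
  have Z: "Z \<in> Obj V" using pq by (simp add: Hom_iff)
  have lr: "?l \<cdot> p \<in> Hom V Z (exponent V X (Ar \<A>))" "?l \<cdot> q \<in> Hom V Z (exponent V X (Ar \<A>))"
    "?r \<cdot> p \<in> Hom V Z X" "?r \<cdot> q \<in> Hom V Z X" using pq' by (simp_all add: Hom_iff)
  have rq: "?r \<cdot> q = ?r \<cdot> p" using c(2) lr by (simp add: Hom_iff)
  have p: "p = pairing V (?l \<cdot> p) (?r \<cdot> p)" using pq' by (simp add: Hom_iff)
  have "q = pairing V (?l \<cdot> q) (?r \<cdot> q)" using pq' by (simp add: Hom_iff)
  then have q: "q = pairing V (?l \<cdot> q) (?r \<cdot> p)" unfolding rq .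
  have "ev1 \<cdot> icomp V P.\<P> p q = ev1 \<cdot> pairing V (icomp V \<M> (?l \<cdot> p) (?l \<cdot> q) \<cdot> Ident V Z) (?r \<cdot> p)"
    unfolding P.icomp_prod[OF pq' pq(3)]
    using rq icomp_cst[OF lr(3)] icomp_power_Hom[OF lr(1,2) c(1)] by (simp add: Hom_iff)
  also have "\<dots> = icomp V \<A> (ev1 \<cdot> pairing V (?l \<cdot> p) (?r \<cdot> p)) (ev1 \<cdot> pairing V (?l \<cdot> q) (?r \<cdot> p))"
    using lr(1,2) Z by (subst eval_icomp_power[OF lr(1,2) c(1) _ lr(3)]) (simp_all add: Hom_iff)
  finally show "ev1 \<cdot> icomp V P.\<P> p q = icomp V \<A> (ev1 \<cdot> p) (ev1 \<cdot> q)" using p q by simp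
qed (use internal_category_axioms P.internal_category_prod power_eval[of "pr2 V _ X" "pr1 V _ X"]
      in \<open>simp_all add: Hom_iff\<close>)

text \<open>Source, target and identities are compared by evaluating at an element \<open>u\<close> of \<open>X\<close>. For the
composition one uses that \<open>u\<close>, as an arrow of \<open>cst X\<close>, is its own composite with itself.\<close>

lemma curry_functor_in_Hom:
  assumes Z: "internal_category V \<Z>" and f: "f \<in> Hom (Cat V) (prod_icat V \<Z> (cst V X)) \<A>"
  shows "\<lparr>IDom = \<Z>, ICod = \<M>, IOb = exp_transpose V (Ob \<Z>) X (IOb f),
    IAr = exp_transpose V (Ar \<Z>) X (IAr f)\<rparr> \<in> Hom (Cat V) \<Z> \<M>"
proof (rule Hom_CatI[OF Z internal_category_power]; (unfold power_typing)?)
  interpret Q: two_internal_categories V \<Z> "cst V X"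
    using two_internal Z internal_category_cst by auto
  note [simp] = Hom_CatD(1-6)[OF f, unfolded Q.prod_icat_sel cst_sel]
  note f' = Hom_CatD_comp[OF f, unfolded Q.prod_icat_sel cst_sel]
  let ?h0 = "exp_transpose V (Ob \<Z>) X (IOb f)" and ?h1 = "exp_transpose V (Ar \<Z>) X (IAr f)"
  show "?h0 \<in> Hom V (Ob \<Z>) (exponent V X (Ob \<A>))" "?h1 \<in> Hom V (Ar \<Z>) (exponent V X (Ar \<A>))"
    by (simp_all add: Hom_iff)
  have ex: "exponentiable V X (Ob \<A>)" "exponentiable V X (Ar \<A>)" by simp_all
  show "Src \<M> \<cdot> ?h1 = ?h0 \<cdot> Src \<Z>"
  proof (rule exponent_ext[OF ex(1), of _ "Ar \<Z>"])
    fix W z u assume z: "z \<in> Hom V W (Ar \<Z>)" "u \<in> Hom V W X"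
    show "ev0 \<cdot> pairing V ((Src \<M> \<cdot> ?h1) \<cdot> z) u = ev0 \<cdot> pairing V ((?h0 \<cdot> Src \<Z>) \<cdot> z) u"
      using z f'(1)[of "pairing V z u"] by (simp add: Hom_iff)
  qed (simp_all add: Hom_iff)
  show "Tgt \<M> \<cdot> ?h1 = ?h0 \<cdot> Tgt \<Z>"
  proof (rule exponent_ext[OF ex(1), of _ "Ar \<Z>"])
    fix W z u assume z: "z \<in> Hom V W (Ar \<Z>)" "u \<in> Hom V W X"
    show "ev0 \<cdot> pairing V ((Tgt \<M> \<cdot> ?h1) \<cdot> z) u = ev0 \<cdot> pairing V ((?h0 \<cdot> Tgt \<Z>) \<cdot> z) u"
      using z f'(2)[of "pairing V z u"] by (simp add: Hom_iff)
  qed (simp_all add: Hom_iff)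
  show "?h1 \<cdot> Idn \<Z> = Idn \<M> \<cdot> ?h0"
  proof (rule exponent_ext[OF ex(2), of _ "Ob \<Z>"])
    fix W z u assume z: "z \<in> Hom V W (Ob \<Z>)" "u \<in> Hom V W X"
    show "ev1 \<cdot> pairing V ((?h1 \<cdot> Idn \<Z>) \<cdot> z) u = ev1 \<cdot> pairing V ((Idn \<M> \<cdot> ?h0) \<cdot> z) u"
      using z f'(3)[of "pairing V z u"] by (simp add: Hom_iff)
  qed (simp_all add: Hom_iff)
  have sh: "Src \<M> \<cdot> (?h1 \<cdot> p) = ?h0 \<cdot> (Src \<Z> \<cdot> p)" "Tgt \<M> \<cdot> (?h1 \<cdot> p) = ?h0 \<cdot> (Tgt \<Z> \<cdot> p)"
    if "p \<in> Hom V Z (Ar \<Z>)" for p Z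
    using comp_cong_right[OF \<open>Src \<M> \<cdot> ?h1 = ?h0 \<cdot> Src \<Z>\<close>, of p]
      comp_cong_right[OF \<open>Tgt \<M> \<cdot> ?h1 = ?h0 \<cdot> Tgt \<Z>\<close>, of p] that by (simp_all add: Hom_iff)
  fix Z p q assume pq: "p \<in> Hom V Z (Ar \<Z>)" "q \<in> Hom V Z (Ar \<Z>)" "Tgt \<Z> \<cdot> p = Src \<Z> \<cdot> q"
  have hpq: "?h1 \<cdot> p \<in> Hom V Z (exponent V X (Ar \<A>))" "?h1 \<cdot> q \<in> Hom V Z (exponent V X (Ar \<A>))"
    "Tgt \<M> \<cdot> (?h1 \<cdot> p) = Src \<M> \<cdot> (?h1 \<cdot> q)"
    using pq sh(1)[OF pq(2)] sh(2)[OF pq(1)] by (simp_all add: Hom_iff)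
  show "?h1 \<cdot> icomp V \<Z> p q = icomp V \<M> (?h1 \<cdot> p) (?h1 \<cdot> q)"
  proof (rule exponent_ext[OF ex(2) _ icomp_power_Hom[OF hpq]])
    fix W z u assume z: "z \<in> Hom V W Z" "u \<in> Hom V W X"
    let ?p = "pairing V (p \<cdot> z) u" and ?q = "pairing V (q \<cdot> z) u"
    have tpq: "Tgt \<Z> \<cdot> (p \<cdot> z) = Src \<Z> \<cdot> (q \<cdot> z)"
      using Q.A.Tgt_Src_comp[OF pq(3), of z] pq z by (simp add: Hom_iff)
    have PQ: "?p \<in> Hom V W (product V (Ar \<Z>) (Ar (cst V X)))" "?q \<in> Hom V W (product V (Ar \<Z>) (Ar (cst V X)))"
      "Tgt Q.\<P> \<cdot> ?p = Src Q.\<P> \<cdot> ?q" using pq z tpq by (simp_all add: Hom_iff)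
    have "ev1 \<cdot> pairing V ((?h1 \<cdot> icomp V \<Z> p q) \<cdot> z) u
        = IAr f \<cdot> pairing V (icomp V \<Z> (p \<cdot> z) (q \<cdot> z)) u"
      using pq z tpq by (simp add: Hom_iff Q.A.icomp_comp)
    also have "\<dots> = IAr f \<cdot> icomp V Q.\<P> ?p ?q"
      unfolding Q.icomp_prod[OF PQ] using pq z tpq icomp_cst[OF z(2)] by (simp add: Hom_iff)
    also have "\<dots> = icomp V \<A> (IAr f \<cdot> ?p) (IAr f \<cdot> ?q)"
      by (rule Hom_Cat_icomp[OF f, of _ W]) (use PQ in simp_all)
    also have "\<dots> = ev1 \<cdot> pairing V (icomp V \<M> (?h1 \<cdot> p) (?h1 \<cdot> q) \<cdot> z) u"
      unfolding eval_icomp_power[OF hpq z] using pq z by (simp add: Hom_iff)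
    finally show "ev1 \<cdot> pairing V ((?h1 \<cdot> icomp V \<Z> p q) \<cdot> z) u
        = ev1 \<cdot> pairing V (icomp V \<M> (?h1 \<cdot> p) (?h1 \<cdot> q) \<cdot> z) u" .
  qed (use pq in \<open>simp add: Hom_iff\<close>)
qed

end

context ccc_with_pullbacks
begin

text \<open>The chosen product in \<open>Cat V\<close> is only isomorphic to the levelwise one; composing with the
  comparison functors moves an internal functor from one to the other.\<close>

lemma compare_Cat_product:
  assumes "internal_category V \<A>" "internal_category V \<B>"
  obtains u v where
    "u \<in> Hom (Cat V) (product (Cat V) \<A> \<B>) (prod_icat V \<A> \<B>)"
    "v \<in> Hom (Cat V) (prod_icat V \<A> \<B>) (product (Cat V) \<A> \<B>)"
    "v \<cdot>\<^bsub>Cat V\<^esub> u = Ident (Cat V) (product (Cat V) \<A> \<B>)"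
    "IOb u = pairing V (IOb (pr1 (Cat V) \<A> \<B>)) (IOb (pr2 (Cat V) \<A> \<B>))"
    "IAr u = pairing V (IAr (pr1 (Cat V) \<A> \<B>)) (IAr (pr2 (Cat V) \<A> \<B>))"
    "IOb (pr1 (Cat V) \<A> \<B>) \<cdot> IOb v = pr1 V (Ob \<A>) (Ob \<B>)"
    "IOb (pr2 (Cat V) \<A> \<B>) \<cdot> IOb v = pr2 V (Ob \<A>) (Ob \<B>)"
    "IAr (pr1 (Cat V) \<A> \<B>) \<cdot> IAr v = pr1 V (Ar \<A>) (Ar \<B>)"
    "IAr (pr2 (Cat V) \<A> \<B>) \<cdot> IAr v = pr2 V (Ar \<A>) (Ar \<B>)"
proof -
  interpret T: two_internal_categories V \<A> \<B> using assms by (rule two_internal)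
  interpret C: cartesian_category "Cat V" by (rule cartesian_category_Cat)
  obtain u v where u: "u \<in> Hom (Cat V) (product (Cat V) \<A> \<B>) T.\<P>"
    and v: "v \<in> Hom (Cat V) T.\<P> (product (Cat V) \<A> \<B>)"
    and vu: "v \<cdot>\<^bsub>Cat V\<^esub> u = Ident (Cat V) (product (Cat V) \<A> \<B>)"
    and pu: "T.proj1 \<cdot>\<^bsub>Cat V\<^esub> u = pr1 (Cat V) \<A> \<B>" "T.proj2 \<cdot>\<^bsub>Cat V\<^esub> u = pr2 (Cat V) \<A> \<B>"
    and pv: "pr1 (Cat V) \<A> \<B> \<cdot>\<^bsub>Cat V\<^esub> v = T.proj1" "pr2 (Cat V) \<A> \<B> \<cdot>\<^bsub>Cat V\<^esub> v = T.proj2"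
    using C.compare_products[OF T.is_product_prod_icat] by blast
  have "IOb u = pairing V (IOb (pr1 (Cat V) \<A> \<B>)) (IOb (pr2 (Cat V) \<A> \<B>))"
    "IAr u = pairing V (IAr (pr1 (Cat V) \<A> \<B>)) (IAr (pr2 (Cat V) \<A> \<B>))"
    unfolding pu[symmetric] using Hom_CatD(1-6)[OF u]
    by (simp_all add: T.proj1_def T.proj2_def)
  moreover have "IOb (pr1 (Cat V) \<A> \<B>) \<cdot> IOb v = pr1 V (Ob \<A>) (Ob \<B>)"
    "IOb (pr2 (Cat V) \<A> \<B>) \<cdot> IOb v = pr2 V (Ob \<A>) (Ob \<B>)"
    "IAr (pr1 (Cat V) \<A> \<B>) \<cdot> IAr v = pr1 V (Ar \<A>) (Ar \<B>)"
    "IAr (pr2 (Cat V) \<A> \<B>) \<cdot> IAr v = pr2 V (Ar \<A>) (Ar \<B>)"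
    using arg_cong[OF pv(1), of IOb] arg_cong[OF pv(2), of IOb]
      arg_cong[OF pv(1), of IAr] arg_cong[OF pv(2), of IAr]
    by (simp_all add: T.proj1_def T.proj2_def)
  ultimately show ?thesis using that u v vu by blast
qed

lemma Cat_prod_map_pr:
  assumes "internal_category V \<A>" "internal_category V \<B>" "internal_category V \<Z>"
    "h \<in> Hom (Cat V) \<Z> \<A>"
  defines "m \<equiv> prod_map (Cat V) h (Ident (Cat V) \<B>)"
  shows "m \<in> Hom (Cat V) (product (Cat V) \<Z> \<B>) (product (Cat V) \<A> \<B>)"
    "IOb (pr1 (Cat V) \<A> \<B>) \<cdot> IOb m = IOb h \<cdot> IOb (pr1 (Cat V) \<Z> \<B>)"
    "IOb (pr2 (Cat V) \<A> \<B>) \<cdot> IOb m = IOb (pr2 (Cat V) \<Z> \<B>)"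
    "IAr (pr1 (Cat V) \<A> \<B>) \<cdot> IAr m = IAr h \<cdot> IAr (pr1 (Cat V) \<Z> \<B>)"
    "IAr (pr2 (Cat V) \<A> \<B>) \<cdot> IAr m = IAr (pr2 (Cat V) \<Z> \<B>)"
proof -
  interpret C: cartesian_category "Cat V" by (rule cartesian_category_Cat)
  have O: "\<A> \<in> Obj (Cat V)" "\<B> \<in> Obj (Cat V)" "\<Z> \<in> Obj (Cat V)" using assms by simp_all
  have h: "h \<in> Arr (Cat V)" "Dom (Cat V) h = \<Z>" "Cod (Cat V) h = \<A>"
    using assms(4) unfolding C.Hom_iff by blast+
  note p = C.pr_in_Hom[OF O(3,2)]
  have m: "m = pairing (Cat V) (h \<cdot>\<^bsub>Cat V\<^esub> pr1 (Cat V) \<Z> \<B>) (pr2 (Cat V) \<Z> \<B>)"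
    unfolding m_def C.prod_map_eq[OF h(1) C.ident_simps(1)[OF O(2)]] h(2) C.ident_simps(2)[OF O(2)]
      C.comp_ident_left[OF p(2)] ..
  note q = C.pairing_aux[OF C.comp_in_Hom[OF p(1) assms(4)] p(2)]
  show "m \<in> Hom (Cat V) (product (Cat V) \<Z> \<B>) (product (Cat V) \<A> \<B>)"
    unfolding m using q by blast
  have e: "pr1 (Cat V) \<A> \<B> \<cdot>\<^bsub>Cat V\<^esub> m = h \<cdot>\<^bsub>Cat V\<^esub> pr1 (Cat V) \<Z> \<B>"
    "pr2 (Cat V) \<A> \<B> \<cdot>\<^bsub>Cat V\<^esub> m = pr2 (Cat V) \<Z> \<B>"
    unfolding m using q by blast+
  show "IOb (pr1 (Cat V) \<A> \<B>) \<cdot> IOb m = IOb h \<cdot> IOb (pr1 (Cat V) \<Z> \<B>)"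
    "IOb (pr2 (Cat V) \<A> \<B>) \<cdot> IOb m = IOb (pr2 (Cat V) \<Z> \<B>)"
    "IAr (pr1 (Cat V) \<A> \<B>) \<cdot> IAr m = IAr h \<cdot> IAr (pr1 (Cat V) \<Z> \<B>)"
    "IAr (pr2 (Cat V) \<A> \<B>) \<cdot> IAr m = IAr (pr2 (Cat V) \<Z> \<B>)"
    using arg_cong[OF e(1), of IOb] arg_cong[OF e(2), of IOb]
      arg_cong[OF e(1), of IAr] arg_cong[OF e(2), of IAr] by simp_all
qed

lemma pr_Cat_in_Hom:
  assumes "internal_category V \<A>" "internal_category V \<B>"
  shows "pr1 (Cat V) \<A> \<B> \<in> Hom (Cat V) (product (Cat V) \<A> \<B>) \<A>"
    "pr2 (Cat V) \<A> \<B> \<in> Hom (Cat V) (product (Cat V) \<A> \<B>) \<B>"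
    "internal_category V (product (Cat V) \<A> \<B>)"
proof -
  interpret C: cartesian_category "Cat V" by (rule cartesian_category_Cat)
  have O: "\<A> \<in> Obj (Cat V)" "\<B> \<in> Obj (Cat V)" using assms by simp_all
  show "pr1 (Cat V) \<A> \<B> \<in> Hom (Cat V) (product (Cat V) \<A> \<B>) \<A>"
    "pr2 (Cat V) \<A> \<B> \<in> Hom (Cat V) (product (Cat V) \<A> \<B>) \<B>"
    using C.pr_in_Hom[OF O] by blast+
  then show "internal_category V (product (Cat V) \<A> \<B>)" by (simp add: Hom_Cat)
qed

end

context internal_category_power
begin

lemma cst_icat: "internal_category V (cst V X)"
  by (rule internal_category_cst(1)[OF X_Obj])

abbreviation "\<pi>0 \<Z> \<equiv> IOb (pr1 (Cat V) \<Z> (cst V X))"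
abbreviation "\<rho>0 \<Z> \<equiv> IOb (pr2 (Cat V) \<Z> (cst V X))"
abbreviation "\<pi>1 \<Z> \<equiv> IAr (pr1 (Cat V) \<Z> (cst V X))"
abbreviation "\<rho>1 \<Z> \<equiv> IAr (pr2 (Cat V) \<Z> (cst V X))"

text \<open>An internal functor out of \<open>\<Z> \<times> cst X\<close> transposes on objects and on arrows separately. The value of the
evaluation on objects is recorded because it decides which elements of \<open>\<M>\<close> are the constant ones.\<close>

lemma power_is_exponential:
  obtains e where "is_exponential (Cat V) (cst V X) \<A> (\<M>, e)"
    "\<And>\<Z> h. h \<in> Hom (Cat V) \<Z> \<M> \<Longrightarrow>
      IOb (e \<cdot>\<^bsub>Cat V\<^esub> prod_map (Cat V) h (Ident (Cat V) (cst V X)))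
        = ev0 \<cdot> pairing V (IOb h \<cdot> \<pi>0 \<Z>) (\<rho>0 \<Z>)"
proof -
  interpret C: cartesian_category "Cat V" by (rule cartesian_category_Cat)
  let ?X = "cst V X"
  obtain u where u: "u \<in> Hom (Cat V) (product (Cat V) \<M> ?X) P.\<P>"
    "IOb u = pairing V (\<pi>0 \<M>) (\<rho>0 \<M>)" "IAr u = pairing V (\<pi>1 \<M>) (\<rho>1 \<M>)"
    using compare_Cat_product[OF internal_category_power cst_icat] by metis
  let ?e = "eval_functor \<cdot>\<^bsub>Cat V\<^esub> u"
  have e: "?e \<in> Hom (Cat V) (product (Cat V) \<M> ?X) \<A>"
    using u(1) eval_functor_in_Hom by (rule C.comp_in_Hom)
  note p = pr_Cat_in_Hom[OF internal_category_power cst_icat]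
  let ?m = "\<lambda>h. prod_map (Cat V) h (Ident (Cat V) ?X)"
  have em: "?e \<cdot>\<^bsub>Cat V\<^esub> ?m h \<in> Hom (Cat V) (product (Cat V) \<Z> ?X) \<A>"
    "IOb (?e \<cdot>\<^bsub>Cat V\<^esub> ?m h) = ev0 \<cdot> pairing V (IOb h \<cdot> \<pi>0 \<Z>) (\<rho>0 \<Z>)"
    "IAr (?e \<cdot>\<^bsub>Cat V\<^esub> ?m h) = ev1 \<cdot> pairing V (IAr h \<cdot> \<pi>1 \<Z>) (\<rho>1 \<Z>)"
    if h: "h \<in> Hom (Cat V) \<Z> \<M>" for \<Z> h
  proof -
    have Z: "internal_category V \<Z>" using h by (simp add: Hom_Cat)
    note m = Cat_prod_map_pr[OF internal_category_power cst_icat Z h]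
    note q = pr_Cat_in_Hom[OF Z cst_icat]
    note [simp] = Hom_CatD(1-6)[OF p(1), unfolded power_typing] Hom_CatD(1-6)[OF p(2), unfolded cst_sel]
      Hom_CatD(1-6)[OF q(1)] Hom_CatD(1-6)[OF q(2), unfolded cst_sel]
      Hom_CatD(1-6)[OF h, unfolded power_typing] Hom_CatD(1-6)[OF m(1)]
    show "?e \<cdot>\<^bsub>Cat V\<^esub> ?m h \<in> Hom (Cat V) (product (Cat V) \<Z> ?X) \<A>"
      using m(1) e by (rule C.comp_in_Hom)
    show "IOb (?e \<cdot>\<^bsub>Cat V\<^esub> ?m h) = ev0 \<cdot> pairing V (IOb h \<cdot> \<pi>0 \<Z>) (\<rho>0 \<Z>)"
      "IAr (?e \<cdot>\<^bsub>Cat V\<^esub> ?m h) = ev1 \<cdot> pairing V (IAr h \<cdot> \<pi>1 \<Z>) (\<rho>1 \<Z>)"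
      using m(2-5) u(2,3) by (simp_all add: eval_functor_def)
  qed
  have "is_exponential (Cat V) (cst V X) \<A> (\<M>, ?e)"
    unfolding is_exponential_def prod.case
  proof (intro conjI ballI)
    show "\<M> \<in> Obj (Cat V)" using internal_category_power by simp
    show "?e \<in> Hom (Cat V) (product (Cat V) \<M> (cst V X)) \<A>" by (rule e)
    fix \<Z> f assume "\<Z> \<in> Obj (Cat V)" and f: "f \<in> Hom (Cat V) (product (Cat V) \<Z> (cst V X)) \<A>"
    then have Z: "internal_category V \<Z>" by simp
    interpret Q: two_internal_categories V \<Z> "cst V X" using two_internal Z cst_icat by blast
    obtain u v where u: "u \<in> Hom (Cat V) (product (Cat V) \<Z> (cst V X)) Q.\<P>"
      and v: "v \<in> Hom (Cat V) Q.\<P> (product (Cat V) \<Z> (cst V X))"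
      and vu: "v \<cdot>\<^bsub>Cat V\<^esub> u = Ident (Cat V) (product (Cat V) \<Z> (cst V X))"
      and uc: "IOb u = pairing V (\<pi>0 \<Z>) (\<rho>0 \<Z>)" "IAr u = pairing V (\<pi>1 \<Z>) (\<rho>1 \<Z>)"
      and pv: "\<pi>0 \<Z> \<cdot> IOb v = pr1 V (Ob \<Z>) X" "\<rho>0 \<Z> \<cdot> IOb v = pr2 V (Ob \<Z>) X"
        "\<pi>1 \<Z> \<cdot> IAr v = pr1 V (Ar \<Z>) X" "\<rho>1 \<Z> \<cdot> IAr v = pr2 V (Ar \<Z>) X"
      using compare_Cat_product[OF Z cst_icat, unfolded cst_sel] by metis
    note q = pr_Cat_in_Hom[OF Z cst_icat]
    interpret PQ: elementwise_internal_category V "product (Cat V) \<Z> (cst V X)"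
      using q(3) by (rule elementwise)
    let ?f = "f \<cdot>\<^bsub>Cat V\<^esub> v"
    have f': "?f \<in> Hom (Cat V) Q.\<P> \<A>" using v f by (rule C.comp_in_Hom)
    let ?h = "\<lparr>IDom = \<Z>, ICod = \<M>, IOb = exp_transpose V (Ob \<Z>) X (IOb ?f),
      IAr = exp_transpose V (Ar \<Z>) X (IAr ?f)\<rparr>"
    have h: "?h \<in> Hom (Cat V) \<Z> \<M>" by (rule curry_functor_in_Hom[OF Z f'])
    note [simp] = Hom_CatD(1-6)[OF q(1)] Hom_CatD(1-6)[OF q(2), unfolded cst_sel]
      Hom_CatD(1-6)[OF f] Hom_CatD(1-6)[OF v, unfolded Q.prod_icat_sel cst_sel]
    have vu0: "IOb v \<cdot> pairing V (\<pi>0 \<Z>) (\<rho>0 \<Z>) = Ident V (Ob (product (Cat V) \<Z> (cst V X)))"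
      using arg_cong[OF vu, of IOb] uc by simp
    have vu1: "IAr v \<cdot> pairing V (\<pi>1 \<Z>) (\<rho>1 \<Z>) = Ident V (Ar (product (Cat V) \<Z> (cst V X)))"
      using arg_cong[OF vu, of IAr] uc by simp
    show "\<exists>!h. h \<in> Hom (Cat V) \<Z> \<M> \<and>
        ?e \<cdot>\<^bsub>Cat V\<^esub> ?m h = f"
    proof (rule ex1I[of _ ?h])
      have "?e \<cdot>\<^bsub>Cat V\<^esub> ?m ?h = f"
        by (rule ifun_eqI[OF _ f]) (use em[OF h] vu0 vu1 in \<open>simp_all\<close>)
      then show "?h \<in> Hom (Cat V) \<Z> \<M> \<and>
          ?e \<cdot>\<^bsub>Cat V\<^esub> ?m ?h = f" using h by blast
      fix k assume k: "k \<in> Hom (Cat V) \<Z> \<M> \<and>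
          ?e \<cdot>\<^bsub>Cat V\<^esub> ?m k = f"
      then have k': "k \<in> Hom (Cat V) \<Z> \<M>" by blast
      note [simp] = Hom_CatD(1-6)[OF k', unfolded power_typing]
      have e0: "IOb f = ev0 \<cdot> pairing V (IOb k \<cdot> \<pi>0 \<Z>) (\<rho>0 \<Z>)"
        and e1: "IAr f = ev1 \<cdot> pairing V (IAr k \<cdot> \<pi>1 \<Z>) (\<rho>1 \<Z>)"
        using em[OF k'] k by simp_all
      have f0: "IOb f \<cdot> IOb v = ev0 \<cdot> pairing V (IOb k \<cdot> pr1 V (Ob \<Z>) X) (pr2 V (Ob \<Z>) X)"
        unfolding e0 using pv by simp
      have f1: "IAr f \<cdot> IAr v = ev1 \<cdot> pairing V (IAr k \<cdot> pr1 V (Ar \<Z>) X) (pr2 V (Ar \<Z>) X)"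
        unfolding e1 using pv by simp
      show "k = ?h"
      proof (rule ifun_eqI[OF k' h])
        show "IOb k = IOb ?h"
          by (rule exponent_eqI[of X "Ob \<A>" _ "Ob \<Z>"]) (use f0 in \<open>simp_all add: Hom_iff\<close>)
        show "IAr k = IAr ?h"
          by (rule exponent_eqI[of X "Ar \<A>" _ "Ar \<Z>"]) (use f1 in \<open>simp_all add: Hom_iff\<close>)
      qed
    qed
  qed
  then show ?thesis using that em by blast
qed

text \<open>Internal homs are unique up to isomorphism, so the chosen one may be exchanged for the levelwise power.
The last equation says that the inclusion of the constant functions becomes the levelwise one.\<close>

lemma compare_exponent:
  defines "E \<equiv> exponent (Cat V) (cst V X) \<A>" and "K \<equiv> exp_const (Cat V) (cst V X) \<A>"
  obtains w w' where "w \<in> Hom (Cat V) E \<M>" "w' \<in> Hom (Cat V) \<M> E"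
    "w' \<cdot>\<^bsub>Cat V\<^esub> w = Ident (Cat V) E" "w \<cdot>\<^bsub>Cat V\<^esub> w' = Ident (Cat V) \<M>"
    "K \<in> Hom (Cat V) \<A> E"
    "\<And>Z z u. z \<in> Hom V Z (Ob \<A>) \<Longrightarrow> u \<in> Hom V Z X \<Longrightarrow> ev0 \<cdot> pairing V (IOb w \<cdot> (IOb K \<cdot> z)) u = z"
proof -
  interpret C: cartesian_category "Cat V" by (rule cartesian_category_Cat)
  have O: "cst V X \<in> Obj (Cat V)" "\<A> \<in> Obj (Cat V)"
    using cst_icat internal_category_axioms by simp_all
  have A: "internal_category V \<A>" by (rule internal_category_axioms)
  obtain e where e: "is_exponential (Cat V) (cst V X) \<A> (\<M>, e)"
    and em: "\<And>\<Z> h. h \<in> Hom (Cat V) \<Z> \<M> \<Longrightarrow>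
      IOb (e \<cdot>\<^bsub>Cat V\<^esub> prod_map (Cat V) h (Ident (Cat V) (cst V X)))
        = ev0 \<cdot> pairing V (IOb h \<cdot> \<pi>0 \<Z>) (\<rho>0 \<Z>)"
    using power_is_exponential by blast
  have eH: "e \<in> Hom (Cat V) (product (Cat V) \<M> (cst V X)) \<A>"
    using e unfolding is_exponential_def by blast
  have ex: "exponentiable (Cat V) (cst V X) \<A>" using e O unfolding exponentiable_def by blast
  obtain w where w: "w \<in> Hom (Cat V) E \<M>" "is_iso (Cat V) w"
    "e \<cdot>\<^bsub>Cat V\<^esub> prod_map (Cat V) w (Ident (Cat V) (cst V X)) = evalmap (Cat V) (cst V X) \<A>"
    using C.exponential_unique[OF e O] unfolding E_def by blast
  obtain w' where w': "w' \<in> Hom (Cat V) \<M> E" "w' \<cdot>\<^bsub>Cat V\<^esub> w = Ident (Cat V) E"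
    "w \<cdot>\<^bsub>Cat V\<^esub> w' = Ident (Cat V) \<M>" using C.is_isoE[OF w(2,1)] by metis
  note q = pr_Cat_in_Hom[OF A cst_icat]
  note K = C.eval_exp_const[OF ex q(1,2), folded K_def E_def]
  have E: "internal_category V E" using w(1) by (simp add: Hom_Cat)
  have wK: "w \<cdot>\<^bsub>Cat V\<^esub> K \<in> Hom (Cat V) \<A> \<M>" using K(1) w(1) by (rule C.comp_in_Hom)
  let ?I = "Ident (Cat V) (cst V X)"
  have I: "?I \<in> Hom (Cat V) (cst V X) (cst V X)" using O(1) by (rule C.ident_in_Hom)
  let ?mw = "prod_map (Cat V) w ?I" and ?mK = "prod_map (Cat V) K ?I"
  note mw = Cat_prod_map_pr[OF internal_category_power cst_icat E w(1)]
  note mK = Cat_prod_map_pr[OF E cst_icat A K(1)]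
  note mwK = Cat_prod_map_pr[OF internal_category_power cst_icat A wK]
  have pm: "pairing (Cat V) (h \<cdot>\<^bsub>Cat V\<^esub> pr1 (Cat V) \<A> (cst V X)) (pr2 (Cat V) \<A> (cst V X))
      = prod_map (Cat V) h ?I" if "h \<in> Hom (Cat V) \<A> \<B>" for h \<B>
  proof -
    have h: "h \<in> Arr (Cat V)" "Dom (Cat V) h = \<A>" using that unfolding C.Hom_iff by blast+
    show ?thesis
      unfolding C.prod_map_eq[OF h(1) C.ident_simps(1)[OF O(1)]] h(2) C.ident_simps(2)[OF O(1)]
        C.comp_ident_left[OF q(2)] ..
  qed
  have "prod_map (Cat V) (w \<cdot>\<^bsub>Cat V\<^esub> K) ?I = ?mw \<cdot>\<^bsub>Cat V\<^esub> ?mK"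
  proof -
    have a: "w \<in> Arr (Cat V)" "Dom (Cat V) w = E" "K \<in> Arr (Cat V)" "Cod (Cat V) K = E"
      "Dom (Cat V) K = \<A>" "E \<in> Obj (Cat V)"
      using w(1) K(1) unfolding C.Hom_iff by blast+
    show ?thesis using a O(1,2) by (simp del: Cat_sel add: C.prod_map_eq)
  qed
  then have "e \<cdot>\<^bsub>Cat V\<^esub> prod_map (Cat V) (w \<cdot>\<^bsub>Cat V\<^esub> K) ?I = evalmap (Cat V) (cst V X) \<A> \<cdot>\<^bsub>Cat V\<^esub> ?mK"
    using C.comp_assoc[OF mK(1) mw(1) eH] w(3) by simp
  also have "\<dots> = pr1 (Cat V) \<A> (cst V X)" using K(2) unfolding pm[OF K(1)] .
  finally have "IOb (e \<cdot>\<^bsub>Cat V\<^esub> prod_map (Cat V) (w \<cdot>\<^bsub>Cat V\<^esub> K) ?I) = \<pi>0 \<A>" by simp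
  then have base: "ev0 \<cdot> pairing V ((IOb w \<cdot> IOb K) \<cdot> \<pi>0 \<A>) (\<rho>0 \<A>) = \<pi>0 \<A>"
    unfolding em[OF wK] by simp
  interpret Q: two_internal_categories V \<A> "cst V X" using two_internal A cst_icat by blast
  obtain v where v: "v \<in> Hom (Cat V) Q.\<P> (product (Cat V) \<A> (cst V X))"
    and pv: "\<pi>0 \<A> \<cdot> IOb v = pr1 V (Ob \<A>) X" "\<rho>0 \<A> \<cdot> IOb v = pr2 V (Ob \<A>) X"
    using compare_Cat_product[OF A cst_icat, unfolded cst_sel] by metis
  note [simp] = Hom_CatD(1-6)[OF q(1)] Hom_CatD(1-6)[OF q(2), unfolded cst_sel]
    Hom_CatD(1-6)[OF K(1)] Hom_CatD(1-6)[OF w(1), unfolded power_typing]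
    Hom_CatD(1-6)[OF v, unfolded Q.prod_icat_sel cst_sel]
  have "ev0 \<cdot> pairing V (IOb w \<cdot> (IOb K \<cdot> z)) u = z" if z: "z \<in> Hom V Z (Ob \<A>)" "u \<in> Hom V Z X" for Z z u
  proof -
    have pz: "\<pi>0 \<A> \<cdot> (IOb v \<cdot> pairing V z u) = z" "\<rho>0 \<A> \<cdot> (IOb v \<cdot> pairing V z u) = u"
      using comp_cong_right[OF pv(1), of "pairing V z u"] comp_cong_right[OF pv(2), of "pairing V z u"] z
      by (simp_all add: Hom_iff)
    have "(ev0 \<cdot> pairing V ((IOb w \<cdot> IOb K) \<cdot> \<pi>0 \<A>) (\<rho>0 \<A>)) \<cdot> (IOb v \<cdot> pairing V z u)
        = \<pi>0 \<A> \<cdot> (IOb v \<cdot> pairing V z u)" using base by simp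
    then show ?thesis using z pz by (simp add: Hom_iff)
  qed
  then show ?thesis using that w(1) w' K(1) by blast
qed

end

context ccc_with_pullbacks
begin

text \<open>Elements of the pullback at a stage \<open>Z\<close> are the elements of \<open>W\<close> that lie over the point \<open>g\<close>, and an
object is terminal when it has one element at each stage.\<close>

lemma terminal_pullback_iff:
  assumes f: "f \<in> Hom V W Y" and g: "g \<in> Hom V (terminal V) Y"
  shows "is_iso V (bang V (pullback V f g)) \<longleftrightarrow>
    (\<forall>Z\<in>Obj V. \<exists>!h. h \<in> Hom V Z W \<and> f \<cdot> h = g \<cdot> bang V Z)"
proof -
  let ?P = "pullback V f g" and ?p = "pb1 V f g" and ?q = "pb2 V f g"
  have fg [simp]: "f \<in> Arr V" "Dom V f = W" "Cod V f = Y" "g \<in> Arr V" "Dom V g = terminal V" "Cod V g = Y"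
    using f g by (simp_all add: Hom_iff)
  have q: "?q = bang V ?P" by (rule bang_unique) (simp add: Hom_iff)
  have comm: "f \<cdot> ?p = g \<cdot> bang V ?P" using pb_commutes[of f g] q by simp
  show ?thesis
  proof
    assume iso: "is_iso V (bang V ?P)"
    then obtain k where k: "k \<in> Hom V (terminal V) ?P" "k \<cdot> bang V ?P = Ident V ?P"
      using is_isoE[OF iso, of ?P "terminal V"] by (auto simp: Hom_iff)
    show "\<forall>Z\<in>Obj V. \<exists>!h. h \<in> Hom V Z W \<and> f \<cdot> h = g \<cdot> bang V Z"
    proof (intro ballI ex1I conjI)
      fix Z assume Z: "Z \<in> Obj V"
      show "?p \<cdot> (k \<cdot> bang V Z) \<in> Hom V Z W" using k Z f by (simp add: Hom_iff)
      show "f \<cdot> (?p \<cdot> (k \<cdot> bang V Z)) = g \<cdot> bang V Z"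
        using comp_cong_right[OF comm, of "k \<cdot> bang V Z"] k Z by (simp add: Hom_iff)
      fix h assume h: "h \<in> Hom V Z W \<and> f \<cdot> h = g \<cdot> bang V Z"
      let ?l = "pb_lift V f g h (bang V Z)"
      have l: "?l \<in> Hom V Z ?P" "?p \<cdot> ?l = h" using h Z by (simp_all add: Hom_iff)
      have "?l = (k \<cdot> bang V ?P) \<cdot> ?l" using l k by (simp add: Hom_iff)
      also have "\<dots> = k \<cdot> bang V Z" using l(1) k(1) by (simp add: Hom_iff)
      finally show "h = ?p \<cdot> (k \<cdot> bang V Z)" using l by simp
    qed
  next
    assume u: "\<forall>Z\<in>Obj V. \<exists>!h. h \<in> Hom V Z W \<and> f \<cdot> h = g \<cdot> bang V Z"
    obtain h where h: "h \<in> Hom V (terminal V) W" "f \<cdot> h = g \<cdot> bang V (terminal V)"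
      using u terminal_Obj by blast
    let ?k = "pb_lift V f g h (Ident V (terminal V))"
    have k: "?k \<in> Hom V (terminal V) ?P" "?p \<cdot> ?k = h" "?q \<cdot> ?k = Ident V (terminal V)"
      using h by (simp_all add: Hom_iff)
    have fh: "f \<cdot> (h \<cdot> bang V ?P) = g \<cdot> bang V ?P"
      using comp_cong_right[OF h(2), of "bang V ?P"] h(1) by (simp add: Hom_iff)
    have "?k \<cdot> bang V ?P = Ident V ?P"
    proof (rule pullback_eqI[of f g _ ?P])
      have "h \<cdot> bang V ?P = ?p"
      proof -
        have "\<exists>!m. m \<in> Hom V ?P W \<and> f \<cdot> m = g \<cdot> bang V ?P"
          using bspec[OF u, of ?P] by simp
        moreover have "h \<cdot> bang V ?P \<in> Hom V ?P W" "?p \<in> Hom V ?P W"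
          using h(1) by (simp_all add: Hom_iff)
        ultimately show ?thesis using fh comm by blast
      qed
      then show "?p \<cdot> (?k \<cdot> bang V ?P) = ?p \<cdot> Ident V ?P"
        using comp_cong_right[OF k(2), of "bang V ?P"] k(1) by (simp add: Hom_iff)
      show "?q \<cdot> (?k \<cdot> bang V ?P) = ?q \<cdot> Ident V ?P"
        by (rule terminal_unique[of _ ?P]) (use k(1) in \<open>simp_all add: Hom_iff\<close>)
    qed (use k in \<open>simp_all add: Hom_iff\<close>)
    moreover have "bang V ?P \<cdot> ?k = Ident V (terminal V)"
      using k(1) by (simp add: Hom_iff)
    ultimately show "is_iso V (bang V ?P)"
      using k(1) by (intro is_isoI[of _ ?P "terminal V" ?k]) (simp_all add: Hom_iff)
  qed
qed

end

lemma ex1_transfer: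
  assumes "bij_betw \<Phi> S T" "\<And>h. h \<in> S \<Longrightarrow> A h \<longleftrightarrow> B (\<Phi> h)"
  shows "(\<exists>!h. h \<in> S \<and> A h) \<longleftrightarrow> (\<exists>!k. k \<in> T \<and> B k)"
proof -
  have inj: "inj_on \<Phi> S" and img: "T = \<Phi> ` S" using assms(1) by (auto simp: bij_betw_def)
  show ?thesis
    unfolding img Ex1_def using inj assms(2) by (simp add: Bex_def[symmetric] inj_on_def) blast
qed

context internal_category_power
begin

text \<open>Replace the internal hom by the levelwise power and transpose: arrows of the power at the stage \<open>Z\<close> are
arrows of \<open>\<A>\<close> at the stage \<open>Z \<times> X\<close>, and points of its object of objects are arrows \<open>X \<rightarrow> Ob \<A>\<close>.\<close>

lemma v_terminal_exponent_iff:
  assumes y: "y \<in> Hom V (terminal V) (Ob \<A>)"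
  shows "v_terminal V (Und V (exponent (Cat V) (cst V X) \<A>))
      (IOb (exp_const (Cat V) (cst V X) \<A>) \<cdot> y) \<longleftrightarrow>
    (\<forall>a\<in>Hom V X (Ob \<A>). \<forall>Z\<in>Obj V. \<exists>!k. k \<in> Hom V (product V Z X) (Ar \<A>) \<and>
      Src \<A> \<cdot> k = a \<cdot> pr2 V Z X \<and> Tgt \<A> \<cdot> k = y \<cdot> bang V (product V Z X))"
proof -
  let ?E = "exponent (Cat V) (cst V X) \<A>" and ?K = "exp_const (Cat V) (cst V X) \<A>"
  obtain w w' where w: "w \<in> Hom (Cat V) ?E \<M>" and w': "w' \<in> Hom (Cat V) \<M> ?E"
    and ww: "w' \<cdot>\<^bsub>Cat V\<^esub> w = Ident (Cat V) ?E" "w \<cdot>\<^bsub>Cat V\<^esub> w' = Ident (Cat V) \<M>"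
    and K: "?K \<in> Hom (Cat V) \<A> ?E"
    and wK: "\<And>Z z u. z \<in> Hom V Z (Ob \<A>) \<Longrightarrow> u \<in> Hom V Z X \<Longrightarrow>
      ev0 \<cdot> pairing V (IOb w \<cdot> (IOb ?K \<cdot> z)) u = z"
    using compare_exponent by blast
  have E: "internal_category V ?E" using w by (simp add: Hom_Cat)
  interpret E: elementwise_internal_category V ?E using E by (rule elementwise)
  note [simp] = Hom_CatD(1-6)[OF w, unfolded power_typing] Hom_CatD(1-6)[OF w', unfolded power_typing]
    Hom_CatD(1-6)[OF K]
  note sw = Hom_CatD_comp[OF w]
  have w0: "IOb w' \<cdot> IOb w = Ident V (Ob ?E)" "IOb w \<cdot> IOb w' = Ident V (exponent V X (Ob \<A>))"
    and w1: "IAr w' \<cdot> IAr w = Ident V (Ar ?E)" "IAr w \<cdot> IAr w' = Ident V (exponent V X (Ar \<A>))"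
    using arg_cong[OF ww(1), of IOb] arg_cong[OF ww(2), of IOb]
      arg_cong[OF ww(1), of IAr] arg_cong[OF ww(2), of IAr] by simp_all
  have ww0: "IOb w' \<cdot> (IOb w \<cdot> z) = z" if "z \<in> Hom V Z (Ob ?E)" for z Z
    using comp_cong_right[OF w0(1), of z] that by (simp add: Hom_iff)
  have ww0': "IOb w \<cdot> (IOb w' \<cdot> z) = z" if "z \<in> Hom V Z (exponent V X (Ob \<A>))" for z Z
    using comp_cong_right[OF w0(2), of z] that by (simp add: Hom_iff)
  have ww1: "IAr w' \<cdot> (IAr w \<cdot> z) = z" if "z \<in> Hom V Z (Ar ?E)" for z Z
    using comp_cong_right[OF w1(1), of z] that by (simp add: Hom_iff)
  have ww1': "IAr w \<cdot> (IAr w' \<cdot> z) = z" if "z \<in> Hom V Z (exponent V X (Ar \<A>))" for z Z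
    using comp_cong_right[OF w1(2), of z] that by (simp add: Hom_iff)
  have y' [simp]: "y \<in> Arr V" "Dom V y = terminal V" "Cod V y = Ob \<A>" using y by (simp_all add: Hom_iff)
  let ?\<tau> = "IOb ?K \<cdot> y"
  \<comment> \<open>the transposition of arrows at the stage \<open>Z\<close>, and below that of points\<close>
  define \<Phi> where "\<Phi> Z h = ev1 \<cdot> pairing V (IAr w \<cdot> (h \<cdot> pr1 V Z X)) (pr2 V Z X)" for Z h
  define flat where "flat a = ev0 \<cdot> pairing V (IOb w \<cdot> (a \<cdot> bang V X)) (Ident V X)" for a
  have bij: "bij_betw (\<Phi> Z) (Hom V Z (Ar ?E)) (Hom V (product V Z X) (Ar \<A>))" if Z: "Z \<in> Obj V" for Z
  proof (rule bij_betwI[where g = "\<lambda>k. IAr w' \<cdot> exp_transpose V Z X k"])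
    show "\<Phi> Z \<in> Hom V Z (Ar ?E) \<rightarrow> Hom V (product V Z X) (Ar \<A>)"
      using Z by (auto simp: \<Phi>_def Hom_iff)
    show "(\<lambda>k. IAr w' \<cdot> exp_transpose V Z X k) \<in> Hom V (product V Z X) (Ar \<A>) \<rightarrow> Hom V Z (Ar ?E)"
      using Z by (auto simp: Hom_iff)
    fix k assume k: "k \<in> Hom V (product V Z X) (Ar \<A>)"
    have t: "exp_transpose V Z X k \<cdot> pr1 V Z X \<in> Hom V (product V Z X) (exponent V X (Ar \<A>))"
      using k Z by (auto simp: Hom_iff)
    show "\<Phi> Z (IAr w' \<cdot> exp_transpose V Z X k) = k"
      unfolding \<Phi>_def using ww1'[OF t] k Z by (simp add: Hom_iff)
  next
    fix h assume h: "h \<in> Hom V Z (Ar ?E)"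
    have "exp_transpose V Z X (\<Phi> Z h) = IAr w \<cdot> h"
      by (rule exponent_eqI[of X "Ar \<A>" _ Z])
         (use h Z in \<open>auto simp: \<Phi>_def Hom_iff\<close>)
    then show "IAr w' \<cdot> exp_transpose V Z X (\<Phi> Z h) = h" using ww1[OF h] by simp
  qed
  have src: "Src \<A> \<cdot> \<Phi> Z h = ev0 \<cdot> pairing V (IOb w \<cdot> (Src ?E \<cdot> h) \<cdot> pr1 V Z X) (pr2 V Z X)"
    and tgt: "Tgt \<A> \<cdot> \<Phi> Z h = ev0 \<cdot> pairing V (IOb w \<cdot> (Tgt ?E \<cdot> h) \<cdot> pr1 V Z X) (pr2 V Z X)"
    if h: "h \<in> Hom V Z (Ar ?E)" for Z h
    unfolding \<Phi>_def
    using h sw(1)[of "h \<cdot> pr1 V Z X"] sw(2)[of "h \<cdot> pr1 V Z X"]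
      power_eval(1)[of "pr2 V Z X" "IAr w \<cdot> (h \<cdot> pr1 V Z X)"]
      power_eval(2)[of "pr2 V Z X" "IAr w \<cdot> (h \<cdot> pr1 V Z X)"]
    by (simp_all add: Hom_iff del: power_eval)
  \<comment> \<open>Being constant at a point \<open>b\<close> can be tested after transposition, which is injective.\<close>
  have point: "f = b \<cdot> bang V Z \<longleftrightarrow>
      ev0 \<cdot> pairing V (IOb w \<cdot> f \<cdot> pr1 V Z X) (pr2 V Z X)
        = ev0 \<cdot> pairing V (IOb w \<cdot> b \<cdot> bang V (product V Z X)) (pr2 V Z X)"
    if f: "f \<in> Hom V Z (Ob ?E)" and b: "b \<in> Hom V (terminal V) (Ob ?E)" for Z f b
  proof
    assume "f = b \<cdot> bang V Z"
    then show "ev0 \<cdot> pairing V (IOb w \<cdot> f \<cdot> pr1 V Z X) (pr2 V Z X)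
        = ev0 \<cdot> pairing V (IOb w \<cdot> b \<cdot> bang V (product V Z X)) (pr2 V Z X)"
      using f b by (simp add: Hom_iff)
  next
    assume e: "ev0 \<cdot> pairing V (IOb w \<cdot> f \<cdot> pr1 V Z X) (pr2 V Z X)
        = ev0 \<cdot> pairing V (IOb w \<cdot> b \<cdot> bang V (product V Z X)) (pr2 V Z X)"
    have "IOb w \<cdot> f = IOb w \<cdot> (b \<cdot> bang V Z)"
      by (rule exponent_eqI[of X "Ob \<A>" _ Z]) (use e f b in \<open>simp_all add: Hom_iff\<close>)
    then have "IOb w' \<cdot> (IOb w \<cdot> f) = IOb w' \<cdot> (IOb w \<cdot> (b \<cdot> bang V Z))" by simp
    then show "f = b \<cdot> bang V Z"
      using ww0[OF f] ww0[of "b \<cdot> bang V Z" Z] f b by (simp add: Hom_iff)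
  qed
  have hom_iff: "(\<exists>!h. h \<in> Hom V Z (Ar ?E) \<and>
        pairing V (Src ?E) (Tgt ?E) \<cdot> h = pairing V a ?\<tau> \<cdot> bang V Z) \<longleftrightarrow>
      (\<exists>!k. k \<in> Hom V (product V Z X) (Ar \<A>) \<and>
        Src \<A> \<cdot> k = flat a \<cdot> pr2 V Z X \<and> Tgt \<A> \<cdot> k = y \<cdot> bang V (product V Z X))"
    if Z: "Z \<in> Obj V" and a: "a \<in> Hom V (terminal V) (Ob ?E)" for Z a
  proof (rule ex1_transfer[OF bij[OF Z]])
    fix h assume h: "h \<in> Hom V Z (Ar ?E)"
    have \<tau>: "?\<tau> \<in> Hom V (terminal V) (Ob ?E)" by (simp add: Hom_iff)
    have "pairing V (Src ?E) (Tgt ?E) \<cdot> h = pairing V a ?\<tau> \<cdot> bang V Z \<longleftrightarrow>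
        pairing V (Src ?E \<cdot> h) (Tgt ?E \<cdot> h) = pairing V (a \<cdot> bang V Z) (?\<tau> \<cdot> bang V Z)"
      using h a Z by (simp add: Hom_iff)
    also have "\<dots> \<longleftrightarrow> Src ?E \<cdot> h = a \<cdot> bang V Z \<and> Tgt ?E \<cdot> h = ?\<tau> \<cdot> bang V Z"
      using pairing_inject[of "Src ?E \<cdot> h" "Tgt ?E \<cdot> h" "a \<cdot> bang V Z" "?\<tau> \<cdot> bang V Z" Z "Ob ?E" "Ob ?E"]
        h a Z by (auto simp: Hom_iff)
    also have "\<dots> \<longleftrightarrow> Src \<A> \<cdot> \<Phi> Z h = flat a \<cdot> pr2 V Z X \<and> Tgt \<A> \<cdot> \<Phi> Z h = y \<cdot> bang V (product V Z X)"
    proof -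
      have sh: "Src ?E \<cdot> h \<in> Hom V Z (Ob ?E)" "Tgt ?E \<cdot> h \<in> Hom V Z (Ob ?E)"
        using h by (simp_all add: Hom_iff)
      have "flat a \<cdot> pr2 V Z X = ev0 \<cdot> pairing V (IOb w \<cdot> a \<cdot> bang V (product V Z X)) (pr2 V Z X)"
        unfolding flat_def using a Z by (simp add: Hom_iff)
      moreover have "y \<cdot> bang V (product V Z X)
          = ev0 \<cdot> pairing V (IOb w \<cdot> ?\<tau> \<cdot> bang V (product V Z X)) (pr2 V Z X)"
        using wK[of "y \<cdot> bang V (product V Z X)" "product V Z X" "pr2 V Z X"] Z
        by (simp add: Hom_iff)
      ultimately show ?thesis
        unfolding src[OF h] tgt[OF h] point[OF sh(1) a] point[OF sh(2) \<tau>] by simp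
    qed
    finally show "pairing V (Src ?E) (Tgt ?E) \<cdot> h = pairing V a ?\<tau> \<cdot> bang V Z \<longleftrightarrow>
        Src \<A> \<cdot> \<Phi> Z h = flat a \<cdot> pr2 V Z X \<and> Tgt \<A> \<cdot> \<Phi> Z h = y \<cdot> bang V (product V Z X)" .
  qed
  have flat_image: "flat ` Hom V (terminal V) (Ob ?E) = Hom V X (Ob \<A>)"
  proof (intro equalityI subsetI)
    fix b assume "b \<in> flat ` Hom V (terminal V) (Ob ?E)"
    then show "b \<in> Hom V X (Ob \<A>)" by (auto simp: flat_def Hom_iff)
  next
    fix b assume b: "b \<in> Hom V X (Ob \<A>)"
    let ?t = "exp_transpose V (terminal V) X (b \<cdot> pr2 V (terminal V) X)"
    have t: "?t \<in> Hom V (terminal V) (exponent V X (Ob \<A>))" using b by (simp add: Hom_iff)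
    have "flat (IOb w' \<cdot> ?t) = b"
      unfolding flat_def using ww0'[of "?t \<cdot> bang V X" X] b t by (simp add: Hom_iff)
    moreover have "IOb w' \<cdot> ?t \<in> Hom V (terminal V) (Ob ?E)" using t by (simp add: Hom_iff)
    ultimately show "b \<in> flat ` Hom V (terminal V) (Ob ?E)" by (metis imageI)
  qed
  have "v_terminal V (Und V ?E) ?\<tau> \<longleftrightarrow>
      (\<forall>a\<in>Hom V (terminal V) (Ob ?E).
        is_iso V (bang V (pullback V (pairing V (Src ?E) (Tgt ?E)) (pairing V a ?\<tau>))))"
    by (simp add: v_terminal_def Und_def Let_def Hom_iff)
  also have "\<dots> \<longleftrightarrow> (\<forall>a\<in>Hom V (terminal V) (Ob ?E). \<forall>Z\<in>Obj V.
      \<exists>!h. h \<in> Hom V Z (Ar ?E) \<and> pairing V (Src ?E) (Tgt ?E) \<cdot> h = pairing V a ?\<tau> \<cdot> bang V Z)"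
  proof (rule ball_cong[OF refl])
    fix a assume a: "a \<in> Hom V (terminal V) (Ob ?E)"
    show "is_iso V (bang V (pullback V (pairing V (Src ?E) (Tgt ?E)) (pairing V a ?\<tau>))) \<longleftrightarrow>
      (\<forall>Z\<in>Obj V. \<exists>!h. h \<in> Hom V Z (Ar ?E) \<and>
        pairing V (Src ?E) (Tgt ?E) \<cdot> h = pairing V a ?\<tau> \<cdot> bang V Z)"
      by (rule terminal_pullback_iff[of _ _ "product V (Ob ?E) (Ob ?E)"])
         (use a in \<open>simp_all add: Hom_iff\<close>)
  qed
  also have "\<dots> \<longleftrightarrow> (\<forall>a\<in>Hom V (terminal V) (Ob ?E). \<forall>Z\<in>Obj V.
      \<exists>!k. k \<in> Hom V (product V Z X) (Ar \<A>) \<and>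
        Src \<A> \<cdot> k = flat a \<cdot> pr2 V Z X \<and> Tgt \<A> \<cdot> k = y \<cdot> bang V (product V Z X))"
    using hom_iff by simp
  also have "\<dots> \<longleftrightarrow> (\<forall>a\<in>flat ` Hom V (terminal V) (Ob ?E). \<forall>Z\<in>Obj V.
      \<exists>!k. k \<in> Hom V (product V Z X) (Ar \<A>) \<and>
        Src \<A> \<cdot> k = a \<cdot> pr2 V Z X \<and> Tgt \<A> \<cdot> k = y \<cdot> bang V (product V Z X))"
    by blast
  finally show ?thesis unfolding flat_image .
qed

end

section \<open>Representability in terms of the action on the universal element\<close>

text \<open>Points of an internal hom \<open>[X, Y]\<close> correspond to arrows \<open>X \<rightarrow> Y\<close>; the two functions pass between them.\<close>

definition arrow_of :: "('o, 'a) cat \<Rightarrow> 'o \<Rightarrow> 'o \<Rightarrow> 'a \<Rightarrow> 'a" where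
  "arrow_of V X Y h = evalmap V X Y \<cdot>\<^bsub>V\<^esub> pairing V (h \<cdot>\<^bsub>V\<^esub> bang V X) (Ident V X)"

definition name_of :: "('o, 'a) cat \<Rightarrow> 'o \<Rightarrow> 'a \<Rightarrow> 'a" where
  "name_of V X f = exp_transpose V (terminal V) X (f \<cdot>\<^bsub>V\<^esub> pr2 V (terminal V) X)"

context ccc_with_pullbacks
begin

lemma arrow_of_Hom:
  assumes "h \<in> Hom V (terminal V) (exponent V X Y)" "X \<in> Obj V" "Y \<in> Obj V"
  shows "arrow_of V X Y h \<in> Hom V X Y"
  using assms by (simp add: arrow_of_def Hom_iff)

lemma eval_point:
  assumes "h \<in> Hom V (terminal V) (exponent V X Y)" "Y \<in> Obj V" "z \<in> Hom V Z (terminal V)"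
    "u \<in> Hom V Z X"
  shows "evalmap V X Y \<cdot> pairing V (h \<cdot> z) u = arrow_of V X Y h \<cdot> u"
  using assms bang_unique[OF assms(3)] by (simp add: arrow_of_def Hom_iff)

lemma eval_point':
  assumes "h \<in> Hom V (terminal V) (exponent V X Y)" "Y \<in> Obj V" "u \<in> Hom V (terminal V) X"
  shows "evalmap V X Y \<cdot> pairing V h u = arrow_of V X Y h \<cdot> u"
  using eval_point[OF assms(1,2) _ assms(3), of "Ident V (terminal V)"] assms(1)
  by (simp add: Hom_iff)

lemma name_of:
  assumes "f \<in> Hom V X Y"
  shows "name_of V X f \<in> Hom V (terminal V) (exponent V X Y)" "arrow_of V X Y (name_of V X f) = f"
  using assms by (simp_all add: name_of_def arrow_of_def Hom_iff)

lemma point_eqI: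
  assumes "h \<in> Hom V (terminal V) (exponent V X Y)" "k \<in> Hom V (terminal V) (exponent V X Y)"
    "X \<in> Obj V" "Y \<in> Obj V" "arrow_of V X Y h = arrow_of V X Y k"
  shows "h = k"
  by (rule exponent_ext[OF exponentiable_all[OF assms(3,4)] assms(1,2)])
     (use assms eval_point[OF assms(1,4)] eval_point[OF assms(2,4)] in auto)

lemma eval_self_comp:
  assumes "X \<in> Obj V" "Y \<in> Obj V" "T \<in> Obj V"
    "h \<in> Hom V Z (exponent V X Y)" "k \<in> Hom V Z (exponent V Y T)" "u \<in> Hom V Z X"
  shows "evalmap V X T \<cdot> pairing V (VComp (self_enriched V) X Y T \<cdot> pairing V h k) u
    = evalmap V Y T \<cdot> pairing V k (evalmap V X Y \<cdot> pairing V h u)"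
  using assms by (simp add: self_enriched_def Let_def Hom_iff)

lemma self_comp_Hom:
  assumes "X \<in> Obj V" "Y \<in> Obj V" "T \<in> Obj V"
  shows "VComp (self_enriched V) X Y T
    \<in> Hom V (product V (exponent V X Y) (exponent V Y T)) (exponent V X T)"
  using assms by (simp add: self_enriched_def Let_def Hom_iff)

lemma self_id:
  assumes "X \<in> Obj V"
  shows "VId (self_enriched V) X \<in> Hom V (terminal V) (exponent V X X)"
    "arrow_of V X X (VId (self_enriched V) X) = Ident V X"
  using assms by (simp_all add: self_enriched_def arrow_of_def Hom_iff)

lemma self_enriched_sel [simp]:
  "VObj (self_enriched V) = Obj V" "VHom (self_enriched V) = exponent V"
  by (simp_all add: self_enriched_def)

lemma arrow_of_comp:
  assumes "X \<in> Obj V" "Y \<in> Obj V" "T \<in> Obj V"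
    "h \<in> Hom V (terminal V) (exponent V X Y)" "k \<in> Hom V (terminal V) (exponent V Y T)"
  shows "arrow_of V X T (VComp (self_enriched V) X Y T \<cdot> pairing V h k)
    = arrow_of V Y T k \<cdot> arrow_of V X Y h"
proof -
  have b: "bang V X \<in> Hom V X (terminal V)" using assms(1) by (rule bang_in_Hom)
  have I: "Ident V X \<in> Hom V X X" using assms(1) by (rule ident_in_Hom)
  have hb: "h \<cdot> bang V X \<in> Hom V X (exponent V X Y)" "k \<cdot> bang V X \<in> Hom V X (exponent V Y T)"
    using assms b by (auto intro: comp_in_Hom)
  have c: "VComp (self_enriched V) X Y T \<cdot> pairing V h k \<in> Hom V (terminal V) (exponent V X T)"
    using self_comp_Hom[OF assms(1-3)] assms(4,5) by (simp add: Hom_iff)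
  have "arrow_of V X T (VComp (self_enriched V) X Y T \<cdot> pairing V h k)
      = evalmap V X T \<cdot> pairing V (VComp (self_enriched V) X Y T
          \<cdot> pairing V (h \<cdot> bang V X) (k \<cdot> bang V X)) (Ident V X)"
    using self_comp_Hom[OF assms(1-3)] assms by (simp add: arrow_of_def Hom_iff)
  also have "\<dots> = evalmap V Y T \<cdot> pairing V (k \<cdot> bang V X) (arrow_of V X Y h)"
    unfolding eval_self_comp[OF assms(1-3) hb I] arrow_of_def[of V X Y h] ..
  also have "\<dots> = arrow_of V Y T k \<cdot> arrow_of V X Y h"
    by (rule eval_point[OF assms(5,3) b arrow_of_Hom[OF assms(4,1,2)]])
  finally show ?thesis .
qed

end

text \<open>The typing part of a presheaf is what naturality of a transformation refers to; it can be verified for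
\<open>C(-, c)\<close> at once.\<close>

locale presheaf_data = ccc_with_pullbacks V + v_category V C
  for V :: "('o, 'a) cat" (structure) and C :: "('c, 'o, 'a) vcat" +
  fixes P :: "('c, 'o, 'a) vfun"
  assumes obj [simp]: "A \<in> VObj C \<Longrightarrow> VFObj P A \<in> Obj V"
    and hom: "A \<in> VObj C \<Longrightarrow> B \<in> VObj C \<Longrightarrow>
      VFHom P B A \<in> Hom V (VHom C A B) (exponent V (VFObj P B) (VFObj P A))"
begin

lemma hom_simps [simp]:
  assumes "A \<in> VObj C" "B \<in> VObj C"
  shows "VFHom P B A \<in> Arr V" "Dom V (VFHom P B A) = VHom C A B"
    "Cod V (VFHom P B A) = exponent V (VFObj P B) (VFObj P A)" "VHom C A B \<in> Obj V"
  using hom[OF assms] by (simp_all add: Hom_iff)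

lemma ev_simps [simp]:
  assumes "A \<in> VObj C" "B \<in> VObj C"
  shows "presheaf_ev V P A B \<in> Arr V"
    "Dom V (presheaf_ev V P A B) = product V (VHom C A B) (VFObj P B)"
    "Cod V (presheaf_ev V P A B) = VFObj P A"
  using assms by (simp_all add: presheaf_ev_def)

lemma eval_hom:
  assumes "A \<in> VObj C" "B \<in> VObj C" "f \<in> Hom V Z (VHom C A B)" "y \<in> Hom V Z (VFObj P B)"
  shows "evalmap V (VFObj P B) (VFObj P A) \<cdot> pairing V (VFHom P B A \<cdot> f) y
    = presheaf_ev V P A B \<cdot> pairing V f y"
  using assms by (simp add: presheaf_ev_def Hom_iff)

end

locale two_presheaf_data =
  P: presheaf_data V C P + Q: presheaf_data V C Q
  for V :: "('o, 'a) cat" (structure) and C :: "('c, 'o, 'a) vcat" and P Q :: "('c, 'o, 'a) vfun"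
begin

text \<open>Both sides of the naturality equation are arrows into an internal hom. Evaluated at an element \<open>u\<close> of
\<open>P A\<close> and an element \<open>f\<close> of the hom-object, they say that \<open>\<gamma>\<close> commutes with the action of \<open>f\<close>.\<close>

lemma naturality_iff:
  assumes A: "A \<in> VObj C" and B: "B \<in> VObj C"
    and gA: "\<gamma> A \<in> Hom V (terminal V) (exponent V (VFObj P A) (VFObj Q A))"
    and gB: "\<gamma> B \<in> Hom V (terminal V) (exponent V (VFObj P B) (VFObj Q B))"
  shows "VComp (self_enriched V) (VFObj P A) (VFObj P B) (VFObj Q B)
        \<cdot> pairing V (VFHom P A B) (\<gamma> B \<cdot> bang V (VHom C B A))
      = VComp (self_enriched V) (VFObj P A) (VFObj Q A) (VFObj Q B)
        \<cdot> pairing V (\<gamma> A \<cdot> bang V (VHom C B A)) (VFHom Q A B) \<longleftrightarrow>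
    (\<forall>Z f u. f \<in> Hom V Z (VHom C B A) \<longrightarrow> u \<in> Hom V Z (VFObj P A) \<longrightarrow>
      arrow_of V (VFObj P B) (VFObj Q B) (\<gamma> B) \<cdot> (presheaf_ev V P B A \<cdot> pairing V f u)
      = presheaf_ev V Q B A \<cdot> pairing V f (arrow_of V (VFObj P A) (VFObj Q A) (\<gamma> A) \<cdot> u))"
    (is "?l = ?r \<longleftrightarrow> ?R")
proof -
  let ?H = "VHom C B A" and ?b = "bang V (VHom C B A)"
  have o: "VFObj P A \<in> Obj V" "VFObj P B \<in> Obj V" "VFObj Q A \<in> Obj V" "VFObj Q B \<in> Obj V"
    using A B by simp_all
  have H: "?H \<in> Obj V" using A B by simp
  have lr: "?l \<in> Hom V ?H (exponent V (VFObj P A) (VFObj Q B))"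
    "?r \<in> Hom V ?H (exponent V (VFObj P A) (VFObj Q B))"
    using P.self_comp_Hom[OF o(1,2,4)] P.self_comp_Hom[OF o(1,3,4)] A B gA gB H
    by (simp_all add: P.Hom_iff)
  have el: "evalmap V (VFObj P A) (VFObj Q B) \<cdot> pairing V (?l \<cdot> f) u
      = arrow_of V (VFObj P B) (VFObj Q B) (\<gamma> B) \<cdot> (presheaf_ev V P B A \<cdot> pairing V f u)"
    and er: "evalmap V (VFObj P A) (VFObj Q B) \<cdot> pairing V (?r \<cdot> f) u
      = presheaf_ev V Q B A \<cdot> pairing V f (arrow_of V (VFObj P A) (VFObj Q A) (\<gamma> A) \<cdot> u)"
    if f: "f \<in> Hom V Z ?H" and u: "u \<in> Hom V Z (VFObj P A)" for Z f u
  proof -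
    have Z: "Z \<in> Obj V" using f by (simp add: P.Hom_iff)
    have b: "bang V Z \<in> Hom V Z (terminal V)" using Z by (rule P.bang_in_Hom)
    have pf: "VFHom P A B \<cdot> f \<in> Hom V Z (exponent V (VFObj P A) (VFObj P B))"
      "VFHom Q A B \<cdot> f \<in> Hom V Z (exponent V (VFObj Q A) (VFObj Q B))"
      "\<gamma> A \<cdot> bang V Z \<in> Hom V Z (exponent V (VFObj P A) (VFObj Q A))"
      "\<gamma> B \<cdot> bang V Z \<in> Hom V Z (exponent V (VFObj P B) (VFObj Q B))"
      using f A B b gA gB by (auto intro: P.comp_in_Hom P.hom Q.hom)
    have l: "?l \<cdot> f = VComp (self_enriched V) (VFObj P A) (VFObj P B) (VFObj Q B)
        \<cdot> pairing V (VFHom P A B \<cdot> f) (\<gamma> B \<cdot> bang V Z)"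
      using P.self_comp_Hom[OF o(1,2,4)] A B gB f by (simp add: P.Hom_iff)
    have r: "?r \<cdot> f = VComp (self_enriched V) (VFObj P A) (VFObj Q A) (VFObj Q B)
        \<cdot> pairing V (\<gamma> A \<cdot> bang V Z) (VFHom Q A B \<cdot> f)"
      using P.self_comp_Hom[OF o(1,3,4)] A B gA f by (simp add: P.Hom_iff)
    have pe: "presheaf_ev V P B A \<cdot> pairing V f u \<in> Hom V Z (VFObj P B)"
      using A B f u by (simp add: P.Hom_iff)
    have au: "arrow_of V (VFObj P A) (VFObj Q A) (\<gamma> A) \<cdot> u \<in> Hom V Z (VFObj Q A)"
      using u P.arrow_of_Hom[OF gA o(1,3)] by (rule P.comp_in_Hom)
    show "evalmap V (VFObj P A) (VFObj Q B) \<cdot> pairing V (?l \<cdot> f) u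
      = arrow_of V (VFObj P B) (VFObj Q B) (\<gamma> B) \<cdot> (presheaf_ev V P B A \<cdot> pairing V f u)"
      unfolding l P.eval_self_comp[OF o(1,2,4) pf(1,4) u] P.eval_hom[OF B A f u]
      by (rule P.eval_point[OF gB o(4) b pe])
    show "evalmap V (VFObj P A) (VFObj Q B) \<cdot> pairing V (?r \<cdot> f) u
      = presheaf_ev V Q B A \<cdot> pairing V f (arrow_of V (VFObj P A) (VFObj Q A) (\<gamma> A) \<cdot> u)"
      unfolding r P.eval_self_comp[OF o(1,3,4) pf(3,2) u] P.eval_point[OF gA o(3) b u]
      by (rule Q.eval_hom[OF B A f au])
  qed
  show ?thesis
  proof
    assume e: "?l = ?r"
    show ?R
    proof (intro allI impI)
      fix Z f u assume fu: "f \<in> Hom V Z ?H" "u \<in> Hom V Z (VFObj P A)"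
      show "arrow_of V (VFObj P B) (VFObj Q B) (\<gamma> B) \<cdot> (presheaf_ev V P B A \<cdot> pairing V f u)
          = presheaf_ev V Q B A \<cdot> pairing V f (arrow_of V (VFObj P A) (VFObj Q A) (\<gamma> A) \<cdot> u)"
        by (rule trans[OF el[OF fu, symmetric] trans[OF _ er[OF fu]]]) (simp only: e)
    qed
  next
    assume R: ?R
    show "?l = ?r"
    proof (rule P.exponent_ext[OF P.exponentiable_all[OF o(1,4)] lr])
      fix Z f u assume fu: "f \<in> Hom V Z ?H" "u \<in> Hom V Z (VFObj P A)"
      show "evalmap V (VFObj P A) (VFObj Q B) \<cdot> pairing V (?l \<cdot> f) u
          = evalmap V (VFObj P A) (VFObj Q B) \<cdot> pairing V (?r \<cdot> f) u"
        unfolding el[OF fu] er[OF fu] using R fu by blast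
    qed
  qed
qed

lemma v_natural_iff:
  "v_natural V (opposite V C) (self_enriched V) P Q \<gamma> \<longleftrightarrow>
    \<gamma> \<in> extensional (VObj C) \<and>
    (\<forall>A\<in>VObj C. \<gamma> A \<in> Hom V (terminal V) (exponent V (VFObj P A) (VFObj Q A))) \<and>
    (\<forall>A\<in>VObj C. \<forall>B\<in>VObj C. \<forall>Z f u. f \<in> Hom V Z (VHom C B A) \<longrightarrow> u \<in> Hom V Z (VFObj P A) \<longrightarrow>
      arrow_of V (VFObj P B) (VFObj Q B) (\<gamma> B) \<cdot> (presheaf_ev V P B A \<cdot> pairing V f u)
      = presheaf_ev V Q B A \<cdot> pairing V f (arrow_of V (VFObj P A) (VFObj Q A) (\<gamma> A) \<cdot> u))"
proof -
  have o: "VObj (opposite V C) = VObj C" "\<And>A B. VHom (opposite V C) A B = VHom C B A"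
    by (simp_all add: opposite_def)
  let ?typed = "\<forall>A\<in>VObj C. \<gamma> A \<in> Hom V (terminal V) (exponent V (VFObj P A) (VFObj Q A))"
  let ?nat = "\<lambda>A B. VComp (self_enriched V) (VFObj P A) (VFObj P B) (VFObj Q B)
        \<cdot> pairing V (VFHom P A B) (\<gamma> B \<cdot> bang V (VHom C B A))
      = VComp (self_enriched V) (VFObj P A) (VFObj Q A) (VFObj Q B)
        \<cdot> pairing V (\<gamma> A \<cdot> bang V (VHom C B A)) (VFHom Q A B)"
  let ?elt = "\<lambda>A B. \<forall>Z f u. f \<in> Hom V Z (VHom C B A) \<longrightarrow> u \<in> Hom V Z (VFObj P A) \<longrightarrow>
      arrow_of V (VFObj P B) (VFObj Q B) (\<gamma> B) \<cdot> (presheaf_ev V P B A \<cdot> pairing V f u)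
      = presheaf_ev V Q B A \<cdot> pairing V f (arrow_of V (VFObj P A) (VFObj Q A) (\<gamma> A) \<cdot> u)"
  have "v_natural V (opposite V C) (self_enriched V) P Q \<gamma> \<longleftrightarrow>
      \<gamma> \<in> extensional (VObj C) \<and> ?typed \<and> (\<forall>A\<in>VObj C. \<forall>B\<in>VObj C. ?nat A B)"
    unfolding v_natural_def o P.self_enriched_sel by (simp only: Ball_def imp_conjL) metis
  moreover have "(\<forall>A\<in>VObj C. \<forall>B\<in>VObj C. ?nat A B) \<longleftrightarrow> (\<forall>A\<in>VObj C. \<forall>B\<in>VObj C. ?elt A B)" if ?typed
    by (intro ball_cong refl naturality_iff) (use that in blast)+
  ultimately show ?thesis by (simp only: cong: conj_cong)
qed

end

locale enriched_presheaf = ccc_with_pullbacks V + v_category V C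
  for V :: "('o, 'a) cat" (structure) and C :: "('c, 'o, 'a) vcat" +
  fixes F :: "('c, 'o, 'a) vfun"
  assumes presheaf: "v_presheaf V C F"
begin

lemma F_functor: "v_functor V (opposite V C) (self_enriched V) F"
  using presheaf by (simp add: v_presheaf_def)

lemma opposite_sel [simp]:
  "VObj (opposite V C) = VObj C" "VHom (opposite V C) A B = VHom C B A"
  "VId (opposite V C) = VId C"
  by (simp_all add: opposite_def)

sublocale F: presheaf_data V C F
proof
  fix A B assume "A \<in> VObj C"
  then show "VFObj F A \<in> Obj V"
    using v_functor.vfobj_in_VObj[OF F_functor, of A] by simp
  assume "B \<in> VObj C"
  then show "VFHom F B A \<in> Hom V (VHom C A B) (exponent V (VFObj F B) (VFObj F A))"
    using v_functor.vfhom_in_Hom[OF F_functor, of B A] \<open>A \<in> VObj C\<close> by simp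
qed

lemma vcat_simps [simp]:
  assumes "A \<in> VObj C" "B \<in> VObj C" "D \<in> VObj C"
  shows "VComp C A B D \<in> Arr V" "Dom V (VComp C A B D) = product V (VHom C A B) (VHom C B D)"
    "Cod V (VComp C A B D) = VHom C A D"
  using vcomp_in_Hom[OF assms] by (simp_all add: Hom_iff)

lemma vid_simps [simp]:
  assumes "A \<in> VObj C"
  shows "VId C A \<in> Arr V" "Dom V (VId C A) = terminal V" "Cod V (VId C A) = VHom C A A"
  using vid_in_Hom[OF assms] by (simp_all add: Hom_iff)

lemma vcomp_id:
  assumes "A \<in> VObj C" "B \<in> VObj C" "f \<in> Hom V Z (VHom C A B)"
  shows "VComp C A A B \<cdot> pairing V (VId C A \<cdot> bang V Z) f = f"
    "VComp C A B B \<cdot> pairing V f (VId C B \<cdot> bang V Z) = f"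
  using comp_cong_right[OF vid_left[OF assms(1,2)], of f]
    comp_cong_right[OF vid_right[OF assms(1,2)], of f] assms by (simp_all add: Hom_iff)

lemma vcomp_assoc':
  assumes "A \<in> VObj C" "B \<in> VObj C" "D \<in> VObj C" "E \<in> VObj C"
    "f \<in> Hom V Z (VHom C A B)" "g \<in> Hom V Z (VHom C B D)" "h \<in> Hom V Z (VHom C D E)"
  shows "VComp C A D E \<cdot> pairing V (VComp C A B D \<cdot> pairing V f g) h
    = VComp C A B E \<cdot> pairing V f (VComp C B D E \<cdot> pairing V g h)"
  using comp_cong_right[OF vcomp_assoc[OF assms(1-4), unfolded Let_def], of "pairing V (pairing V f g) h"]
    assms by (simp add: Hom_iff)

lemma action_id:
  assumes "A \<in> VObj C" "y \<in> Hom V Z (VFObj F A)"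
  shows "presheaf_ev V F A A \<cdot> pairing V (VId C A \<cdot> bang V Z) y = y"
proof -
  have o: "VFObj F A \<in> Obj V" "Z \<in> Obj V" using assms by (auto simp: Hom_iff)
  have i: "VId C A \<cdot> bang V Z \<in> Hom V Z (VHom C A A)" using assms(1) o by (simp add: Hom_iff)
  have "VFHom F A A \<cdot> VId C A = VId (self_enriched V) (VFObj F A)"
    using v_functor.vfhom_vid[OF F_functor, of A] assms(1) by simp
  then have "VFHom F A A \<cdot> (VId C A \<cdot> bang V Z) = VId (self_enriched V) (VFObj F A) \<cdot> bang V Z"
    using comp_cong_right[of "VFHom F A A" "VId C A" _ "bang V Z"] assms(1) o by simp
  then have "presheaf_ev V F A A \<cdot> pairing V (VId C A \<cdot> bang V Z) y
      = evalmap V (VFObj F A) (VFObj F A) \<cdot> pairing V (VId (self_enriched V) (VFObj F A) \<cdot> bang V Z) y"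
    using F.eval_hom[OF assms(1,1) i assms(2)] by simp
  also have "\<dots> = y"
    using eval_point[OF self_id(1)[OF o(1)] o(1) bang_in_Hom[OF o(2)] assms(2)] self_id(2)[OF o(1)] assms(2)
    by (simp add: Hom_iff)
  finally show ?thesis .
qed

lemma action_comp:
  assumes "A \<in> VObj C" "B \<in> VObj C" "D \<in> VObj C"
    "f \<in> Hom V Z (VHom C A B)" "g \<in> Hom V Z (VHom C B D)" "y \<in> Hom V Z (VFObj F D)"
  shows "presheaf_ev V F A D \<cdot> pairing V (VComp C A B D \<cdot> pairing V f g) y
    = presheaf_ev V F A B \<cdot> pairing V f (presheaf_ev V F B D \<cdot> pairing V g y)"
proof -
  have o: "VFObj F A \<in> Obj V" "VFObj F B \<in> Obj V" "VFObj F D \<in> Obj V" using assms(1-3) by simp_all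
  let ?S = "VComp (self_enriched V) (VFObj F D) (VFObj F B) (VFObj F A)"
  have fg: "VComp C A B D \<cdot> pairing V f g \<in> Hom V Z (VHom C A D)"
    "VFHom F D B \<cdot> g \<in> Hom V Z (exponent V (VFObj F D) (VFObj F B))"
    "VFHom F B A \<cdot> f \<in> Hom V Z (exponent V (VFObj F B) (VFObj F A))"
    "presheaf_ev V F B D \<cdot> pairing V g y \<in> Hom V Z (VFObj F B)"
    using assms by (simp_all add: Hom_iff)
  have "VFHom F D A \<cdot> (VComp C A B D \<cdot> pairing V (pr2 V (VHom C B D) (VHom C A B)) (pr1 V (VHom C B D) (VHom C A B)))
      = ?S \<cdot> prod_map V (VFHom F D B) (VFHom F B A)"
    using v_functor.vfhom_vcomp[OF F_functor, of D B A] assms(1-3) by (simp add: opposite_def)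
  then have "(VFHom F D A \<cdot> (VComp C A B D \<cdot> pairing V (pr2 V (VHom C B D) (VHom C A B)) (pr1 V (VHom C B D) (VHom C A B))))
        \<cdot> pairing V g f
      = (?S \<cdot> prod_map V (VFHom F D B) (VFHom F B A)) \<cdot> pairing V g f" by simp
  then have e: "VFHom F D A \<cdot> (VComp C A B D \<cdot> pairing V f g)
      = ?S \<cdot> pairing V (VFHom F D B \<cdot> g) (VFHom F B A \<cdot> f)"
    using assms self_comp_Hom[OF o(3,2,1)] by (simp add: Hom_iff)
  show ?thesis
    unfolding F.eval_hom[OF assms(1,3) fg(1) assms(6), symmetric] e
      eval_self_comp[OF o(3,2,1) fg(2,3) assms(6)] F.eval_hom[OF assms(2,3,5,6)]
    by (rule F.eval_hom[OF assms(1,2,4) fg(4)])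
qed

end

text \<open>The component at \<open>A\<close> of the transformation that the Yoneda lemma assigns to an element \<open>x\<close> of
  \<open>F c\<close>: it lets an arrow \<open>A \<rightarrow> c\<close> act on \<open>x\<close>.\<close>

definition act_on :: "('o, 'a) cat \<Rightarrow> ('c, 'o, 'a) vcat \<Rightarrow> ('c, 'o, 'a) vfun \<Rightarrow> 'c \<Rightarrow> 'a \<Rightarrow> 'c \<Rightarrow> 'a" where
  "act_on V C F c x A = presheaf_ev V F A c
    \<cdot>\<^bsub>V\<^esub> pairing V (Ident V (VHom C A c)) (x \<cdot>\<^bsub>V\<^esub> bang V (VHom C A c))"

locale pointed_presheaf = enriched_presheaf V C F
  for V :: "('o, 'a) cat" (structure) and C :: "('c, 'o, 'a) vcat" and F :: "('c, 'o, 'a) vfun" +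
  fixes c :: 'c and x :: 'a
  assumes c [simp]: "c \<in> VObj C" and x: "x \<in> Hom V (terminal V) (VFObj F c)"
begin

abbreviation "\<alpha> \<equiv> act_on V C F c x"

lemma x_simps [simp]: "x \<in> Arr V" "Dom V x = terminal V" "Cod V x = VFObj F c"
  using x by (simp_all add: Hom_iff)

lemma act_on_Hom: "A \<in> VObj C \<Longrightarrow> \<alpha> A \<in> Hom V (VHom C A c) (VFObj F A)"
  by (simp add: act_on_def Hom_iff)

lemma act_on_comp:
  assumes "A \<in> VObj C" "f \<in> Hom V Z (VHom C A c)"
  shows "\<alpha> A \<cdot> f = presheaf_ev V F A c \<cdot> pairing V f (x \<cdot> bang V Z)"
  using assms by (simp add: act_on_def Hom_iff)

sublocale H: presheaf_data V C "hom_presheaf V C c"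
  by unfold_locales (simp_all add: hom_presheaf_def vhom_in_Obj Hom_iff)

lemma hom_obj: "VFObj (hom_presheaf V C c) A = VHom C A c"
  by (simp add: hom_presheaf_def)

lemma hom_ev:
  assumes "A \<in> VObj C" "B \<in> VObj C" "f \<in> Hom V Z (VHom C A B)" "u \<in> Hom V Z (VHom C B c)"
  shows "presheaf_ev V (hom_presheaf V C c) A B \<cdot> pairing V f u = VComp C A B c \<cdot> pairing V f u"
  using assms by (simp add: presheaf_ev_def hom_presheaf_def Hom_iff)

sublocale HF: two_presheaf_data V C "hom_presheaf V C c" F ..

sublocale FH: two_presheaf_data V C F "hom_presheaf V C c" ..

lemma act_on_natural:
  assumes "A \<in> VObj C" "B \<in> VObj C" "f \<in> Hom V Z (VHom C B A)" "u \<in> Hom V Z (VHom C A c)"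
  shows "\<alpha> B \<cdot> (VComp C B A c \<cdot> pairing V f u) = presheaf_ev V F B A \<cdot> pairing V f (\<alpha> A \<cdot> u)"
proof -
  have Z: "Z \<in> Obj V" using assms by (simp add: Hom_iff)
  have "VComp C B A c \<cdot> pairing V f u \<in> Hom V Z (VHom C B c)" "x \<cdot> bang V Z \<in> Hom V Z (VFObj F c)"
    using assms Z by (simp_all add: Hom_iff)
  then show ?thesis
    using act_on_comp[OF assms(1,4)] act_on_comp[OF assms(2), of "VComp C B A c \<cdot> pairing V f u" Z]
      action_comp[OF assms(2,1) c assms(3,4)] by simp
qed

text \<open>The Yoneda lemma: a natural transformation out of \<open>C(-, c)\<close> is determined by its value at the
  identity, since every arrow \<open>A \<rightarrow> c\<close> is its composite with the identity of \<open>c\<close>.\<close>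

lemma yoneda_transformation_eq:
  "yoneda_transformation V C F c x = (\<lambda>A\<in>VObj C. name_of V (VHom C A c) (\<alpha> A))" (is "_ = ?\<gamma>")
  and yoneda_natural: "v_natural V (opposite V C) (self_enriched V) (hom_presheaf V C c) F
    (\<lambda>A\<in>VObj C. name_of V (VHom C A c) (\<alpha> A))"
proof -
  let ?H = "hom_presheaf V C c"
  have g: "?\<gamma> A \<in> Hom V (terminal V) (exponent V (VHom C A c) (VFObj F A))"
    "arrow_of V (VHom C A c) (VFObj F A) (?\<gamma> A) = \<alpha> A" if "A \<in> VObj C" for A
    using name_of[OF act_on_Hom[OF that]] that by simp_all
  show nat: "v_natural V (opposite V C) (self_enriched V) ?H F ?\<gamma>"
    unfolding HF.v_natural_iff hom_obj
    using g act_on_natural hom_ev by (simp add: restrict_extensional)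
  have i: "VId C c \<in> Hom V (terminal V) (VHom C c c)" by (rule vid_in_Hom) simp
  have o: "VFObj F c \<in> Obj V" by simp
  have "yoneda_element V C F c ?\<gamma> = \<alpha> c \<cdot> VId C c"
    unfolding yoneda_element_def using eval_point'[OF g(1)[OF c] o i] g(2)[OF c] by simp
  also have "\<dots> = x"
    using act_on_comp[OF c i] action_id[OF c x] by simp
  finally have el: "yoneda_element V C F c ?\<gamma> = x" .
  show "yoneda_transformation V C F c x = ?\<gamma>"
    unfolding yoneda_transformation_def
  proof (rule the_equality)
    show "v_natural V (opposite V C) (self_enriched V) ?H F ?\<gamma> \<and> yoneda_element V C F c ?\<gamma> = x"
      using nat el by blast
    fix \<delta> assume d: "v_natural V (opposite V C) (self_enriched V) ?H F \<delta> \<and> yoneda_element V C F c \<delta> = x"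
    then have dE: "\<delta> \<in> extensional (VObj C)"
      and dH: "\<And>A. A \<in> VObj C \<Longrightarrow> \<delta> A \<in> Hom V (terminal V) (exponent V (VHom C A c) (VFObj F A))"
      and dN: "\<And>A B Z f u. A \<in> VObj C \<Longrightarrow> B \<in> VObj C \<Longrightarrow> f \<in> Hom V Z (VHom C B A) \<Longrightarrow>
        u \<in> Hom V Z (VHom C A c) \<Longrightarrow>
        arrow_of V (VHom C B c) (VFObj F B) (\<delta> B) \<cdot> (presheaf_ev V ?H B A \<cdot> pairing V f u)
        = presheaf_ev V F B A \<cdot> pairing V f (arrow_of V (VHom C A c) (VFObj F A) (\<delta> A) \<cdot> u)"
      unfolding HF.v_natural_iff hom_obj by blast+
    have dx: "arrow_of V (VHom C c c) (VFObj F c) (\<delta> c) \<cdot> VId C c = x"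
      using eval_point'[OF dH[OF c] o i] d by (simp add: yoneda_element_def)
    show "\<delta> = ?\<gamma>"
    proof (rule extensionalityI[OF dE restrict_extensional])
      fix A assume A: "A \<in> VObj C"
      have oA: "VHom C A c \<in> Obj V" "VFObj F A \<in> Obj V" using A by simp_all
      let ?I = "Ident V (VHom C A c)" and ?b = "bang V (VHom C A c)"
      have I: "?I \<in> Hom V (VHom C A c) (VHom C A c)" using oA by (simp add: Hom_iff)
      have ib: "VId C c \<cdot> ?b \<in> Hom V (VHom C A c) (VHom C c c)" using oA by (simp add: Hom_iff)
      let ?d = "arrow_of V (VHom C A c) (VFObj F A) (\<delta> A)"
      let ?dc = "arrow_of V (VHom C c c) (VFObj F c) (\<delta> c)"
      have dA: "?d \<in> Hom V (VHom C A c) (VFObj F A)" by (rule arrow_of_Hom[OF dH[OF A] oA])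
      have dc: "?dc \<in> Hom V (VHom C c c) (VFObj F c)" by (rule arrow_of_Hom[OF dH[OF c]]) simp_all
      have "?d = ?d \<cdot> (presheaf_ev V ?H A c \<cdot> pairing V ?I (VId C c \<cdot> ?b))"
        unfolding hom_ev[OF A c I ib] vcomp_id(2)[OF A c I] using dA by (simp add: Hom_iff)
      also have "\<dots> = presheaf_ev V F A c \<cdot> pairing V ?I (?dc \<cdot> (VId C c \<cdot> ?b))"
        by (rule dN[OF c A I ib])
      also have "?dc \<cdot> (VId C c \<cdot> ?b) = x \<cdot> ?b"
        using comp_cong_right[OF dx, of ?b] dc oA by (simp add: Hom_iff)
      also have "presheaf_ev V F A c \<cdot> pairing V ?I (x \<cdot> ?b) = \<alpha> A" by (simp add: act_on_def)
      finally show "\<delta> A = ?\<gamma> A"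
        using point_eqI[OF dH[OF A] g(1)[OF A] oA] g(2)[OF A] by simp
    qed
  qed
qed

text \<open>Composition in the self-enrichment of points of internal homs is composition of the arrows that they
name, so an inverse transformation has inverse components. Conversely, the inverses of the components of
a natural transformation are natural, by cancelling the components.\<close>

lemma representable_iff: "v_representable_by V C F c x \<longleftrightarrow> (\<forall>A\<in>VObj C. is_iso V (\<alpha> A))"
proof -
  let ?H = "hom_presheaf V C c"
  let ?\<gamma> = "\<lambda>A\<in>VObj C. name_of V (VHom C A c) (\<alpha> A)"
  have g: "?\<gamma> A \<in> Hom V (terminal V) (exponent V (VHom C A c) (VFObj F A))"
    "arrow_of V (VHom C A c) (VFObj F A) (?\<gamma> A) = \<alpha> A" if "A \<in> VObj C" for A
    using name_of[OF act_on_Hom[OF that]] that by simp_all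
  have inverse: "VComp (self_enriched V) X Y X \<cdot> pairing V h k = VId (self_enriched V) X
      \<longleftrightarrow> arrow_of V Y X k \<cdot> arrow_of V X Y h = Ident V X"
    if "h \<in> Hom V (terminal V) (exponent V X Y)" "k \<in> Hom V (terminal V) (exponent V Y X)"
      "X \<in> Obj V" "Y \<in> Obj V" for h k X Y
  proof -
    have c: "VComp (self_enriched V) X Y X \<cdot> pairing V h k \<in> Hom V (terminal V) (exponent V X X)"
      using self_comp_Hom[OF that(3,4,3)] that by (simp add: Hom_iff)
    show ?thesis
      using arrow_of_comp[OF that(3,4,3,1,2)] point_eqI[OF c self_id(1)[OF that(3)] that(3,3)]
        self_id(2)[OF that(3)] by auto
  qed
  let ?inv = "\<lambda>\<beta> A.
        VComp (self_enriched V) (VHom C A c) (VFObj F A) (VHom C A c) \<cdot> pairing V (?\<gamma> A) (\<beta> A)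
          = VId (self_enriched V) (VHom C A c) \<and>
        VComp (self_enriched V) (VFObj F A) (VHom C A c) (VFObj F A) \<cdot> pairing V (\<beta> A) (?\<gamma> A)
          = VId (self_enriched V) (VFObj F A)"
  have "v_representable_by V C F c x \<longleftrightarrow>
    (\<exists>\<beta>. v_natural V (opposite V C) (self_enriched V) F ?H \<beta> \<and> (\<forall>A\<in>VObj C. ?inv \<beta> A))"
    unfolding v_representable_by_def v_natural_iso_def yoneda_transformation_eq hom_obj opposite_sel
    using yoneda_natural by blast
  also have "\<dots> \<longleftrightarrow> (\<forall>A\<in>VObj C. is_iso V (\<alpha> A))"
  proof
    assume "\<exists>\<beta>. v_natural V (opposite V C) (self_enriched V) F ?H \<beta> \<and> (\<forall>A\<in>VObj C. ?inv \<beta> A)"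
    then obtain \<beta> where nat: "v_natural V (opposite V C) (self_enriched V) F ?H \<beta>"
      and inv: "\<And>A. A \<in> VObj C \<Longrightarrow> ?inv \<beta> A" by blast
    show "\<forall>A\<in>VObj C. is_iso V (\<alpha> A)"
    proof
      fix A assume A: "A \<in> VObj C"
      have o: "VHom C A c \<in> Obj V" "VFObj F A \<in> Obj V" using A by simp_all
      have b: "\<beta> A \<in> Hom V (terminal V) (exponent V (VFObj F A) (VHom C A c))"
        using nat A unfolding FH.v_natural_iff hom_obj by blast
      show "is_iso V (\<alpha> A)"
      proof (rule is_isoI[OF act_on_Hom[OF A] arrow_of_Hom[OF b o(2,1)]])
        show "arrow_of V (VFObj F A) (VHom C A c) (\<beta> A) \<cdot> \<alpha> A = Ident V (VHom C A c)"
          using inv[OF A] unfolding inverse[OF g(1)[OF A] b o] g(2)[OF A] by blast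
        show "\<alpha> A \<cdot> arrow_of V (VFObj F A) (VHom C A c) (\<beta> A) = Ident V (VFObj F A)"
          using inv[OF A] unfolding inverse[OF b g(1)[OF A] o(2,1)] g(2)[OF A] by blast
      qed
    qed
  next
    assume iso: "\<forall>A\<in>VObj C. is_iso V (\<alpha> A)"
    have "\<forall>A\<in>VObj C. \<exists>k. k \<in> Hom V (VFObj F A) (VHom C A c) \<and>
        k \<cdot> \<alpha> A = Ident V (VHom C A c) \<and> \<alpha> A \<cdot> k = Ident V (VFObj F A)"
      using is_isoE[OF bspec[OF iso] act_on_Hom] by metis
    then obtain k where k: "\<And>A. A \<in> VObj C \<Longrightarrow> k A \<in> Hom V (VFObj F A) (VHom C A c)"
        "\<And>A. A \<in> VObj C \<Longrightarrow> k A \<cdot> \<alpha> A = Ident V (VHom C A c)"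
        "\<And>A. A \<in> VObj C \<Longrightarrow> \<alpha> A \<cdot> k A = Ident V (VFObj F A)"
      by metis
    let ?\<beta> = "\<lambda>A\<in>VObj C. name_of V (VFObj F A) (k A)"
    have b: "?\<beta> A \<in> Hom V (terminal V) (exponent V (VFObj F A) (VHom C A c))"
      "arrow_of V (VFObj F A) (VHom C A c) (?\<beta> A) = k A" if "A \<in> VObj C" for A
      using name_of[OF k(1)[OF that]] that by simp_all
    have "k B \<cdot> (presheaf_ev V F B A \<cdot> pairing V f u)
        = presheaf_ev V ?H B A \<cdot> pairing V f (k A \<cdot> u)"
      if A: "A \<in> VObj C" and B: "B \<in> VObj C" and f: "f \<in> Hom V Z (VHom C B A)"
        and u: "u \<in> Hom V Z (VFObj F A)" for A B Z f u
    proof (rule iso_cancel_left[OF bspec[OF iso B] act_on_Hom[OF B]])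
      have ku: "k A \<cdot> u \<in> Hom V Z (VHom C A c)" using u k(1)[OF A] by (rule comp_in_Hom)
      have pf: "presheaf_ev V F B A \<cdot> pairing V f u \<in> Hom V Z (VFObj F B)"
        using A B f u by (simp add: Hom_iff)
      show "k B \<cdot> (presheaf_ev V F B A \<cdot> pairing V f u) \<in> Hom V Z (VHom C B c)"
        using pf k(1)[OF B] by (rule comp_in_Hom)
      show "presheaf_ev V ?H B A \<cdot> pairing V f (k A \<cdot> u) \<in> Hom V Z (VHom C B c)"
        unfolding hom_ev[OF B A f ku] using A B f ku by (simp add: Hom_iff)
      have "\<alpha> B \<cdot> (k B \<cdot> (presheaf_ev V F B A \<cdot> pairing V f u)) = presheaf_ev V F B A \<cdot> pairing V f u"
        using comp_cong_right[OF k(3)[OF B], of "presheaf_ev V F B A \<cdot> pairing V f u"]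
          pf k(1)[OF B] act_on_Hom[OF B] by (simp add: Hom_iff)
      also have "\<dots> = presheaf_ev V F B A \<cdot> pairing V f (\<alpha> A \<cdot> (k A \<cdot> u))"
        using comp_cong_right[OF k(3)[OF A], of u] u k(1)[OF A] act_on_Hom[OF A] by (simp add: Hom_iff)
      also have "\<dots> = \<alpha> B \<cdot> (presheaf_ev V ?H B A \<cdot> pairing V f (k A \<cdot> u))"
        unfolding hom_ev[OF B A f ku] by (rule act_on_natural[OF A B f ku, symmetric])
      finally show "\<alpha> B \<cdot> (k B \<cdot> (presheaf_ev V F B A \<cdot> pairing V f u))
          = \<alpha> B \<cdot> (presheaf_ev V ?H B A \<cdot> pairing V f (k A \<cdot> u))" .
    qed
    then have "v_natural V (opposite V C) (self_enriched V) F ?H ?\<beta>"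
      unfolding FH.v_natural_iff hom_obj using b by (simp add: restrict_extensional)
    moreover have "?inv ?\<beta> A" if A: "A \<in> VObj C" for A
    proof -
      have o: "VHom C A c \<in> Obj V" "VFObj F A \<in> Obj V" using A by simp_all
      show ?thesis
        unfolding inverse[OF g(1)[OF A] b(1)[OF A] o] inverse[OF b(1)[OF A] g(1)[OF A] o(2,1)]
          g(2)[OF A] b(2)[OF A] using k A by blast
    qed
    ultimately show "\<exists>\<beta>. v_natural V (opposite V C) (self_enriched V) F ?H \<beta> \<and> (\<forall>A\<in>VObj C. ?inv \<beta> A)" by blast
  qed
  finally show ?thesis .
qed

end

section \<open>The category of elements\<close>

locale presheaf_elements = enriched_presheaf V C F + extensive_category V I_type
  for V :: "('o, 'a) cat" (structure) and C :: "('i, 'o, 'a) vcat" and F :: "('i, 'o, 'a) vfun"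
    and I_type :: "'i itself" +
  assumes infinite_type: "infinite (UNIV :: 'i set)"
begin

abbreviation "ob \<equiv> el_ob V C F"
abbreviation "ar \<equiv> el_ar V C F"
abbreviation "src \<equiv> el_src V C F"
abbreviation "tgt \<equiv> el_tgt V C F"
abbreviation "\<iota> \<equiv> el_incl V C F"
abbreviation "ev \<equiv> presheaf_ev V F"

text \<open>The arrow \<open>(A, f \<cdot> y) \<rightarrow> (B, y)\<close> of the category of elements given by generalized elements
  \<open>f\<close> of \<open>C(A, B)\<close> and \<open>y\<close> of \<open>F B\<close>.\<close>

definition lift_arrow :: "'i \<Rightarrow> 'i \<Rightarrow> 'a \<Rightarrow> 'a \<Rightarrow> 'a" where
  "lift_arrow A B f y = el_ar_incl V C F A B \<cdot> pairing V f y"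

lemma coproduct_ob: "is_coproduct V (VObj C) (VFObj F) (ob, \<iota>)"
  unfolding el_ob_def el_incl_def by (rule is_coproduct_chosen, rule ex_coproduct_type) simp

lemma ex_coproduct_ar: "\<exists>c. is_coproduct V (VObj C \<times> VObj C) (el_summand V C F) c"
  by (rule ex_coproduct[OF small_pairs[OF infinite_type]]) (auto simp: el_summand_def)

lemma coproduct_ar:
  "is_coproduct V (VObj C \<times> VObj C) (el_summand V C F) (ar, \<lambda>(A, B). el_ar_incl V C F A B)"
  using is_coproduct_chosen[OF ex_coproduct_ar]
  unfolding el_ar_def by (rule is_coproduct_cong) (auto simp: el_ar_incl_def)

lemma ob_ar_Obj [simp]: "ob \<in> Obj V" "ar \<in> Obj V"
  using is_coproduct_incl(1)[OF coproduct_ob] is_coproduct_incl(1)[OF coproduct_ar] by simp_all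

lemma incl_simps [simp]:
  assumes "A \<in> VObj C"
  shows "\<iota> A \<in> Arr V" "Dom V (\<iota> A) = VFObj F A" "Cod V (\<iota> A) = ob"
  using is_coproduct_incl(2)[OF coproduct_ob assms] by (simp_all add: Hom_iff)

lemma ar_incl_simps [simp]:
  assumes "A \<in> VObj C" "B \<in> VObj C"
  shows "el_ar_incl V C F A B \<in> Arr V"
    "Dom V (el_ar_incl V C F A B) = product V (VHom C A B) (VFObj F B)"
    "Cod V (el_ar_incl V C F A B) = ar"
  using is_coproduct_incl(2)[OF coproduct_ar, of "(A, B)"] assms
  by (simp_all add: Hom_iff el_summand_def)

lemma lift_arrow_Hom:
  assumes "A \<in> VObj C" "B \<in> VObj C" "f \<in> Hom V Z (VHom C A B)" "y \<in> Hom V Z (VFObj F B)"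
  shows "lift_arrow A B f y \<in> Hom V Z ar"
  using assms by (simp add: lift_arrow_def Hom_iff)

lemma lift_arrow_comp:
  assumes "A \<in> VObj C" "B \<in> VObj C" "f \<in> Hom V Z (VHom C A B)" "y \<in> Hom V Z (VFObj F B)"
    "z \<in> Hom V W Z"
  shows "lift_arrow A B f y \<cdot> z = lift_arrow A B (f \<cdot> z) (y \<cdot> z)"
  using assms by (simp add: lift_arrow_def Hom_iff)

lemma action_Hom:
  assumes "A \<in> VObj C" "B \<in> VObj C" "f \<in> Hom V Z (VHom C A B)" "y \<in> Hom V Z (VFObj F B)"
  shows "ev A B \<cdot> pairing V f y \<in> Hom V Z (VFObj F A)"
  using assms by (simp add: Hom_iff)

lemma src_tgt_Hom: "src \<in> Hom V ar ob" "tgt \<in> Hom V ar ob"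
  and src_tgt_incl:
    "A \<in> VObj C \<Longrightarrow> B \<in> VObj C \<Longrightarrow> src \<cdot> el_ar_incl V C F A B = \<iota> A \<cdot> ev A B"
    "A \<in> VObj C \<Longrightarrow> B \<in> VObj C \<Longrightarrow>
      tgt \<cdot> el_ar_incl V C F A B = \<iota> B \<cdot> pr2 V (VHom C A B) (VFObj F B)"
proof -
  have s: "(\<lambda>(A, B). \<iota> A \<cdot> ev A B) k \<in> Hom V (el_summand V C F k) ob"
    and t: "(\<lambda>(A, B). \<iota> B \<cdot> pr2 V (VHom C A B) (VFObj F B)) k \<in> Hom V (el_summand V C F k) ob"
    if "k \<in> VObj C \<times> VObj C" for k
    using that by (auto simp: el_summand_def Hom_iff)
  show "src \<in> Hom V ar ob" "tgt \<in> Hom V ar ob"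
    using copair(1)[OF ex_coproduct_ar ob_ar_Obj(1) s] copair(1)[OF ex_coproduct_ar ob_ar_Obj(1) t]
    unfolding el_src_def el_tgt_def el_ar_def by blast+
  assume AB: "A \<in> VObj C" "B \<in> VObj C"
  show "src \<cdot> el_ar_incl V C F A B = \<iota> A \<cdot> ev A B"
    "tgt \<cdot> el_ar_incl V C F A B = \<iota> B \<cdot> pr2 V (VHom C A B) (VFObj F B)"
    using copair(2)[OF ex_coproduct_ar ob_ar_Obj(1) s, of "(A, B)"]
      copair(2)[OF ex_coproduct_ar ob_ar_Obj(1) t, of "(A, B)"] AB
    unfolding el_src_def el_tgt_def el_ar_incl_def by auto
qed

lemma src_tgt_simps [simp]:
  "src \<in> Arr V" "Dom V src = ar" "Cod V src = ob" "tgt \<in> Arr V" "Dom V tgt = ar" "Cod V tgt = ob"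
  using src_tgt_Hom by (simp_all add: Hom_iff)

lemma src_tgt_lift:
  assumes "A \<in> VObj C" "B \<in> VObj C" "f \<in> Hom V Z (VHom C A B)" "y \<in> Hom V Z (VFObj F B)"
  shows "src \<cdot> lift_arrow A B f y = \<iota> A \<cdot> (ev A B \<cdot> pairing V f y)"
    "tgt \<cdot> lift_arrow A B f y = \<iota> B \<cdot> y"
  using comp_cong_right[OF src_tgt_incl(1)[OF assms(1,2)], of "pairing V f y"]
    comp_cong_right[OF src_tgt_incl(2)[OF assms(1,2)], of "pairing V f y"] assms
  by (simp_all add: lift_arrow_def Hom_iff)

lemma idn_incl:
  shows idn_Hom: "el_idn V C F \<in> Hom V ob ar"
    and "A \<in> VObj C \<Longrightarrow> y \<in> Hom V Z (VFObj F A) \<Longrightarrow>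
      el_idn V C F \<cdot> (\<iota> A \<cdot> y) = lift_arrow A A (VId C A \<cdot> bang V Z) y"
proof -
  let ?f = "\<lambda>A. el_ar_incl V C F A A \<cdot> pairing V (VId C A \<cdot> bang V (VFObj F A)) (Ident V (VFObj F A))"
  have f: "?f A \<in> Hom V (VFObj F A) ar" if "A \<in> VObj C" for A
    using that by (simp add: Hom_iff)
  have ex: "\<exists>c. is_coproduct V (VObj C) (VFObj F) c" using coproduct_ob by blast
  show h: "el_idn V C F \<in> Hom V ob ar"
    using copair(1)[OF ex ob_ar_Obj(2) f] unfolding el_idn_def el_ob_def .
  assume A: "A \<in> VObj C" and y: "y \<in> Hom V Z (VFObj F A)"
  have "el_idn V C F \<cdot> \<iota> A = ?f A"
    using copair(2)[OF ex ob_ar_Obj(2) f A] unfolding el_idn_def el_incl_def .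
  then show "el_idn V C F \<cdot> (\<iota> A \<cdot> y) = lift_arrow A A (VId C A \<cdot> bang V Z) y"
    using comp_cong_right[of "el_idn V C F" "\<iota> A" "?f A" y] A y h
    by (simp add: lift_arrow_def Hom_iff)
qed

lemma incl_disjoint:
  assumes "A \<in> VObj C" "B \<in> VObj C" "u \<in> Hom V Z (VFObj F A)" "v \<in> Hom V Z (VFObj F B)"
    "\<iota> A \<cdot> u = \<iota> B \<cdot> v"
  shows "(A = B \<and> u = v) \<or> is_initial V Z"
  using disjoint[OF small_same coproduct_ob assms] by blast

lemma lift_arrow_disjoint:
  assumes "A \<in> VObj C" "B \<in> VObj C" "f \<in> Hom V Z (VHom C A B)" "y \<in> Hom V Z (VFObj F B)"
    "A' \<in> VObj C" "B' \<in> VObj C" "f' \<in> Hom V Z (VHom C A' B')" "y' \<in> Hom V Z (VFObj F B')"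
    "lift_arrow A B f y = lift_arrow A' B' f' y'"
  shows "(A = A' \<and> B = B' \<and> f = f' \<and> y = y') \<or> is_initial V Z"
proof -
  have p: "pairing V f y \<in> Hom V Z (el_summand V C F (A, B))"
    "pairing V f' y' \<in> Hom V Z (el_summand V C F (A', B'))"
    using assms by (simp_all add: el_summand_def Hom_iff)
  have "((A, B) = (A', B') \<and> pairing V f y = pairing V f' y') \<or> is_initial V Z"
    using disjoint[OF small_pairs[OF infinite_type] coproduct_ar _ _ p] assms
    by (auto simp: lift_arrow_def)
  then show ?thesis using pairing_inject[OF _ assms(3,4)] assms(7,8) by auto
qed

text \<open>The decomposition of a stage along an arrow of the category of elements, with the element of each
summand split into its two coordinates.\<close>

lemma decompose_ar:
  assumes "h \<in> Hom V Z ar"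
  obtains Z' \<kappa> f y where "is_coproduct V (VObj C \<times> VObj C) Z' (Z, \<kappa>)"
    "\<And>k. k \<in> VObj C \<times> VObj C \<Longrightarrow> \<kappa> k \<in> Hom V (Z' k) Z"
    "\<And>A B. A \<in> VObj C \<Longrightarrow> B \<in> VObj C \<Longrightarrow> f (A, B) \<in> Hom V (Z' (A, B)) (VHom C A B) \<and>
      y (A, B) \<in> Hom V (Z' (A, B)) (VFObj F B) \<and>
      h \<cdot> \<kappa> (A, B) = lift_arrow A B (f (A, B)) (y (A, B))"
proof -
  let ?K = "VObj C \<times> VObj C"
  obtain Z' \<kappa> g where cop: "is_coproduct V ?K Z' (Z, \<kappa>)"
    and k: "\<And>k. k \<in> ?K \<Longrightarrow> \<kappa> k \<in> Hom V (Z' k) Z"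
    and g: "\<And>k. k \<in> ?K \<Longrightarrow> g k \<in> Hom V (Z' k) (el_summand V C F k)"
    and hk: "\<And>k. k \<in> ?K \<Longrightarrow> h \<cdot> \<kappa> k = (case k of (A, B) \<Rightarrow> el_ar_incl V C F A B) \<cdot> g k"
    using decompose[OF small_pairs[OF infinite_type] coproduct_ar assms] by blast
  let ?f = "\<lambda>(A, B). pr1 V (VHom C A B) (VFObj F B) \<cdot> g (A, B)"
  let ?y = "\<lambda>(A, B). pr2 V (VHom C A B) (VFObj F B) \<cdot> g (A, B)"
  have "?f (A, B) \<in> Hom V (Z' (A, B)) (VHom C A B) \<and> ?y (A, B) \<in> Hom V (Z' (A, B)) (VFObj F B) \<and>
      h \<cdot> \<kappa> (A, B) = lift_arrow A B (?f (A, B)) (?y (A, B))"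
    if "A \<in> VObj C" "B \<in> VObj C" for A B
    using g[of "(A, B)"] hk[of "(A, B)"] that by (simp add: el_summand_def lift_arrow_def Hom_iff)
  then show ?thesis using that cop k by blast
qed

lemma ar_cover:
  assumes "p \<in> Hom V Z ar" "u \<in> Hom V Z T" "v \<in> Hom V Z T"
    "\<And>A B W z f y. A \<in> VObj C \<Longrightarrow> B \<in> VObj C \<Longrightarrow> z \<in> Hom V W Z \<Longrightarrow> f \<in> Hom V W (VHom C A B) \<Longrightarrow>
      y \<in> Hom V W (VFObj F B) \<Longrightarrow> p \<cdot> z = lift_arrow A B f y \<Longrightarrow> u \<cdot> z = v \<cdot> z"
  shows "u = v"
proof -
  obtain Z' \<kappa> f y where cop: "is_coproduct V (VObj C \<times> VObj C) Z' (Z, \<kappa>)"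
    and "\<And>k. k \<in> VObj C \<times> VObj C \<Longrightarrow> \<kappa> k \<in> Hom V (Z' k) Z"
    and "\<And>A B. A \<in> VObj C \<Longrightarrow> B \<in> VObj C \<Longrightarrow> f (A, B) \<in> Hom V (Z' (A, B)) (VHom C A B) \<and>
      y (A, B) \<in> Hom V (Z' (A, B)) (VFObj F B) \<and>
      p \<cdot> \<kappa> (A, B) = lift_arrow A B (f (A, B)) (y (A, B))"
    using decompose_ar[OF assms(1)] by blast
  then show ?thesis
    using assms(4) by (intro is_coproduct_ext[OF cop assms(2,3)]) (metis SigmaE)
qed

lemma initial_comp_eq:
  assumes "is_initial V W" "z \<in> Hom V W Z" "u \<in> Hom V Z T" "v \<in> Hom V Z T"
  shows "u \<cdot> z = v \<cdot> z"
  using initial_eq[OF assms(1) comp_in_Hom[OF assms(2,3)] comp_in_Hom[OF assms(2,4)]] .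

text \<open>Cover the stage first by the summand of \<open>p\<close> and then by that of \<open>q\<close>. Where the target of the former and
the source of the latter lie over different objects of \<open>C\<close>, the stage is initial by disjointness and there
is nothing to check; so the composable pairs that come from composable pairs of \<open>C\<close> form a cover.\<close>

lemma composable_cover:
  assumes "p \<in> Hom V Z ar" "q \<in> Hom V Z ar" "tgt \<cdot> p = src \<cdot> q" "u \<in> Hom V Z T" "v \<in> Hom V Z T"
    "\<And>A B D W z f g y. A \<in> VObj C \<Longrightarrow> B \<in> VObj C \<Longrightarrow> D \<in> VObj C \<Longrightarrow> z \<in> Hom V W Z \<Longrightarrow>
      f \<in> Hom V W (VHom C A B) \<Longrightarrow> g \<in> Hom V W (VHom C B D) \<Longrightarrow> y \<in> Hom V W (VFObj F D) \<Longrightarrow>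
      p \<cdot> z = lift_arrow A B f (ev B D \<cdot> pairing V g y) \<Longrightarrow> q \<cdot> z = lift_arrow B D g y \<Longrightarrow>
      u \<cdot> z = v \<cdot> z"
  shows "u = v"
proof (rule ar_cover[OF assms(1,4,5)])
  fix A B W z f y'
  assume A: "A \<in> VObj C" and B: "B \<in> VObj C" and z: "z \<in> Hom V W Z" and f: "f \<in> Hom V W (VHom C A B)"
    and y': "y' \<in> Hom V W (VFObj F B)" and pz: "p \<cdot> z = lift_arrow A B f y'"
  show "u \<cdot> z = v \<cdot> z"
  proof (rule ar_cover[of "q \<cdot> z" W])
    show "q \<cdot> z \<in> Hom V W ar" "u \<cdot> z \<in> Hom V W T" "v \<cdot> z \<in> Hom V W T"
      using z assms(2,4,5) by (auto intro: comp_in_Hom)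
    fix B' D W' w g y
    assume B': "B' \<in> VObj C" and D: "D \<in> VObj C" and w: "w \<in> Hom V W' W"
      and g: "g \<in> Hom V W' (VHom C B' D)" and y: "y \<in> Hom V W' (VFObj F D)"
      and qw: "(q \<cdot> z) \<cdot> w = lift_arrow B' D g y"
    have zw: "z \<cdot> w \<in> Hom V W' Z" using w z by (rule comp_in_Hom)
    have qzw: "q \<cdot> (z \<cdot> w) = lift_arrow B' D g y" using qw assms(2) z w by (simp add: Hom_iff)
    have fw: "f \<cdot> w \<in> Hom V W' (VHom C A B)" "y' \<cdot> w \<in> Hom V W' (VFObj F B)"
      using w f y' by (auto intro: comp_in_Hom)
    have pzw: "p \<cdot> (z \<cdot> w) = lift_arrow A B (f \<cdot> w) (y' \<cdot> w)"
      using comp_assoc[OF w z assms(1)] lift_arrow_comp[OF A B f y' w] pz by simp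
    have "tgt \<cdot> (p \<cdot> (z \<cdot> w)) = src \<cdot> (q \<cdot> (z \<cdot> w))"
      using comp_cong_right[OF assms(3), of "z \<cdot> w"] assms(1,2) zw by (simp add: Hom_iff)
    then have "\<iota> B \<cdot> (y' \<cdot> w) = \<iota> B' \<cdot> (ev B' D \<cdot> pairing V g y)"
      unfolding pzw qzw src_tgt_lift(1)[OF B' D g y] src_tgt_lift(2)[OF A B fw] .
    then have "(B = B' \<and> y' \<cdot> w = ev B' D \<cdot> pairing V g y) \<or> is_initial V W'"
      using incl_disjoint[OF B B' fw(2) action_Hom[OF B' D g y]] by blast
    then have "u \<cdot> (z \<cdot> w) = v \<cdot> (z \<cdot> w)"
    proof
      assume "B = B' \<and> y' \<cdot> w = ev B' D \<cdot> pairing V g y"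
      then show ?thesis using assms(6)[OF A B D zw fw(1)] g y pzw qzw by simp
    next
      assume "is_initial V W'"
      then show ?thesis using initial_comp_eq zw assms(4,5) by blast
    qed
    then show "(u \<cdot> z) \<cdot> w = (v \<cdot> z) \<cdot> w" using assms(4,5) z w by (simp add: Hom_iff)
  qed
qed

text \<open>The arrow \<open>v\<close> is a composite of the pair of arrows \<open>z\<close> wherever both arrows lie in a single summand. This
is a local condition on \<open>v\<close>, which makes it possible to glue composites along a cover.\<close>

definition composes :: "'o \<Rightarrow> 'a \<Rightarrow> 'a \<Rightarrow> bool" where
  "composes Z z v \<longleftrightarrow> (\<forall>A\<in>VObj C. \<forall>B\<in>VObj C. \<forall>D\<in>VObj C. \<forall>W a f g y. a \<in> Hom V W Z \<longrightarrow>
    f \<in> Hom V W (VHom C A B) \<longrightarrow> g \<in> Hom V W (VHom C B D) \<longrightarrow> y \<in> Hom V W (VFObj F D) \<longrightarrow>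
    pb1 V tgt src \<cdot> (z \<cdot> a) = lift_arrow A B f (ev B D \<cdot> pairing V g y) \<longrightarrow>
    pb2 V tgt src \<cdot> (z \<cdot> a) = lift_arrow B D g y \<longrightarrow>
    v \<cdot> a = lift_arrow A D (VComp C A B D \<cdot> pairing V f g) y)"

abbreviation "pairs \<equiv> pullback V tgt src"

lemma composes_glue:
  assumes z: "z \<in> Hom V Z pairs" and w: "w \<in> Hom V Z ar"
    and loc: "\<And>A B Z' a f y. A \<in> VObj C \<Longrightarrow> B \<in> VObj C \<Longrightarrow> a \<in> Hom V Z' Z \<Longrightarrow>
      f \<in> Hom V Z' (VHom C A B) \<Longrightarrow> y \<in> Hom V Z' (VFObj F B) \<Longrightarrow> w \<cdot> a = lift_arrow A B f y \<Longrightarrow>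
      \<exists>v\<in>Hom V Z' ar. composes Z' (z \<cdot> a) v"
  shows "\<exists>v\<in>Hom V Z ar. composes Z z v"
proof -
  let ?K = "VObj C \<times> VObj C"
  obtain Z' \<kappa> f y where cop: "is_coproduct V ?K Z' (Z, \<kappa>)"
    and k: "\<And>k. k \<in> ?K \<Longrightarrow> \<kappa> k \<in> Hom V (Z' k) Z"
    and wk: "\<And>A B. A \<in> VObj C \<Longrightarrow> B \<in> VObj C \<Longrightarrow> f (A, B) \<in> Hom V (Z' (A, B)) (VHom C A B) \<and>
      y (A, B) \<in> Hom V (Z' (A, B)) (VFObj F B) \<and>
      w \<cdot> \<kappa> (A, B) = lift_arrow A B (f (A, B)) (y (A, B))"
    using decompose_ar[OF w] by blast
  have "\<exists>v\<in>Hom V (Z' k) ar. composes (Z' k) (z \<cdot> \<kappa> k) v" if "k \<in> ?K" for k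
    using that wk loc k by (metis SigmaE)
  then obtain v' where v': "\<And>k. k \<in> ?K \<Longrightarrow> v' k \<in> Hom V (Z' k) ar"
      "\<And>k. k \<in> ?K \<Longrightarrow> composes (Z' k) (z \<cdot> \<kappa> k) (v' k)" by metis
  obtain v where v: "v \<in> Hom V Z ar" "\<And>k. k \<in> ?K \<Longrightarrow> v \<cdot> \<kappa> k = v' k"
    using is_coproduct_ex[OF cop ob_ar_Obj(2) v'(1)] by blast
  have "composes Z z v"
    unfolding composes_def
  proof (intro ballI allI impI)
    fix A B D W a f g y
    assume A: "A \<in> VObj C" and B: "B \<in> VObj C" and D: "D \<in> VObj C" and a: "a \<in> Hom V W Z"
      and f: "f \<in> Hom V W (VHom C A B)" and g: "g \<in> Hom V W (VHom C B D)"
      and y: "y \<in> Hom V W (VFObj F D)"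
      and p1: "pb1 V tgt src \<cdot> (z \<cdot> a) = lift_arrow A B f (ev B D \<cdot> pairing V g y)"
      and p2: "pb2 V tgt src \<cdot> (z \<cdot> a) = lift_arrow B D g y"
    let ?fg = "VComp C A B D \<cdot> pairing V f g"
    have fg: "?fg \<in> Hom V W (VHom C A D)" using A B D f g by (simp add: Hom_iff)
    have gy: "ev B D \<cdot> pairing V g y \<in> Hom V W (VFObj F B)" by (rule action_Hom[OF B D g y])
    have pb: "pb1 V tgt src \<in> Hom V pairs ar" "pb2 V tgt src \<in> Hom V pairs ar"
      by (simp_all add: Hom_iff)
    show "v \<cdot> a = lift_arrow A D ?fg y"
    proof (rule local_eq[OF small_pairs[OF infinite_type] cop a])
      show "v \<cdot> a \<in> Hom V W ar" using a v(1) by (rule comp_in_Hom)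
      show "lift_arrow A D ?fg y \<in> Hom V W ar" by (rule lift_arrow_Hom[OF A D fg y])
      fix k W' b l
      assume kK: "k \<in> ?K" and b: "b \<in> Hom V W' W" and l: "l \<in> Hom V W' (Z' k)"
        and e: "a \<cdot> b = \<kappa> k \<cdot> l"
      have zl: "(z \<cdot> \<kappa> k) \<cdot> l = (z \<cdot> a) \<cdot> b"
        using e z a b l k[OF kK] by (simp add: Hom_iff)
      have za: "z \<cdot> a \<in> Hom V W pairs" using a z by (rule comp_in_Hom)
      have fb: "f \<cdot> b \<in> Hom V W' (VHom C A B)" "g \<cdot> b \<in> Hom V W' (VHom C B D)"
        "y \<cdot> b \<in> Hom V W' (VFObj F D)" using b f g y by (auto intro: comp_in_Hom)
      have q1: "pb1 V tgt src \<cdot> ((z \<cdot> \<kappa> k) \<cdot> l) = lift_arrow A B (f \<cdot> b) (ev B D \<cdot> pairing V (g \<cdot> b) (y \<cdot> b))"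
        unfolding zl comp_assoc[OF b za pb(1), symmetric] p1 lift_arrow_comp[OF A B f gy b]
        using B D g y b by (simp add: Hom_iff)
      have q2: "pb2 V tgt src \<cdot> ((z \<cdot> \<kappa> k) \<cdot> l) = lift_arrow B D (g \<cdot> b) (y \<cdot> b)"
        unfolding zl comp_assoc[OF b za pb(2), symmetric] p2 lift_arrow_comp[OF B D g y b] ..
      have "(v \<cdot> a) \<cdot> b = (v \<cdot> \<kappa> k) \<cdot> l"
        using e v(1) a b l k[OF kK] by (simp add: Hom_iff)
      also have "\<dots> = lift_arrow A D (VComp C A B D \<cdot> pairing V (f \<cdot> b) (g \<cdot> b)) (y \<cdot> b)"
        using v'(2)[OF kK] A B D l fb q1 q2 unfolding v(2)[OF kK] composes_def by blast
      also have "\<dots> = lift_arrow A D ?fg y \<cdot> b"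
        unfolding lift_arrow_comp[OF A D fg y b] using A B D f g b by (simp add: Hom_iff)
      finally show "(v \<cdot> a) \<cdot> b = lift_arrow A D ?fg y \<cdot> b" .
    qed
  qed
  then show ?thesis using v(1) by blast
qed

text \<open>Glue twice, along the two projections of the object of composable pairs. On a piece where the first
arrow lies over \<open>(A, B)\<close> and the second over \<open>(B', D)\<close>, either \<open>B' = B\<close> and the composite is
formed in \<open>C\<close>, or the piece is initial and any arrow will do. The composite satisfies the condition for
all other ways of writing the two arrows since the injections are disjoint and monic.\<close>

lemma ex_composition: "\<exists>m\<in>Hom V pairs ar. composes pairs (Ident V pairs) m"
proof -
  let ?p = "pb1 V tgt src" and ?q = "pb2 V tgt src"
  have pq: "?p \<in> Hom V pairs ar" "?q \<in> Hom V pairs ar" by (simp_all add: Hom_iff)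
  have comm: "tgt \<cdot> ?p = src \<cdot> ?q" by (rule pb_commutes) simp_all
  have I: "Ident V pairs \<in> Hom V pairs pairs" by (simp add: Hom_iff)
  show ?thesis
  proof (rule composes_glue[OF I pq(1)])
    fix A B Z a f y'
    assume A: "A \<in> VObj C" and B: "B \<in> VObj C" and a: "a \<in> Hom V Z pairs"
      and f: "f \<in> Hom V Z (VHom C A B)" and y': "y' \<in> Hom V Z (VFObj F B)"
      and pa: "?p \<cdot> a = lift_arrow A B f y'"
    have Ia: "Ident V pairs \<cdot> a = a" using a by (simp add: Hom_iff)
    have "\<exists>v\<in>Hom V Z ar. composes Z a v"
    proof (rule composes_glue[OF a comp_in_Hom[OF a pq(2)]])
      fix B' D W b g y
      assume B': "B' \<in> VObj C" and D: "D \<in> VObj C" and b: "b \<in> Hom V W Z"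
        and g: "g \<in> Hom V W (VHom C B' D)" and y: "y \<in> Hom V W (VFObj F D)"
        and qab': "(?q \<cdot> a) \<cdot> b = lift_arrow B' D g y"
      have ab: "a \<cdot> b \<in> Hom V W pairs" using b a by (rule comp_in_Hom)
      have qab: "?q \<cdot> (a \<cdot> b) = lift_arrow B' D g y" using comp_assoc[OF b a pq(2)] qab' by simp
      have fb: "f \<cdot> b \<in> Hom V W (VHom C A B)" "y' \<cdot> b \<in> Hom V W (VFObj F B)"
        using b f y' by (auto intro: comp_in_Hom)
      have pab: "?p \<cdot> (a \<cdot> b) = lift_arrow A B (f \<cdot> b) (y' \<cdot> b)"
        using comp_assoc[OF b a pq(1)] lift_arrow_comp[OF A B f y' b] pa by simp
      have "tgt \<cdot> (?p \<cdot> (a \<cdot> b)) = src \<cdot> (?q \<cdot> (a \<cdot> b))"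
        using comp_cong_right[OF comm, of "a \<cdot> b"] ab by (simp add: Hom_iff)
      then have "\<iota> B \<cdot> (y' \<cdot> b) = \<iota> B' \<cdot> (ev B' D \<cdot> pairing V g y)"
        unfolding pab qab src_tgt_lift(1)[OF B' D g y] src_tgt_lift(2)[OF A B fb] .
      then have "(B = B' \<and> y' \<cdot> b = ev B' D \<cdot> pairing V g y) \<or> is_initial V W"
        using incl_disjoint[OF B B' fb(2) action_Hom[OF B' D g y]] by blast
      then show "\<exists>v\<in>Hom V W ar. composes W (a \<cdot> b) v"
      proof
        assume "is_initial V W"
        then obtain v where v: "v \<in> Hom V W ar" using initial_ex by (meson ob_ar_Obj(2))
        have "composes W (a \<cdot> b) v"
          unfolding composes_def
        proof (intro ballI allI impI)
          fix A2 B2 D2 X k f2 g2 y2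
          assume o2: "A2 \<in> VObj C" "B2 \<in> VObj C" "D2 \<in> VObj C" and k: "k \<in> Hom V X W"
            and f2: "f2 \<in> Hom V X (VHom C A2 B2)" and g2: "g2 \<in> Hom V X (VHom C B2 D2)"
            and y2: "y2 \<in> Hom V X (VFObj F D2)"
          have fg2: "VComp C A2 B2 D2 \<cdot> pairing V f2 g2 \<in> Hom V X (VHom C A2 D2)"
            using o2 f2 g2 by (simp add: Hom_iff)
          show "v \<cdot> k = lift_arrow A2 D2 (VComp C A2 B2 D2 \<cdot> pairing V f2 g2) y2"
            by (rule initial_eq[OF strict_initial[OF \<open>is_initial V W\<close> k] comp_in_Hom[OF k v]
                  lift_arrow_Hom[OF o2(1,3) fg2 y2]])
        qed
        then show ?thesis using v by blast
      next
        assume "B = B' \<and> y' \<cdot> b = ev B' D \<cdot> pairing V g y"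
        then have BB: "B' = B" and yb: "y' \<cdot> b = ev B D \<cdot> pairing V g y" by auto
        note g = g[unfolded BB] and qab = qab[unfolded BB]
        let ?fg = "VComp C A B D \<cdot> pairing V (f \<cdot> b) g"
        have fg: "?fg \<in> Hom V W (VHom C A D)" using A B D fb g by (simp add: Hom_iff)
        have "composes W (a \<cdot> b) (lift_arrow A D ?fg y)"
          unfolding composes_def
        proof (intro ballI allI impI)
          fix A2 B2 D2 X k f2 g2 y2
          assume o2: "A2 \<in> VObj C" "B2 \<in> VObj C" "D2 \<in> VObj C" and k: "k \<in> Hom V X W"
            and f2: "f2 \<in> Hom V X (VHom C A2 B2)" and g2: "g2 \<in> Hom V X (VHom C B2 D2)"
            and y2: "y2 \<in> Hom V X (VFObj F D2)"
            and p2: "?p \<cdot> ((a \<cdot> b) \<cdot> k) = lift_arrow A2 B2 f2 (ev B2 D2 \<cdot> pairing V g2 y2)"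
            and q2: "?q \<cdot> ((a \<cdot> b) \<cdot> k) = lift_arrow B2 D2 g2 y2"
          have fk: "(f \<cdot> b) \<cdot> k \<in> Hom V X (VHom C A B)" "(y' \<cdot> b) \<cdot> k \<in> Hom V X (VFObj F B)"
            "g \<cdot> k \<in> Hom V X (VHom C B D)" "y \<cdot> k \<in> Hom V X (VFObj F D)"
            using k fb g y by (auto intro: comp_in_Hom)
          have pk: "?p \<cdot> ((a \<cdot> b) \<cdot> k) = lift_arrow A B ((f \<cdot> b) \<cdot> k) ((y' \<cdot> b) \<cdot> k)"
            unfolding comp_assoc[OF k ab pq(1), symmetric] pab by (rule lift_arrow_comp[OF A B fb k])
          have qk: "?q \<cdot> ((a \<cdot> b) \<cdot> k) = lift_arrow B D (g \<cdot> k) (y \<cdot> k)"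
            unfolding comp_assoc[OF k ab pq(2), symmetric] qab by (rule lift_arrow_comp[OF B D g y k])
          have fg2: "VComp C A2 B2 D2 \<cdot> pairing V f2 g2 \<in> Hom V X (VHom C A2 D2)"
            using o2 f2 g2 by (simp add: Hom_iff)
          have m1: "(A = A2 \<and> B = B2 \<and> (f \<cdot> b) \<cdot> k = f2 \<and>
              (y' \<cdot> b) \<cdot> k = ev B2 D2 \<cdot> pairing V g2 y2) \<or> is_initial V X"
            using lift_arrow_disjoint[OF A B fk(1,2) o2(1,2) f2 action_Hom[OF o2(2,3) g2 y2]] pk p2 by simp
          have m2: "(B = B2 \<and> D = D2 \<and> g \<cdot> k = g2 \<and> y \<cdot> k = y2) \<or> is_initial V X"
            using lift_arrow_disjoint[OF B D fk(3,4) o2(2,3) g2 y2] qk q2 by simp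
          have l1: "lift_arrow A D ?fg y \<cdot> k \<in> Hom V X ar"
            using k lift_arrow_Hom[OF A D fg y] by (rule comp_in_Hom)
          have l2: "lift_arrow A2 D2 (VComp C A2 B2 D2 \<cdot> pairing V f2 g2) y2 \<in> Hom V X ar"
            by (rule lift_arrow_Hom[OF o2(1,3) fg2 y2])
          show "lift_arrow A D ?fg y \<cdot> k = lift_arrow A2 D2 (VComp C A2 B2 D2 \<cdot> pairing V f2 g2) y2"
          proof (cases "is_initial V X")
            case True
            then show ?thesis using initial_eq l1 l2 by blast
          next
            case False
            then have eq: "A2 = A" "B2 = B" "D2 = D" "f2 = (f \<cdot> b) \<cdot> k" "g2 = g \<cdot> k" "y2 = y \<cdot> k"
              using m1 m2 by blast+
            have "?fg \<cdot> k = VComp C A B D \<cdot> pairing V ((f \<cdot> b) \<cdot> k) (g \<cdot> k)"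
              using A B D f b g k by (simp add: Hom_iff)
            then show ?thesis unfolding eq lift_arrow_comp[OF A D fg y k] by simp
          qed
        qed
        then show ?thesis using lift_arrow_Hom[OF A D fg y] by blast
      qed
    qed
    then show "\<exists>v\<in>Hom V Z ar. composes Z (Ident V pairs \<cdot> a) v" unfolding Ia .
  qed
qed

lemma composable_lift:
  assumes "A \<in> VObj C" "B \<in> VObj C" "D \<in> VObj C"
    "f \<in> Hom V Z (VHom C A B)" "g \<in> Hom V Z (VHom C B D)" "y \<in> Hom V Z (VFObj F D)"
  shows "lift_arrow A B f (ev B D \<cdot> pairing V g y) \<in> Hom V Z ar" "lift_arrow B D g y \<in> Hom V Z ar"
    "tgt \<cdot> lift_arrow A B f (ev B D \<cdot> pairing V g y) = src \<cdot> lift_arrow B D g y"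
proof -
  note gy = action_Hom[OF assms(2,3,5,6)]
  show "lift_arrow A B f (ev B D \<cdot> pairing V g y) \<in> Hom V Z ar" "lift_arrow B D g y \<in> Hom V Z ar"
    by (rule lift_arrow_Hom[OF assms(1,2,4) gy], rule lift_arrow_Hom[OF assms(2,3,5,6)])
  show "tgt \<cdot> lift_arrow A B f (ev B D \<cdot> pairing V g y) = src \<cdot> lift_arrow B D g y"
    unfolding src_tgt_lift(1)[OF assms(2,3,5,6)] src_tgt_lift(2)[OF assms(1,2,4) gy] ..
qed

lemma pair_incl:
  assumes o: "A \<in> VObj C" "B \<in> VObj C" "D \<in> VObj C"
    and fgy: "f \<in> Hom V Z (VHom C A B)" "g \<in> Hom V Z (VHom C B D)" "y \<in> Hom V Z (VFObj F D)"
  shows "el_pair_incl V C F A B D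
      \<in> Hom V (product V (product V (VHom C A B) (VHom C B D)) (VFObj F D)) pairs"
    "el_pair_incl V C F A B D \<cdot> pairing V (pairing V f g) y
      = pb_lift V tgt src (lift_arrow A B f (ev B D \<cdot> pairing V g y)) (lift_arrow B D g y)"
proof -
  let ?H = "VHom C A B" and ?K = "VHom C B D" and ?Y = "VFObj F D"
  let ?P = "product V ?H ?K"
  let ?Q = "product V ?P ?Y"
  let ?a = "pr1 V ?H ?K \<cdot> pr1 V ?P ?Y" and ?b = "pr2 V ?H ?K \<cdot> pr1 V ?P ?Y" and ?y = "pr2 V ?P ?Y"
  have h: "?a \<in> Hom V ?Q ?H" "?b \<in> Hom V ?Q ?K" "?y \<in> Hom V ?Q ?Y"
    using o by (simp_all add: Hom_iff)
  let ?l = "lift_arrow A B ?a (ev B D \<cdot> pairing V ?b ?y)" and ?r = "lift_arrow B D ?b ?y"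
  have e: "el_pair_incl V C F A B D = pb_lift V tgt src ?l ?r"
    by (simp add: el_pair_incl_def lift_arrow_def Let_def)
  note c = composable_lift[OF o h]
  show "el_pair_incl V C F A B D \<in> Hom V ?Q pairs"
    unfolding e using c by (simp add: Hom_iff)
  let ?z = "pairing V (pairing V f g) y"
  have z: "?z \<in> Hom V Z ?Q" using assms by (simp add: Hom_iff)
  have lz: "?l \<cdot> ?z = lift_arrow A B f (ev B D \<cdot> pairing V g y)" "?r \<cdot> ?z = lift_arrow B D g y"
    unfolding lift_arrow_comp[OF o(1,2) h(1) action_Hom[OF o(2,3) h(2,3)] z]
      lift_arrow_comp[OF o(2,3) h(2,3) z]
    using assms by (simp_all add: Hom_iff)
  show "el_pair_incl V C F A B D \<cdot> ?z
      = pb_lift V tgt src (lift_arrow A B f (ev B D \<cdot> pairing V g y)) (lift_arrow B D g y)"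
    unfolding e lz[symmetric] by (rule pb_lift_comp) (use c z in \<open>simp_all add: Hom_iff\<close>)
qed

text \<open>The composition is given by a definite description, so existence has to be matched by uniqueness:
by \<open>composable_cover\<close>, an arrow out of the object of composable pairs is determined by its restrictions
along the arrows \<open>el_pair_incl\<close>.\<close>

lemma el_cmp:
  shows el_cmp_Hom: "el_cmp V C F \<in> Hom V pairs ar"
    and "A \<in> VObj C \<Longrightarrow> B \<in> VObj C \<Longrightarrow> D \<in> VObj C \<Longrightarrow>
      el_cmp V C F \<cdot> el_pair_incl V C F A B D
        = el_ar_incl V C F A D \<cdot> prod_map V (VComp C A B D) (Ident V (VFObj F D))"
proof -
  let ?char = "\<lambda>m. m \<in> Hom V pairs ar \<and> (\<forall>A\<in>VObj C. \<forall>B\<in>VObj C. \<forall>D\<in>VObj C.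
        m \<cdot> el_pair_incl V C F A B D
        = el_ar_incl V C F A D \<cdot> prod_map V (VComp C A B D) (Ident V (VFObj F D)))"
  obtain m where m: "m \<in> Hom V pairs ar" "composes pairs (Ident V pairs) m"
    using ex_composition by blast
  have cm: "?char m"
  proof (intro conjI ballI m(1))
    fix A B D assume o: "A \<in> VObj C" "B \<in> VObj C" "D \<in> VObj C"
    let ?H = "VHom C A B" and ?K = "VHom C B D" and ?Y = "VFObj F D"
    let ?P = "product V ?H ?K"
    let ?Q = "product V ?P ?Y"
    let ?a = "pr1 V ?H ?K \<cdot> pr1 V ?P ?Y" and ?b = "pr2 V ?H ?K \<cdot> pr1 V ?P ?Y" and ?y = "pr2 V ?P ?Y"
    have h: "?a \<in> Hom V ?Q ?H" "?b \<in> Hom V ?Q ?K" "?y \<in> Hom V ?Q ?Y"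
      using o by (simp_all add: Hom_iff)
    let ?l = "lift_arrow A B ?a (ev B D \<cdot> pairing V ?b ?y)" and ?r = "lift_arrow B D ?b ?y"
    note c = composable_lift[OF o h] and i = pair_incl[OF o h]
    have "Ident V pairs \<cdot> el_pair_incl V C F A B D = pb_lift V tgt src ?l ?r"
      using i o by (simp add: Hom_iff)
    then have "pb1 V tgt src \<cdot> (Ident V pairs \<cdot> el_pair_incl V C F A B D) = ?l"
      "pb2 V tgt src \<cdot> (Ident V pairs \<cdot> el_pair_incl V C F A B D) = ?r"
      using c by (simp_all add: Hom_iff)
    then have "m \<cdot> el_pair_incl V C F A B D = lift_arrow A D (VComp C A B D \<cdot> pairing V ?a ?b) ?y"
      using m(2) o i(1) h unfolding composes_def by blast
    also have "\<dots> = el_ar_incl V C F A D \<cdot> prod_map V (VComp C A B D) (Ident V ?Y)"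
      using o by (simp add: lift_arrow_def)
    finally show "m \<cdot> el_pair_incl V C F A B D
        = el_ar_incl V C F A D \<cdot> prod_map V (VComp C A B D) (Ident V ?Y)" .
  qed
  have unique: "m' = m" if m': "?char m'" for m'
  proof (rule composable_cover[of "pb1 V tgt src" pairs "pb2 V tgt src"])
    show "m' \<in> Hom V pairs ar" using m' by blast
    show "m \<in> Hom V pairs ar" by (rule m(1))
    show "tgt \<cdot> pb1 V tgt src = src \<cdot> pb2 V tgt src" by (rule pb_commutes) simp_all
    fix A B D W z f g y
    assume o: "A \<in> VObj C" "B \<in> VObj C" "D \<in> VObj C" and z: "z \<in> Hom V W pairs"
      and f: "f \<in> Hom V W (VHom C A B)" and g: "g \<in> Hom V W (VHom C B D)" and y: "y \<in> Hom V W (VFObj F D)"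
      and p: "pb1 V tgt src \<cdot> z = lift_arrow A B f (ev B D \<cdot> pairing V g y)"
      and q: "pb2 V tgt src \<cdot> z = lift_arrow B D g y"
    let ?z = "pairing V (pairing V f g) y" and ?i = "el_pair_incl V C F A B D"
    note i = pair_incl[OF o f g y]
    have zz: "?z \<in> Hom V W (product V (product V (VHom C A B) (VHom C B D)) (VFObj F D))"
      using o f g y by (simp add: Hom_iff)
    have "z = pb_lift V tgt src (pb1 V tgt src \<cdot> z) (pb2 V tgt src \<cdot> z)"
      using pb_lift_comp[of tgt src "pb1 V tgt src" "pb2 V tgt src" z] z by (simp add: pb_commutes Hom_iff)
    then have zi: "z = ?i \<cdot> ?z" unfolding i(2) p q .
    have "m' \<cdot> ?i = m \<cdot> ?i" using m' cm o by simp
    then have "(m' \<cdot> ?i) \<cdot> ?z = (m \<cdot> ?i) \<cdot> ?z" by simp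
    then show "m' \<cdot> z = m \<cdot> z"
      unfolding zi using m' m(1) i(1) comp_assoc[OF zz i(1)] by metis
  qed (simp_all add: Hom_iff)
  have "el_cmp V C F = m"
    unfolding el_cmp_def using cm unique by (rule the_equality)
  then show "el_cmp V C F \<in> Hom V pairs ar"
    "A \<in> VObj C \<Longrightarrow> B \<in> VObj C \<Longrightarrow> D \<in> VObj C \<Longrightarrow>
      el_cmp V C F \<cdot> el_pair_incl V C F A B D
        = el_ar_incl V C F A D \<cdot> prod_map V (VComp C A B D) (Ident V (VFObj F D))"
    using cm by auto
qed

abbreviation "\<E> \<equiv> elements V C F"

lemma elements_sel [simp]:
  "Ob \<E> = ob" "Ar \<E> = ar" "Src \<E> = src" "Tgt \<E> = tgt" "Idn \<E> = el_idn V C F" "Cmp \<E> = el_cmp V C F"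
  by (simp_all add: elements_def)

lemma icomp_elements_Hom:
  assumes "p \<in> Hom V Z ar" "q \<in> Hom V Z ar" "tgt \<cdot> p = src \<cdot> q"
  shows "icomp V \<E> p q \<in> Hom V Z ar"
  using assms el_cmp_Hom by (simp add: icomp_def Hom_iff)

lemma icomp_elements_comp:
  assumes "p \<in> Hom V Z ar" "q \<in> Hom V Z ar" "tgt \<cdot> p = src \<cdot> q" "z \<in> Hom V W Z"
  shows "icomp V \<E> p q \<cdot> z = icomp V \<E> (p \<cdot> z) (q \<cdot> z)"
  using assms el_cmp_Hom by (simp add: icomp_def Hom_iff pb_lift_comp)

lemma icomp_lift:
  assumes o: "A \<in> VObj C" "B \<in> VObj C" "D \<in> VObj C"
    and f: "f \<in> Hom V Z (VHom C A B)" and g: "g \<in> Hom V Z (VHom C B D)" and y: "y \<in> Hom V Z (VFObj F D)"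
  shows "icomp V \<E> (lift_arrow A B f (ev B D \<cdot> pairing V g y)) (lift_arrow B D g y)
    = lift_arrow A D (VComp C A B D \<cdot> pairing V f g) y"
proof -
  let ?z = "pairing V (pairing V f g) y" and ?i = "el_pair_incl V C F A B D"
  note i = pair_incl[OF o f g y]
  have zz: "?z \<in> Hom V Z (product V (product V (VHom C A B) (VHom C B D)) (VFObj F D))"
    using o f g y by (simp add: Hom_iff)
  have "icomp V \<E> (lift_arrow A B f (ev B D \<cdot> pairing V g y)) (lift_arrow B D g y)
      = (el_cmp V C F \<cdot> ?i) \<cdot> ?z"
    unfolding icomp_def elements_sel i(2)[symmetric] using comp_assoc[OF zz i(1) el_cmp_Hom] by simp
  also have "\<dots> = lift_arrow A D (VComp C A B D \<cdot> pairing V f g) y"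
    unfolding el_cmp(2)[OF o] using o f g y by (simp add: lift_arrow_def Hom_iff)
  finally show ?thesis .
qed

lemma src_tgt_icomp:
  assumes p: "p \<in> Hom V Z ar" and q: "q \<in> Hom V Z ar" and pq: "tgt \<cdot> p = src \<cdot> q"
  shows "src \<cdot> icomp V \<E> p q = src \<cdot> p" "tgt \<cdot> icomp V \<E> p q = tgt \<cdot> q"
proof -
  note h = icomp_elements_Hom[OF p q pq]
  have st: "(src \<cdot> icomp V \<E> p q) \<cdot> z = (src \<cdot> p) \<cdot> z \<and> (tgt \<cdot> icomp V \<E> p q) \<cdot> z = (tgt \<cdot> q) \<cdot> z"
    if o: "A \<in> VObj C" "B \<in> VObj C" "D \<in> VObj C" and z: "z \<in> Hom V W Z"
      and f: "f \<in> Hom V W (VHom C A B)" and g: "g \<in> Hom V W (VHom C B D)" and y: "y \<in> Hom V W (VFObj F D)"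
      and pz: "p \<cdot> z = lift_arrow A B f (ev B D \<cdot> pairing V g y)"
      and qz: "q \<cdot> z = lift_arrow B D g y" for A B D W z f g y
  proof -
    have fg: "VComp C A B D \<cdot> pairing V f g \<in> Hom V W (VHom C A D)" using o f g by (simp add: Hom_iff)
    have i: "icomp V \<E> p q \<cdot> z = lift_arrow A D (VComp C A B D \<cdot> pairing V f g) y"
      unfolding icomp_elements_comp[OF p q pq z] pz qz by (rule icomp_lift[OF o f g y])
    have a: "(src \<cdot> icomp V \<E> p q) \<cdot> z = src \<cdot> (icomp V \<E> p q \<cdot> z)" "(src \<cdot> p) \<cdot> z = src \<cdot> (p \<cdot> z)"
      "(tgt \<cdot> icomp V \<E> p q) \<cdot> z = tgt \<cdot> (icomp V \<E> p q \<cdot> z)" "(tgt \<cdot> q) \<cdot> z = tgt \<cdot> (q \<cdot> z)"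
      using h p q z by (simp_all add: Hom_iff)
    show ?thesis
      unfolding a i pz qz src_tgt_lift[OF o(1,3) fg y] src_tgt_lift(2)[OF o(2,3) g y]
        src_tgt_lift(1)[OF o(1,2) f action_Hom[OF o(2,3) g y]] action_comp[OF o f g y] by simp
  qed
  have H: "src \<cdot> icomp V \<E> p q \<in> Hom V Z ob" "src \<cdot> p \<in> Hom V Z ob"
    "tgt \<cdot> icomp V \<E> p q \<in> Hom V Z ob" "tgt \<cdot> q \<in> Hom V Z ob"
    using h p q by (simp_all add: Hom_iff)
  show "src \<cdot> icomp V \<E> p q = src \<cdot> p" "tgt \<cdot> icomp V \<E> p q = tgt \<cdot> q"
    using composable_cover[OF p q pq H(1,2)] composable_cover[OF p q pq H(3,4)] st by blast+
qed

lemma icomp_elements_assoc: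
  assumes p: "p \<in> Hom V Z ar" and q: "q \<in> Hom V Z ar" and r: "r \<in> Hom V Z ar"
    and pq: "tgt \<cdot> p = src \<cdot> q" and qr: "tgt \<cdot> q = src \<cdot> r"
  shows "icomp V \<E> (icomp V \<E> p q) r = icomp V \<E> p (icomp V \<E> q r)"
proof -
  note h = icomp_elements_Hom[OF p q pq] and S = src_tgt_icomp[OF p q pq]
    and j = icomp_elements_Hom[OF q r qr]
  have pj: "tgt \<cdot> p = src \<cdot> icomp V \<E> q r" using pq src_tgt_icomp[OF q r qr] by simp
  have hr: "tgt \<cdot> icomp V \<E> p q = src \<cdot> r" using S qr by simp
  note l = icomp_elements_Hom[OF h r hr] and m = icomp_elements_Hom[OF p j pj]
  show "icomp V \<E> (icomp V \<E> p q) r = icomp V \<E> p (icomp V \<E> q r)"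
  proof (rule composable_cover[OF q r qr l m])
    fix B D E W z g k y
    assume BDE: "B \<in> VObj C" "D \<in> VObj C" "E \<in> VObj C" and z: "z \<in> Hom V W Z"
      and g: "g \<in> Hom V W (VHom C B D)" and k: "k \<in> Hom V W (VHom C D E)" and y: "y \<in> Hom V W (VFObj F E)"
      and qz: "q \<cdot> z = lift_arrow B D g (ev D E \<cdot> pairing V k y)"
      and rz: "r \<cdot> z = lift_arrow D E k y"
    show "icomp V \<E> (icomp V \<E> p q) r \<cdot> z = icomp V \<E> p (icomp V \<E> q r) \<cdot> z"
    proof (rule ar_cover[OF comp_in_Hom[OF z p] comp_in_Hom[OF z l] comp_in_Hom[OF z m]])
      fix A B' W' w f y'
      assume A: "A \<in> VObj C" and B': "B' \<in> VObj C" and w: "w \<in> Hom V W' W"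
        and f: "f \<in> Hom V W' (VHom C A B')" and y': "y' \<in> Hom V W' (VFObj F B')"
        and pzw': "(p \<cdot> z) \<cdot> w = lift_arrow A B' f y'"
      let ?g = "g \<cdot> w" and ?k = "k \<cdot> w" and ?y = "y \<cdot> w"
      have zw: "z \<cdot> w \<in> Hom V W' Z" using w z by (rule comp_in_Hom)
      have gky: "?g \<in> Hom V W' (VHom C B D)" "?k \<in> Hom V W' (VHom C D E)" "?y \<in> Hom V W' (VFObj F E)"
        using w g k y by (auto intro: comp_in_Hom)
      have ky: "ev D E \<cdot> pairing V ?k ?y \<in> Hom V W' (VFObj F D)" by (rule action_Hom[OF BDE(2,3) gky(2,3)])
      have gk: "VComp C B D E \<cdot> pairing V ?g ?k \<in> Hom V W' (VHom C B E)"
        using BDE gky by (simp add: Hom_iff)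
      have pzw: "p \<cdot> (z \<cdot> w) = lift_arrow A B' f y'" using comp_assoc[OF w z p] pzw' by simp
      have rzw: "r \<cdot> (z \<cdot> w) = lift_arrow D E ?k ?y"
        using comp_assoc[OF w z r] rz lift_arrow_comp[OF BDE(2,3) k y w] by simp
      have qzw: "q \<cdot> (z \<cdot> w) = lift_arrow B D ?g (ev D E \<cdot> pairing V ?k ?y)"
        using comp_assoc[OF w z q] qz lift_arrow_comp[OF BDE(1,2) g action_Hom[OF BDE(2,3) k y] w]
          BDE k y w by (simp add: Hom_iff)
      have L: "icomp V \<E> (icomp V \<E> p q) r \<cdot> (z \<cdot> w)
          = icomp V \<E> (icomp V \<E> (p \<cdot> (z \<cdot> w)) (q \<cdot> (z \<cdot> w))) (r \<cdot> (z \<cdot> w))"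
        unfolding icomp_elements_comp[OF h r hr zw] icomp_elements_comp[OF p q pq zw] ..
      have M: "icomp V \<E> p (icomp V \<E> q r) \<cdot> (z \<cdot> w)
          = icomp V \<E> (p \<cdot> (z \<cdot> w)) (icomp V \<E> (q \<cdot> (z \<cdot> w)) (r \<cdot> (z \<cdot> w)))"
        unfolding icomp_elements_comp[OF p j pj zw] icomp_elements_comp[OF q r qr zw] ..
      have "tgt \<cdot> (p \<cdot> (z \<cdot> w)) = src \<cdot> (q \<cdot> (z \<cdot> w))"
        using comp_cong_right[OF pq, of "z \<cdot> w"] p q zw by (simp add: Hom_iff)
      then have "\<iota> B' \<cdot> y' = \<iota> B \<cdot> (ev B D \<cdot> pairing V ?g (ev D E \<cdot> pairing V ?k ?y))"
        unfolding pzw qzw src_tgt_lift(2)[OF A B' f y'] src_tgt_lift(1)[OF BDE(1,2) gky(1) ky] .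
      then have "(B' = B \<and> y' = ev B D \<cdot> pairing V ?g (ev D E \<cdot> pairing V ?k ?y)) \<or> is_initial V W'"
        using incl_disjoint[OF B' BDE(1) y' action_Hom[OF BDE(1,2) gky(1) ky]] by blast
      then have "icomp V \<E> (icomp V \<E> p q) r \<cdot> (z \<cdot> w) = icomp V \<E> p (icomp V \<E> q r) \<cdot> (z \<cdot> w)"
      proof
        assume "is_initial V W'"
        then show ?thesis using initial_comp_eq zw l m by blast
      next
        assume e: "B' = B \<and> y' = ev B D \<cdot> pairing V ?g (ev D E \<cdot> pairing V ?k ?y)"
        then have BB: "B' = B" and y'e: "y' = ev B D \<cdot> pairing V ?g (ev D E \<cdot> pairing V ?k ?y)" by auto
        note f = f[unfolded BB]
        have fg: "VComp C A B D \<cdot> pairing V f ?g \<in> Hom V W' (VHom C A D)"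
          using A BDE f gky by (simp add: Hom_iff)
        have y'': "y' = ev B E \<cdot> pairing V (VComp C B D E \<cdot> pairing V ?g ?k) ?y"
          unfolding y'e by (rule action_comp[OF BDE gky, symmetric])
        have "icomp V \<E> (icomp V \<E> p q) r \<cdot> (z \<cdot> w)
            = icomp V \<E> (lift_arrow A D (VComp C A B D \<cdot> pairing V f ?g) (ev D E \<cdot> pairing V ?k ?y))
                (lift_arrow D E ?k ?y)"
          unfolding L pzw qzw rzw BB y'e icomp_lift[OF A BDE(1,2) f gky(1) ky] ..
        also have "\<dots> = lift_arrow A E (VComp C A D E \<cdot> pairing V (VComp C A B D \<cdot> pairing V f ?g) ?k) ?y"
          by (rule icomp_lift[OF A BDE(2,3) fg gky(2,3)])
        also have "\<dots> = lift_arrow A E (VComp C A B E \<cdot> pairing V f (VComp C B D E \<cdot> pairing V ?g ?k)) ?y"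
          unfolding vcomp_assoc'[OF A BDE f gky(1,2)] ..
        also have "\<dots> = icomp V \<E> p (icomp V \<E> q r) \<cdot> (z \<cdot> w)"
          unfolding M qzw rzw icomp_lift[OF BDE gky] pzw BB y''
          by (rule icomp_lift[OF A BDE(1,3) f gk gky(3), symmetric])
        finally show ?thesis .
      qed
      then show "(icomp V \<E> (icomp V \<E> p q) r \<cdot> z) \<cdot> w = (icomp V \<E> p (icomp V \<E> q r) \<cdot> z) \<cdot> w"
        using comp_assoc[OF w z l] comp_assoc[OF w z m] by simp
    qed
  qed
qed

lemma src_tgt_idn:
  assumes u: "u \<in> Hom V W ob"
  shows "src \<cdot> (el_idn V C F \<cdot> u) = u" "tgt \<cdot> (el_idn V C F \<cdot> u) = u"
proof -
  have H: "src \<cdot> (el_idn V C F \<cdot> u) \<in> Hom V W ob" "tgt \<cdot> (el_idn V C F \<cdot> u) \<in> Hom V W ob"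
    using u idn_Hom by (simp_all add: Hom_iff)
  have "(src \<cdot> (el_idn V C F \<cdot> u)) \<cdot> z = u \<cdot> z \<and> (tgt \<cdot> (el_idn V C F \<cdot> u)) \<cdot> z = u \<cdot> z"
    if A: "A \<in> VObj C" and z: "z \<in> Hom V W' W" and y: "y \<in> Hom V W' (VFObj F A)"
      and uz: "u \<cdot> z = \<iota> A \<cdot> y" for A W' z y
  proof -
    have b: "VId C A \<cdot> bang V W' \<in> Hom V W' (VHom C A A)" using A y by (simp add: Hom_iff)
    have "(src \<cdot> (el_idn V C F \<cdot> u)) \<cdot> z = src \<cdot> (el_idn V C F \<cdot> (u \<cdot> z))"
      "(tgt \<cdot> (el_idn V C F \<cdot> u)) \<cdot> z = tgt \<cdot> (el_idn V C F \<cdot> (u \<cdot> z))"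
      using u z idn_Hom by (simp_all add: Hom_iff)
    then show ?thesis
      unfolding uz idn_incl(2)[OF A y] src_tgt_lift[OF A A b y] action_id[OF A y] by simp
  qed
  then show "src \<cdot> (el_idn V C F \<cdot> u) = u" "tgt \<cdot> (el_idn V C F \<cdot> u) = u"
    using local_eq[OF small_same coproduct_ob u H(1) u] local_eq[OF small_same coproduct_ob u H(2) u]
    by blast+
qed

lemma icomp_elements_idn:
  assumes p: "p \<in> Hom V Z ar"
  shows "icomp V \<E> (el_idn V C F \<cdot> (src \<cdot> p)) p = p" "icomp V \<E> p (el_idn V C F \<cdot> (tgt \<cdot> p)) = p"
proof -
  have i1: "el_idn V C F \<cdot> (src \<cdot> p) \<in> Hom V Z ar" "el_idn V C F \<cdot> (tgt \<cdot> p) \<in> Hom V Z ar"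
    using p idn_Hom by (simp_all add: Hom_iff)
  have sp: "src \<cdot> p \<in> Hom V Z ob" "tgt \<cdot> p \<in> Hom V Z ob" using p by (simp_all add: Hom_iff)
  have c: "tgt \<cdot> (el_idn V C F \<cdot> (src \<cdot> p)) = src \<cdot> p" "tgt \<cdot> p = src \<cdot> (el_idn V C F \<cdot> (tgt \<cdot> p))"
    using src_tgt_idn[OF sp(1)] src_tgt_idn[OF sp(2)] by simp_all
  have u: "icomp V \<E> (el_idn V C F \<cdot> (src \<cdot> p)) p \<cdot> z = p \<cdot> z \<and>
      icomp V \<E> p (el_idn V C F \<cdot> (tgt \<cdot> p)) \<cdot> z = p \<cdot> z"
    if A: "A \<in> VObj C" and B: "B \<in> VObj C" and z: "z \<in> Hom V W Z" and f: "f \<in> Hom V W (VHom C A B)"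
      and y: "y \<in> Hom V W (VFObj F B)" and pz: "p \<cdot> z = lift_arrow A B f y" for A B W z f y
  proof -
    have fy: "ev A B \<cdot> pairing V f y \<in> Hom V W (VFObj F A)" by (rule action_Hom[OF A B f y])
    have W: "W \<in> Obj V" using z by (simp add: Hom_iff)
    have iA: "VId C A \<cdot> bang V W \<in> Hom V W (VHom C A A)" "VId C B \<cdot> bang V W \<in> Hom V W (VHom C B B)"
      using A B W by (simp_all add: Hom_iff)
    have "(el_idn V C F \<cdot> (src \<cdot> p)) \<cdot> z = el_idn V C F \<cdot> (src \<cdot> (p \<cdot> z))"
      "(el_idn V C F \<cdot> (tgt \<cdot> p)) \<cdot> z = el_idn V C F \<cdot> (tgt \<cdot> (p \<cdot> z))"
      using p z idn_Hom by (simp_all add: Hom_iff)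
    then have e: "(el_idn V C F \<cdot> (src \<cdot> p)) \<cdot> z = lift_arrow A A (VId C A \<cdot> bang V W) (ev A B \<cdot> pairing V f y)"
      "(el_idn V C F \<cdot> (tgt \<cdot> p)) \<cdot> z = lift_arrow B B (VId C B \<cdot> bang V W) y"
      unfolding pz src_tgt_lift[OF A B f y] idn_incl(2)[OF A fy] idn_incl(2)[OF B y] .
    have "icomp V \<E> (el_idn V C F \<cdot> (src \<cdot> p)) p \<cdot> z = lift_arrow A B f y"
      unfolding icomp_elements_comp[OF i1(1) p c(1) z] e pz icomp_lift[OF A A B iA(1) f y]
        vcomp_id[OF A B f] ..
    moreover have "icomp V \<E> p (el_idn V C F \<cdot> (tgt \<cdot> p)) \<cdot> z = lift_arrow A B f y"
      unfolding icomp_elements_comp[OF p i1(2) c(2) z] e pz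
      using icomp_lift[OF A B B f iA(2) y] unfolding action_id[OF B y] vcomp_id[OF A B f] .
    ultimately show ?thesis unfolding pz by blast
  qed
  show "icomp V \<E> (el_idn V C F \<cdot> (src \<cdot> p)) p = p" "icomp V \<E> p (el_idn V C F \<cdot> (tgt \<cdot> p)) = p"
    using ar_cover[OF p icomp_elements_Hom[OF i1(1) p c(1)] p]
      ar_cover[OF p icomp_elements_Hom[OF p i1(2) c(2)] p] u by blast+
qed

lemma internal_category_elements: "internal_category V \<E>"
  by (rule internal_category_elementwiseI; (unfold elements_sel)?)
     (use src_tgt_Hom idn_Hom el_cmp_Hom src_tgt_icomp icomp_elements_assoc icomp_elements_idn
        src_tgt_idn[of "Ident V ob" ob] in \<open>auto simp: Hom_iff\<close>)

text \<open>Cut the stage along \<open>h\<close>. On the piece over \<open>(A, B)\<close> the first coordinate of \<open>h\<close> is the required element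
\<open>f\<close>. The other pieces are initial, because the source or the target of \<open>h\<close> lies in the wrong summand, and
hence carry a unique \<open>f\<close>. These pieces of \<open>f\<close> glue.\<close>

lemma arrow_between:
  assumes A: "A \<in> VObj C" and B: "B \<in> VObj C" and h: "h \<in> Hom V Z ar"
    and u: "u \<in> Hom V Z (VFObj F A)" and y: "y \<in> Hom V Z (VFObj F B)"
    and sh: "src \<cdot> h = \<iota> A \<cdot> u" and th: "tgt \<cdot> h = \<iota> B \<cdot> y"
  obtains f where "f \<in> Hom V Z (VHom C A B)" "h = lift_arrow A B f y"
proof -
  let ?K = "VObj C \<times> VObj C"
  obtain Z' \<kappa> f y' where cop: "is_coproduct V ?K Z' (Z, \<kappa>)"
    and k: "\<And>k. k \<in> ?K \<Longrightarrow> \<kappa> k \<in> Hom V (Z' k) Z"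
    and hk: "\<And>A B. A \<in> VObj C \<Longrightarrow> B \<in> VObj C \<Longrightarrow> f (A, B) \<in> Hom V (Z' (A, B)) (VHom C A B) \<and>
      y' (A, B) \<in> Hom V (Z' (A, B)) (VFObj F B) \<and>
      h \<cdot> \<kappa> (A, B) = lift_arrow A B (f (A, B)) (y' (A, B))"
    using decompose_ar[OF h] by blast
  have "\<exists>f\<in>Hom V (Z' k) (VHom C A B). h \<cdot> \<kappa> k = lift_arrow A B f (y \<cdot> \<kappa> k)" if kK: "k \<in> ?K" for k
  proof -
    obtain A' B' where AB: "k = (A', B')" "A' \<in> VObj C" "B' \<in> VObj C" using kK by auto
    let ?f = "f k" and ?y = "y' k"
    have fy: "?f \<in> Hom V (Z' k) (VHom C A' B')" "?y \<in> Hom V (Z' k) (VFObj F B')"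
      and hf: "h \<cdot> \<kappa> k = lift_arrow A' B' ?f ?y"
      using hk[OF AB(2,3)] AB(1) by simp_all
    have uk: "u \<cdot> \<kappa> k \<in> Hom V (Z' k) (VFObj F A)" "y \<cdot> \<kappa> k \<in> Hom V (Z' k) (VFObj F B)"
      using k[OF kK] u y by (auto intro: comp_in_Hom)
    have "src \<cdot> (h \<cdot> \<kappa> k) = \<iota> A \<cdot> (u \<cdot> \<kappa> k)" "tgt \<cdot> (h \<cdot> \<kappa> k) = \<iota> B \<cdot> (y \<cdot> \<kappa> k)"
      using comp_cong_right[OF sh, of "\<kappa> k"] comp_cong_right[OF th, of "\<kappa> k"] k[OF kK] h u y A B
      by (simp_all add: Hom_iff)
    then have "\<iota> A' \<cdot> (ev A' B' \<cdot> pairing V ?f ?y) = \<iota> A \<cdot> (u \<cdot> \<kappa> k)" "\<iota> B' \<cdot> ?y = \<iota> B \<cdot> (y \<cdot> \<kappa> k)"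
      unfolding hf src_tgt_lift[OF AB(2,3) fy] .
    then have "(A' = A \<and> B' = B \<and> ?y = y \<cdot> \<kappa> k) \<or> is_initial V (Z' k)"
      using incl_disjoint[OF AB(2) A action_Hom[OF AB(2,3) fy] uk(1)]
        incl_disjoint[OF AB(3) B fy(2) uk(2)] by blast
    then show ?thesis
    proof
      assume "A' = A \<and> B' = B \<and> ?y = y \<cdot> \<kappa> k"
      then show ?thesis using fy(1) hf by metis
    next
      assume i: "is_initial V (Z' k)"
      then obtain f where f: "f \<in> Hom V (Z' k) (VHom C A B)" using initial_ex A B F.hom_simps(4) by metis
      have "h \<cdot> \<kappa> k = lift_arrow A B f (y \<cdot> \<kappa> k)"
        by (rule initial_eq[OF i comp_in_Hom[OF k[OF kK] h] lift_arrow_Hom[OF A B f uk(2)]])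
      then show ?thesis using f by blast
    qed
  qed
  then obtain f' where f': "\<And>k. k \<in> ?K \<Longrightarrow> f' k \<in> Hom V (Z' k) (VHom C A B)"
      "\<And>k. k \<in> ?K \<Longrightarrow> h \<cdot> \<kappa> k = lift_arrow A B (f' k) (y \<cdot> \<kappa> k)" by metis
  obtain f where f: "f \<in> Hom V Z (VHom C A B)" "\<And>k. k \<in> ?K \<Longrightarrow> f \<cdot> \<kappa> k = f' k"
    using is_coproduct_ex[OF cop F.hom_simps(4)[OF A B] f'(1)] by blast
  have "h = lift_arrow A B f y"
    by (rule is_coproduct_ext[OF cop h lift_arrow_Hom[OF A B f(1) y]])
       (use f f'(2) lift_arrow_comp[OF A B f(1) y k] in simp)
  then show ?thesis using that f(1) by blast
qed

end

section \<open>Terminal generalized elements\<close>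

locale pointed_presheaf_elements =
  presheaf_elements V C F I_type + pointed_presheaf V C F c x
  for V :: "('o, 'a) cat" (structure) and C :: "('i, 'o, 'a) vcat" and F :: "('i, 'o, 'a) vfun"
    and I_type :: "'i itself" and c :: 'i and x :: 'a
begin

definition unique_arrow_to :: "'o \<Rightarrow> bool" where
  "unique_arrow_to Z \<longleftrightarrow> (\<forall>a\<in>Hom V Z ob.
    \<exists>!k. k \<in> Hom V Z ar \<and> src \<cdot> k = a \<and> tgt \<cdot> k = (\<iota> c \<cdot> x) \<cdot> bang V Z)"

lemma point: "Z \<in> Obj V \<Longrightarrow> x \<cdot> bang V Z \<in> Hom V Z (VFObj F c)"
  "Z \<in> Obj V \<Longrightarrow> (\<iota> c \<cdot> x) \<cdot> bang V Z = \<iota> c \<cdot> (x \<cdot> bang V Z)"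
  by (simp_all add: Hom_iff)

lemma lift_point:
  assumes "A \<in> VObj C" "f \<in> Hom V Z (VHom C A c)"
  shows "lift_arrow A c f (x \<cdot> bang V Z) \<in> Hom V Z ar"
    "src \<cdot> lift_arrow A c f (x \<cdot> bang V Z) = \<iota> A \<cdot> (\<alpha> A \<cdot> f)"
    "tgt \<cdot> lift_arrow A c f (x \<cdot> bang V Z) = (\<iota> c \<cdot> x) \<cdot> bang V Z"
proof -
  have Z: "Z \<in> Obj V" using assms by (simp add: Hom_iff)
  show "lift_arrow A c f (x \<cdot> bang V Z) \<in> Hom V Z ar"
    by (rule lift_arrow_Hom[OF assms(1) c assms(2) point(1)[OF Z]])
  show "src \<cdot> lift_arrow A c f (x \<cdot> bang V Z) = \<iota> A \<cdot> (\<alpha> A \<cdot> f)"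
    "tgt \<cdot> lift_arrow A c f (x \<cdot> bang V Z) = (\<iota> c \<cdot> x) \<cdot> bang V Z"
    unfolding src_tgt_lift[OF assms(1) c assms(2) point(1)[OF Z]] act_on_comp[OF assms] point(2)[OF Z]
    by (rule refl)+
qed

text \<open>An arrow from \<open>(A, u)\<close> to \<open>(c, x)\<close> is an element \<open>f\<close> with \<open>f \<cdot> x = u\<close>, that is, with \<open>\<alpha> A \<cdot> f = u\<close>. The inverses
of the \<open>\<alpha> A\<close> therefore assemble to a universal such arrow, at the stage \<open>\<Squnion> F A\<close>.\<close>

lemma unique_arrow_if_isos:
  assumes iso: "\<forall>A\<in>VObj C. is_iso V (\<alpha> A)" and Z: "Z \<in> Obj V"
  shows "unique_arrow_to Z"
  unfolding unique_arrow_to_def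
proof
  fix a assume a: "a \<in> Hom V Z ob"
  have "\<forall>A\<in>VObj C. \<exists>k. k \<in> Hom V (VFObj F A) (VHom C A c) \<and> \<alpha> A \<cdot> k = Ident V (VFObj F A)"
    using is_isoE[OF bspec[OF iso] act_on_Hom] by metis
  then obtain i where i: "\<And>A. A \<in> VObj C \<Longrightarrow> i A \<in> Hom V (VFObj F A) (VHom C A c)"
      "\<And>A. A \<in> VObj C \<Longrightarrow> \<alpha> A \<cdot> i A = Ident V (VFObj F A)" by metis
  \<comment> \<open>the arrow from the generic element of \<open>F A\<close> to \<open>(c, x)\<close>\<close>
  let ?l = "\<lambda>A. lift_arrow A c (i A) (x \<cdot> bang V (VFObj F A))"
  obtain k where k: "k \<in> Hom V ob ar" "\<And>A. A \<in> VObj C \<Longrightarrow> k \<cdot> \<iota> A = ?l A"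
    using is_coproduct_ex[OF coproduct_ob ob_ar_Obj(2) lift_point(1)[OF _ i(1)]] by blast
  have obH: "\<iota> A \<in> Hom V (VFObj F A) ob" if "A \<in> VObj C" for A using that by (simp add: Hom_iff)
  have I: "Ident V ob \<in> Hom V ob ob" "(\<iota> c \<cdot> x) \<cdot> bang V ob \<in> Hom V ob ob" by (simp_all add: Hom_iff)
  have sk: "src \<cdot> k = Ident V ob"
  proof (rule is_coproduct_ext[OF coproduct_ob comp_in_Hom[OF k(1) src_tgt_Hom(1)] I(1)])
    fix A assume A: "A \<in> VObj C"
    have "(src \<cdot> k) \<cdot> \<iota> A = src \<cdot> ?l A" using comp_assoc[OF obH[OF A] k(1) src_tgt_Hom(1)] k(2)[OF A] by simp
    also have "\<dots> = Ident V ob \<cdot> \<iota> A"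
      unfolding lift_point(2)[OF A i(1)[OF A]] i(2)[OF A] using A by simp
    finally show "(src \<cdot> k) \<cdot> \<iota> A = Ident V ob \<cdot> \<iota> A" .
  qed
  have tk: "tgt \<cdot> k = (\<iota> c \<cdot> x) \<cdot> bang V ob"
  proof (rule is_coproduct_ext[OF coproduct_ob comp_in_Hom[OF k(1) src_tgt_Hom(2)] I(2)])
    fix A assume A: "A \<in> VObj C"
    have "(tgt \<cdot> k) \<cdot> \<iota> A = tgt \<cdot> ?l A" using comp_assoc[OF obH[OF A] k(1) src_tgt_Hom(2)] k(2)[OF A] by simp
    also have "\<dots> = ((\<iota> c \<cdot> x) \<cdot> bang V ob) \<cdot> \<iota> A"
      unfolding lift_point(3)[OF A i(1)[OF A]] using A by simp
    finally show "(tgt \<cdot> k) \<cdot> \<iota> A = ((\<iota> c \<cdot> x) \<cdot> bang V ob) \<cdot> \<iota> A" .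
  qed
  show "\<exists>!k. k \<in> Hom V Z ar \<and> src \<cdot> k = a \<and> tgt \<cdot> k = (\<iota> c \<cdot> x) \<cdot> bang V Z"
  proof (rule ex_ex1I)
    have "k \<cdot> a \<in> Hom V Z ar" using a k(1) by (rule comp_in_Hom)
    moreover have "src \<cdot> (k \<cdot> a) = a" using comp_cong_right[OF sk, of a] a k(1) by (simp add: Hom_iff)
    moreover have "tgt \<cdot> (k \<cdot> a) = (\<iota> c \<cdot> x) \<cdot> bang V Z"
      using comp_cong_right[OF tk, of a] a k(1) by (simp add: Hom_iff)
    ultimately show "\<exists>k. k \<in> Hom V Z ar \<and> src \<cdot> k = a \<and> tgt \<cdot> k = (\<iota> c \<cdot> x) \<cdot> bang V Z" by blast
  next
    fix h h' assume h: "h \<in> Hom V Z ar \<and> src \<cdot> h = a \<and> tgt \<cdot> h = (\<iota> c \<cdot> x) \<cdot> bang V Z"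
      and h': "h' \<in> Hom V Z ar \<and> src \<cdot> h' = a \<and> tgt \<cdot> h' = (\<iota> c \<cdot> x) \<cdot> bang V Z"
    have hH: "h \<in> Hom V Z ar" "h' \<in> Hom V Z ar" using h h' by blast+
    show "h = h'"
    proof (rule local_eq[OF small_same coproduct_ob a hH])
      fix A W z u assume A: "A \<in> VObj C" and z: "z \<in> Hom V W Z" and u: "u \<in> Hom V W (VFObj F A)"
        and az: "a \<cdot> z = \<iota> A \<cdot> u"
      have W: "W \<in> Obj V" using z by (simp add: Hom_iff)
      have ends: "src \<cdot> (m \<cdot> z) = \<iota> A \<cdot> u" "tgt \<cdot> (m \<cdot> z) = \<iota> c \<cdot> (x \<cdot> bang V W)" "m \<cdot> z \<in> Hom V W ar"
        if m: "m \<in> Hom V Z ar \<and> src \<cdot> m = a \<and> tgt \<cdot> m = (\<iota> c \<cdot> x) \<cdot> bang V Z" for m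
      proof -
        show "m \<cdot> z \<in> Hom V W ar" using z m by (blast intro: comp_in_Hom)
        have "src \<cdot> (m \<cdot> z) = a \<cdot> z" using m z by (intro comp_cong_right) (auto simp: Hom_iff)
        then show "src \<cdot> (m \<cdot> z) = \<iota> A \<cdot> u" using az by simp
        have "tgt \<cdot> (m \<cdot> z) = ((\<iota> c \<cdot> x) \<cdot> bang V Z) \<cdot> z" using m z by (intro comp_cong_right) (auto simp: Hom_iff)
        then show "tgt \<cdot> (m \<cdot> z) = \<iota> c \<cdot> (x \<cdot> bang V W)" using z by (simp add: Hom_iff)
      qed
      obtain f where f: "f \<in> Hom V W (VHom C A c)" "h \<cdot> z = lift_arrow A c f (x \<cdot> bang V W)"
        using arrow_between[OF A c ends(3)[OF h] u point(1)[OF W] ends(1,2)[OF h]] by blast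
      obtain f' where f': "f' \<in> Hom V W (VHom C A c)" "h' \<cdot> z = lift_arrow A c f' (x \<cdot> bang V W)"
        using arrow_between[OF A c ends(3)[OF h'] u point(1)[OF W] ends(1,2)[OF h']] by blast
      have fH: "\<alpha> A \<cdot> f \<in> Hom V W (VFObj F A)" "\<alpha> A \<cdot> f' \<in> Hom V W (VFObj F A)"
        using f(1) f'(1) act_on_Hom[OF A] by (auto intro: comp_in_Hom)
      have "\<iota> A \<cdot> (\<alpha> A \<cdot> f) = \<iota> A \<cdot> (\<alpha> A \<cdot> f')"
        using ends(1)[OF h] ends(1)[OF h'] unfolding f(2) f'(2) lift_point(2)[OF A f(1)] lift_point(2)[OF A f'(1)]
        by simp
      then have "\<alpha> A \<cdot> f = \<alpha> A \<cdot> f'" by (rule incl_mono[OF small_same coproduct_ob A fH])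
      then have "f = f'" by (rule iso_cancel_left[OF bspec[OF iso A] act_on_Hom[OF A] f(1) f'(1)])
      then show "h \<cdot> z = h' \<cdot> z" using f(2) f'(2) by simp
    qed
  qed
qed

text \<open>Uniqueness of the arrow out of \<open>(A, u)\<close> makes \<open>\<alpha> A\<close> injective on elements at the stage \<open>Z\<close>, and its existence
makes \<open>\<alpha> A\<close> surjective, since by \<open>arrow_between\<close> any such arrow is an element of \<open>C(A, c)\<close>.\<close>

lemma action_bijective_if_unique_arrow:
  assumes "unique_arrow_to Z" "Z \<in> Obj V" "A \<in> VObj C"
  shows "bij_betw (\<lambda>u. \<alpha> A \<cdot> u) (Hom V Z (VHom C A c)) (Hom V Z (VFObj F A))"
  unfolding bij_betw_def
proof
  show "inj_on (\<lambda>u. \<alpha> A \<cdot> u) (Hom V Z (VHom C A c))"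
  proof (rule inj_onI)
    fix f f' assume f: "f \<in> Hom V Z (VHom C A c)" and f': "f' \<in> Hom V Z (VHom C A c)"
      and e: "\<alpha> A \<cdot> f = \<alpha> A \<cdot> f'"
    have "\<iota> A \<cdot> (\<alpha> A \<cdot> f) \<in> Hom V Z ob" using f act_on_Hom[OF assms(3)] assms(3) by (simp add: Hom_iff)
    then have "\<exists>!k. k \<in> Hom V Z ar \<and> src \<cdot> k = \<iota> A \<cdot> (\<alpha> A \<cdot> f) \<and> tgt \<cdot> k = (\<iota> c \<cdot> x) \<cdot> bang V Z"
      using assms(1) unfolding unique_arrow_to_def by blast
    then have l: "lift_arrow A c f (x \<cdot> bang V Z) = lift_arrow A c f' (x \<cdot> bang V Z)"
      using lift_point[OF assms(3) f] lift_point[OF assms(3) f'] e by auto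
    have p: "pairing V f (x \<cdot> bang V Z) \<in> Hom V Z (el_summand V C F (A, c))"
      "pairing V f' (x \<cdot> bang V Z) \<in> Hom V Z (el_summand V C F (A, c))"
      using f f' point(1)[OF assms(2)] assms(3) by (simp_all add: el_summand_def Hom_iff)
    have "pairing V f (x \<cdot> bang V Z) = pairing V f' (x \<cdot> bang V Z)"
      by (rule incl_mono[OF small_pairs[OF infinite_type] coproduct_ar _ p])
         (use l assms(3) in \<open>simp_all add: lift_arrow_def\<close>)
    then show "f = f'" by (rule pairing_inject(1)[OF _ f point(1)[OF assms(2)] f' point(1)[OF assms(2)]])
  qed
  show "(\<lambda>u. \<alpha> A \<cdot> u) ` Hom V Z (VHom C A c) = Hom V Z (VFObj F A)"
  proof (intro equalityI subsetI)
    fix u assume "u \<in> (\<lambda>u. \<alpha> A \<cdot> u) ` Hom V Z (VHom C A c)"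
    then show "u \<in> Hom V Z (VFObj F A)" using act_on_Hom[OF assms(3)] by (auto intro: comp_in_Hom)
  next
    fix u assume u: "u \<in> Hom V Z (VFObj F A)"
    then have "\<iota> A \<cdot> u \<in> Hom V Z ob" using assms(3) by (simp add: Hom_iff)
    then obtain h where h: "h \<in> Hom V Z ar" "src \<cdot> h = \<iota> A \<cdot> u" "tgt \<cdot> h = (\<iota> c \<cdot> x) \<cdot> bang V Z"
      using assms(1) unfolding unique_arrow_to_def by blast
    obtain f where f: "f \<in> Hom V Z (VHom C A c)" "h = lift_arrow A c f (x \<cdot> bang V Z)"
      using arrow_between[OF assms(3) c h(1) u point(1)[OF assms(2)] h(2)] h(3) point(2)[OF assms(2)]
      by metis
    have "\<iota> A \<cdot> (\<alpha> A \<cdot> f) = \<iota> A \<cdot> u" using h(2) unfolding f(2) lift_point(2)[OF assms(3) f(1)] .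
    then have "\<alpha> A \<cdot> f = u"
      by (rule incl_mono[OF small_same coproduct_ob assms(3) comp_in_Hom[OF f(1) act_on_Hom[OF assms(3)]] u])
    then show "u \<in> (\<lambda>u. \<alpha> A \<cdot> u) ` Hom V Z (VHom C A c)" using f(1) by blast
  qed
qed

lemma terminal_iff:
  assumes X: "X \<in> Obj V"
  shows "v_terminal V (generalized_elements V C F X) (constant_element V C F X c x) \<longleftrightarrow>
    (\<forall>a\<in>Hom V X ob. \<forall>Z\<in>Obj V. \<exists>!k. k \<in> Hom V (product V Z X) ar \<and>
      src \<cdot> k = a \<cdot> pr2 V Z X \<and> tgt \<cdot> k = (\<iota> c \<cdot> x) \<cdot> bang V (product V Z X))"
proof -
  interpret E: elementwise_internal_category V \<E> using internal_category_elements by (rule elementwise)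
  interpret E: internal_category_power V \<E> X by unfold_locales (rule X)
  have "\<iota> c \<cdot> x \<in> Hom V (terminal V) (Ob \<E>)" by (simp add: Hom_iff)
  from E.v_terminal_exponent_iff[OF this] show ?thesis
    unfolding generalized_elements_def constant_element_def elements_sel .
qed

lemma terminal_if_isos:
  assumes "\<forall>A\<in>VObj C. is_iso V (\<alpha> A)" "X \<in> Obj V"
  shows "v_terminal V (generalized_elements V C F X) (constant_element V C F X c x)"
  unfolding terminal_iff[OF assms(2)]
proof (intro ballI)
  fix a Z assume a: "a \<in> Hom V X ob" and Z: "Z \<in> Obj V"
  have "a \<cdot> pr2 V Z X \<in> Hom V (product V Z X) ob" using a Z assms(2) by (simp add: Hom_iff)
  moreover have "unique_arrow_to (product V Z X)" by (rule unique_arrow_if_isos[OF assms(1)]) (simp add: Z assms(2))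
  ultimately show "\<exists>!k. k \<in> Hom V (product V Z X) ar \<and>
      src \<cdot> k = a \<cdot> pr2 V Z X \<and> tgt \<cdot> k = (\<iota> c \<cdot> x) \<cdot> bang V (product V Z X)"
    unfolding unique_arrow_to_def by blast
qed

text \<open>Take the terminal object for the stage \<open>Z\<close>, so that \<open>Z \<times> X\<close> is isomorphic to \<open>X\<close>.\<close>

lemma unique_arrow_if_terminal:
  assumes X: "X \<in> Obj V"
    and t: "v_terminal V (generalized_elements V C F X) (constant_element V C F X c x)"
  shows "unique_arrow_to X"
  unfolding unique_arrow_to_def
proof
  fix a assume a: "a \<in> Hom V X ob"
  let ?P = "product V (terminal V) X" and ?r = "pr2 V (terminal V) X" and ?s = "pairing V (bang V X) (Ident V X)"
  have r: "?r \<in> Hom V ?P X" "?s \<in> Hom V X ?P" "?r \<cdot> ?s = Ident V X" using X by (simp_all add: Hom_iff)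
  have "pr1 V (terminal V) X = bang V ?P" by (rule bang_unique) (simp add: X Hom_iff)
  then have "pairing V (bang V ?P) ?r = Ident V ?P" using pairing_pr[OF terminal_Obj X] by simp
  then have sr: "?s \<cdot> ?r = Ident V ?P" using X by (simp add: Hom_iff)
  have "bij_betw (\<lambda>k. k \<cdot> ?r) (Hom V X ar) (Hom V ?P ar)"
    by (rule bij_betwI[where g = "\<lambda>k. k \<cdot> ?s"]) (use r sr in \<open>auto simp: Hom_iff\<close>)
  then have "(\<exists>!k. k \<in> Hom V X ar \<and> src \<cdot> k = a \<and> tgt \<cdot> k = (\<iota> c \<cdot> x) \<cdot> bang V X) \<longleftrightarrow>
      (\<exists>!k. k \<in> Hom V ?P ar \<and> src \<cdot> k = a \<cdot> ?r \<and> tgt \<cdot> k = (\<iota> c \<cdot> x) \<cdot> bang V ?P)"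
  proof (rule ex1_transfer)
    fix k assume k: "k \<in> Hom V X ar"
    have cancel: "u = v" if "u \<cdot> ?r = v \<cdot> ?r" "u \<in> Hom V X ob" "v \<in> Hom V X ob" for u v
    proof -
      have "(u \<cdot> ?r) \<cdot> ?s = (v \<cdot> ?r) \<cdot> ?s" using that(1) by simp
      then show ?thesis
        using comp_assoc[OF r(2,1) that(2)] comp_assoc[OF r(2,1) that(3)] r(3)
          comp_ident_right[OF that(2)] comp_ident_right[OF that(3)] by simp
    qed
    have H: "src \<cdot> k \<in> Hom V X ob" "tgt \<cdot> k \<in> Hom V X ob" "(\<iota> c \<cdot> x) \<cdot> bang V X \<in> Hom V X ob"
      using k X by (simp_all add: Hom_iff)
    have "src \<cdot> (k \<cdot> ?r) = (src \<cdot> k) \<cdot> ?r" "tgt \<cdot> (k \<cdot> ?r) = (tgt \<cdot> k) \<cdot> ?r"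
      "(\<iota> c \<cdot> x) \<cdot> bang V ?P = ((\<iota> c \<cdot> x) \<cdot> bang V X) \<cdot> ?r"
      using k X by (simp_all add: Hom_iff)
    then show "(src \<cdot> k = a \<and> tgt \<cdot> k = (\<iota> c \<cdot> x) \<cdot> bang V X) \<longleftrightarrow>
        (src \<cdot> (k \<cdot> ?r) = a \<cdot> ?r \<and> tgt \<cdot> (k \<cdot> ?r) = (\<iota> c \<cdot> x) \<cdot> bang V ?P)"
      using cancel[OF _ H(1) a] cancel[OF _ H(2,3)] by auto
  qed
  then show "\<exists>!k. k \<in> Hom V X ar \<and> src \<cdot> k = a \<and> tgt \<cdot> k = (\<iota> c \<cdot> x) \<cdot> bang V X"
    using t a unfolding terminal_iff[OF X] by simp
qed

end

theorem theorem4: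
  fixes V :: "('o, 'a) cat" and G :: "'o set"
    and C :: "('i, 'o, 'a) vcat" and F :: "('i, 'o, 'a) vfun" and c :: 'i and x :: 'a
  assumes "infinite (UNIV :: 'i set)"
    and "category V"
    and "extensive TYPE('i) V"
    and "cartesian_closed V"
    and "has_pullbacks V"
    and "conservative_family V G"
    and "v_category V C"
    and "v_presheaf V C F"
    and "c \<in> VObj C"
    and "x \<in> Hom V (terminal V) (VFObj F c)"
  shows "v_representable_by V C F c x \<longleftrightarrow>
    (\<forall>X\<in>G. v_terminal V (generalized_elements V C F X) (constant_element V C F X c x))"
proof -
  interpret category V by fact
  interpret v_category V C by fact
  interpret pointed_presheaf_elements V C F "TYPE('i)" c x
    using assms(1,3-5,8-10) by unfold_locales (auto simp: cartesian_closed_def)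
  have G: "G \<subseteq> Obj V" and cons: "\<And>Y Z f. f \<in> Hom V Y Z \<Longrightarrow>
      is_iso V f \<longleftrightarrow> (\<forall>X\<in>G. bij_betw (\<lambda>u. f \<cdot>\<^bsub>V\<^esub> u) (Hom V X Y) (Hom V X Z))"
    using assms(6) unfolding conservative_family_def by blast+
  show ?thesis
    unfolding representable_iff
  proof
    assume "\<forall>A\<in>VObj C. is_iso V (\<alpha> A)"
    then show "\<forall>X\<in>G. v_terminal V (generalized_elements V C F X) (constant_element V C F X c x)"
      using terminal_if_isos G by blast
  next
    assume "\<forall>X\<in>G. v_terminal V (generalized_elements V C F X) (constant_element V C F X c x)"
    then have "unique_arrow_to X" if "X \<in> G" for X
      using unique_arrow_if_terminal that G by blast
    then show "\<forall>A\<in>VObj C. is_iso V (\<alpha> A)"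
      using cons[OF act_on_Hom] action_bijective_if_unique_arrow G by blast
  qed
qed

end
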